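(* Suppose that $F$ is a field of characteristic zero, and let $\Lambda\in P_+$ and $d\ge0$. Then for $q\in F^\times$ not a root of unity, the cyclotomic Hecke algebra $H^\Lambda_d$ at parameter $q$ is isomorphic (as an $F$-algebra) to the degenerate cyclotomic Hecke algebra $H^\Lambda_d$ (the algebra $H_d^\Lambda$ for $q=1$).
   Context: Here $I=\mathbb Z$; $P_+$ is the set of formal finite sums $\Lambda=\sum_{i\in\mathbb Z}(\Lambda,\alpha_i)\Lambda_i$ with coefficients $(\Lambda,\alpha_i)\in\mathbb Z_{\ge0}$, almost all zero. For $q$ not a root of unity, the affine Hecke algebra $H_d$ is the $F$-algebra with generators $T_1,\dots,T_{d-1},X_1^{\pm1},\dots,X_d^{\pm1}$ and relations (for all admissible indices): $X_r^{\pm1}X_s^{\pm1}=X_s^{\pm1}X_r^{\pm1}$, $X_rX_r^{-1}=1$; $T_rX_rT_r=qX_{r+1}$; $T_rX_s=X_sT_r$ if $s\neq r,r+1$; $T_r^2=(q-1)T_r+q$; $T_rT_{r+1}T_r=T_{r+1}T_rT_{r+1}$; $T_rT_s=T_sT_r$ if $|r-s|>1$. The cyclotomic Hecke algebra $H^\Lambda_d$ at parameter $q$ is the quotient of $H_d$ by the two-sided ideal generated by $\prod_{i\in I}(X_1-q^i)^{(\Lambda,\alpha_i)}$. For $q=1$, the degenerate affine Hecke algebra $H_d$ is the $F$-algebra with generators $s_1,\dots,s_{d-1},x_1,\dots,x_d$ and relations: $x_rx_s=x_sx_r$; $s_rx_{r+1}=x_rs_r+1$; $s_rx_s=x_ss_r$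 if $s\neq r,r+1$; $s_r^2=1$; $s_rs_{r+1}s_r=s_{r+1}s_rs_{r+1}$; $s_rs_t=s_ts_r$ if $|r-t|>1$. The degenerate cyclotomic Hecke algebra is the quotient of this $H_d$ by the two-sided ideal generated by $\prod_{i\in I}(x_1-i)^{(\Lambda,\alpha_i)}$. *)

theory Defs
  imports "HOL-Algebra.Module" "HOL-Algebra.QuotRing" "HOL-Library.Poly_Mapping"
begin

section \<open>Associative algebras over a field\<close>

text \<open>
  The ground field is a type \<open>'f\<close>. An (associative, unital, not necessarily commutative)
  \<open>'f\<close>-algebra is given by a record of type \<open>('f, 'a) module\<close>.
\<close>

definition algebra_iso :: "('f, 'a) module \<Rightarrow> ('f, 'b) module \<Rightarrow> ('a \<Rightarrow> 'b) set"
  where "algebra_iso A B =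
    {h \<in> ring_iso A B. \<forall>c. \<forall>a \<in> carrier A. h (c \<odot>\<^bsub>A\<^esub> a) = c \<odot>\<^bsub>B\<^esub> h a}"

definition algebra_isomorphic :: "('f, 'a) module \<Rightarrow> ('f, 'b) module \<Rightarrow> bool"
  where "algebra_isomorphic A B \<longleftrightarrow> algebra_iso A B \<noteq> {}"

definition quotient_algebra :: "('f, 'a) module \<Rightarrow> 'a set \<Rightarrow> ('f, 'a set) module"
  where "quotient_algebra A I =
    \<lparr>carrier = carrier (A Quot I), mult = mult (A Quot I), one = one (A Quot I),
     zero = zero (A Quot I), add = add (A Quot I),
     smult = (\<lambda>c C. \<Union>a\<in>C. I +>\<^bsub>A\<^esub> (c \<odot>\<^bsub>A\<^esub> a))\<rparr>"


section \<open>Algebras given by generators and relations\<close>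

text \<open>
  Words form a monoid under concatenation, written additively, because the product on
  \<open>\<Rightarrow>\<^sub>0\<close> is the convolution with respect to addition of keys. Hence
  \<open>'g fword \<Rightarrow>\<^sub>0 'f\<close> is the free algebra on \<open>'g\<close>.
\<close>

datatype 'g fword = Word (letters: "'g list")

instantiation fword :: (type) monoid_add
begin

definition zero_fword :: "'a fword"
  where "0 = Word []"

definition plus_fword :: "'a fword \<Rightarrow> 'a fword \<Rightarrow> 'a fword"
  where "v + w = Word (letters v @ letters w)"

instance
  by standard (simp_all add: zero_fword_def plus_fword_def)

end

definition scalar :: "'f::comm_ring_1 \<Rightarrow> ('g fword \<Rightarrow>\<^sub>0 'f)"
  where "scalar c = Poly_Mapping.single 0 c"

definition gen :: "'g \<Rightarrow> ('g fword \<Rightarrow>\<^sub>0 'f::comm_ring_1)"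
  where "gen g = Poly_Mapping.single (Word [g]) 1"

definition free_algebra :: "'g set \<Rightarrow> ('f::comm_ring_1, 'g fword \<Rightarrow>\<^sub>0 'f) module"
  where "free_algebra G =
    \<lparr>carrier = {p. \<forall>w \<in> Poly_Mapping.keys p. set (letters w) \<subseteq> G},
     mult = (*), one = 1, zero = 0, add = (+), smult = (\<lambda>c p. scalar c * p)\<rparr>"

text \<open>A pair \<open>(l, r)\<close> in \<open>R\<close> stands for the relation \<open>l = r\<close>.\<close>

definition relation_ideal ::
    "'g set \<Rightarrow> (('g fword \<Rightarrow>\<^sub>0 'f) \<times> ('g fword \<Rightarrow>\<^sub>0 'f)) set \<Rightarrow> ('g fword \<Rightarrow>\<^sub>0 'f::comm_ring_1) set"
  where "relation_ideal G R = Idl\<^bsub>free_algebra G\<^esub> {l - r |l r. (l, r) \<in> R}"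

definition presented_algebra ::
    "'g set \<Rightarrow> (('g fword \<Rightarrow>\<^sub>0 'f) \<times> ('g fword \<Rightarrow>\<^sub>0 'f)) set \<Rightarrow>
      ('f::comm_ring_1, ('g fword \<Rightarrow>\<^sub>0 'f) set) module"
  where "presented_algebra G R = quotient_algebra (free_algebra G) (relation_ideal G R)"

definition presented_gen ::
    "'g set \<Rightarrow> (('g fword \<Rightarrow>\<^sub>0 'f) \<times> ('g fword \<Rightarrow>\<^sub>0 'f)) set \<Rightarrow> 'g \<Rightarrow> ('g fword \<Rightarrow>\<^sub>0 'f::comm_ring_1) set"
  where "presented_gen G R g = relation_ideal G R +>\<^bsub>free_algebra G\<^esub> gen g"


section \<open>The affine Hecke algebra\<close>

datatype hecke_gen = T_gen nat | X_gen nat | Xinv_gen nat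

abbreviation Th :: "nat \<Rightarrow> (hecke_gen fword \<Rightarrow>\<^sub>0 'f::comm_ring_1)"
  where "Th r \<equiv> gen (T_gen r)"

abbreviation Xh :: "nat \<Rightarrow> (hecke_gen fword \<Rightarrow>\<^sub>0 'f::comm_ring_1)"
  where "Xh r \<equiv> gen (X_gen r)"

abbreviation Xhinv :: "nat \<Rightarrow> (hecke_gen fword \<Rightarrow>\<^sub>0 'f::comm_ring_1)"
  where "Xhinv r \<equiv> gen (Xinv_gen r)"

definition hecke_gens :: "nat \<Rightarrow> hecke_gen set"
  where "hecke_gens d = T_gen ` {1..<d} \<union> X_gen ` {1..d} \<union> Xinv_gen ` {1..d}"

text \<open>The first set makes all pairs of letters \<open>X\<^sub>r\<close>, \<open>X\<^sub>r\<close> inverse commute, for every choice of signs.\<close>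

definition hecke_relations ::
    "nat \<Rightarrow> 'f::field \<Rightarrow> ((hecke_gen fword \<Rightarrow>\<^sub>0 'f) \<times> (hecke_gen fword \<Rightarrow>\<^sub>0 'f)) set"
  where "hecke_relations d q =
    {(a * b, b * a) |a b. a \<in> Xh ` {1..d} \<union> Xhinv ` {1..d} \<and> b \<in> Xh ` {1..d} \<union> Xhinv ` {1..d}} \<union>
    {(Xh r * Xhinv r, 1) |r. r \<in> {1..d}} \<union>
    {(Th r * Xh r * Th r, scalar q * Xh (r + 1)) |r. r \<in> {1..<d}} \<union>
    {(Th r * Xh s, Xh s * Th r) |r s. r \<in> {1..<d} \<and> s \<in> {1..d} \<and> s \<noteq> r \<and> s \<noteq> r + 1} \<union>
    {(Th r * Th r, scalar (q - 1) * Th r + scalar q) |r. r \<in> {1..<d}} \<union>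
    {(Th r * Th (r + 1) * Th r, Th (r + 1) * Th r * Th (r + 1)) |r. r \<in> {1..<d} \<and> r + 1 \<in> {1..<d}} \<union>
    {(Th r * Th s, Th s * Th r) |r s. r \<in> {1..<d} \<and> s \<in> {1..<d} \<and> \<bar>int r - int s\<bar> > 1}"

definition affine_hecke :: "nat \<Rightarrow> 'f::field \<Rightarrow> ('f, (hecke_gen fword \<Rightarrow>\<^sub>0 'f) set) module"
  where "affine_hecke d q = presented_algebra (hecke_gens d) (hecke_relations d q)"


section \<open>The degenerate affine Hecke algebra\<close>

datatype degen_gen = s_gen nat | x_gen nat

abbreviation sd :: "nat \<Rightarrow> (degen_gen fword \<Rightarrow>\<^sub>0 'f::comm_ring_1)"
  where "sd r \<equiv> gen (s_gen r)"

abbreviation xd :: "nat \<Rightarrow> (degen_gen fword \<Rightarrow>\<^sub>0 'f::comm_ring_1)"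
  where "xd r \<equiv> gen (x_gen r)"

definition degen_gens :: "nat \<Rightarrow> degen_gen set"
  where "degen_gens d = s_gen ` {1..<d} \<union> x_gen ` {1..d}"

definition degen_relations ::
    "nat \<Rightarrow> ((degen_gen fword \<Rightarrow>\<^sub>0 'f::field) \<times> (degen_gen fword \<Rightarrow>\<^sub>0 'f)) set"
  where "degen_relations d =
    {(xd r * xd s, xd s * xd r) |r s. r \<in> {1..d} \<and> s \<in> {1..d}} \<union>
    {(sd r * xd (r + 1), xd r * sd r + 1) |r. r \<in> {1..<d}} \<union>
    {(sd r * xd s, xd s * sd r) |r s. r \<in> {1..<d} \<and> s \<in> {1..d} \<and> s \<noteq> r \<and> s \<noteq> r + 1} \<union>
    {(sd r * sd r, 1) |r. r \<in> {1..<d}} \<union>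
    {(sd r * sd (r + 1) * sd r, sd (r + 1) * sd r * sd (r + 1)) |r.
       r \<in> {1..<d} \<and> r + 1 \<in> {1..<d}} \<union>
    {(sd r * sd t, sd t * sd r) |r t. r \<in> {1..<d} \<and> t \<in> {1..<d} \<and> \<bar>int r - int t\<bar> > 1}"

definition degen_affine_hecke :: "nat \<Rightarrow> ('f::field, (degen_gen fword \<Rightarrow>\<^sub>0 'f) set) module"
  where "degen_affine_hecke d = presented_algebra (degen_gens d) (degen_relations d)"


section \<open>Cyclotomic quotients\<close>

text \<open>
  An element \<open>\<Lambda>\<close> of \<open>P\<^sub>+\<close> is a finitely supported function \<open>int \<Rightarrow>\<^sub>0 nat\<close> sending \<open>i\<close> to the
  coefficient of the \<open>i\<close>-th fundamental weight. The product of the \<open>(y - e i)\<close> to the power \<open>\<Lambda> i\<close>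
  is taken in increasing order of \<open>i\<close>; its factors commute with each other.
\<close>

definition cyclotomic_element ::
    "('f, 'a) module \<Rightarrow> (int \<Rightarrow> 'f) \<Rightarrow> (int \<Rightarrow>\<^sub>0 nat) \<Rightarrow> 'a \<Rightarrow> 'a"
  where "cyclotomic_element A e \<Lambda> y =
    foldr (\<lambda>i p. (y \<ominus>\<^bsub>A\<^esub> (e i \<odot>\<^bsub>A\<^esub> \<one>\<^bsub>A\<^esub>)) [^]\<^bsub>A\<^esub> Poly_Mapping.lookup \<Lambda> i \<otimes>\<^bsub>A\<^esub> p)
      (sorted_list_of_set (Poly_Mapping.keys \<Lambda>)) \<one>\<^bsub>A\<^esub>"

text \<open>
  For \<open>d = 0\<close> there is no first polynomial generator, hence no cyclotomic relation, and both
  cyclotomic algebras are the ground field.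
\<close>

definition cyclotomic_hecke ::
    "nat \<Rightarrow> 'f::field \<Rightarrow> (int \<Rightarrow>\<^sub>0 nat) \<Rightarrow> ('f, (hecke_gen fword \<Rightarrow>\<^sub>0 'f) set set) module"
  where "cyclotomic_hecke d q \<Lambda> =
    quotient_algebra (affine_hecke d q) (Idl\<^bsub>affine_hecke d q\<^esub>
      (if d = 0 then {}
       else {cyclotomic_element (affine_hecke d q) (\<lambda>i. q powi i) \<Lambda>
               (presented_gen (hecke_gens d) (hecke_relations d q) (X_gen 1))}))"

definition degen_cyclotomic_hecke ::
    "nat \<Rightarrow> (int \<Rightarrow>\<^sub>0 nat) \<Rightarrow> ('f::field, (degen_gen fword \<Rightarrow>\<^sub>0 'f) set set) module"
  where "degen_cyclotomic_hecke d \<Lambda> =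
    quotient_algebra (degen_affine_hecke d) (Idl\<^bsub>degen_affine_hecke d\<^esub>
      (if d = 0 then {}
       else {cyclotomic_element (degen_affine_hecke d) of_int \<Lambda>
               (presented_gen (degen_gens d) (degen_relations d) (x_gen 1))}))"

end

theory Submission
  imports Defs "HOL-Computational_Algebra.Polynomial"
begin

text \<open>
  On a cyclotomic quotient every \<open>x\<^sub>r\<close> is annihilated by a polynomial whose roots are integers, and every
  \<open>X\<^sub>r\<close> by one whose roots are powers of \<open>q\<close>. Let \<open>E\<close> be a polynomial which near each of the finitely many
  relevant integers \<open>i\<close> agrees to high order with \<open>q\<^sup>i (1 + x - i)\<close>. Then \<open>E(x + 1) = q E(x)\<close> up to terms that
  vanish in the quotient, \<open>E\<close> has a compositional inverse \<open>L\<close> in the same sense, and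
  \<open>h(x, y) = (q E(y) - E(x)) (x - y) / ((E(y) - E(x)) (x - y - 1))\<close> is polynomial and invertible up to such
  terms. The isomorphism sends \<open>X\<^sub>r\<close> to \<open>E(x\<^sub>r)\<close> and \<open>T\<^sub>r + 1\<close> to \<open>(s\<^sub>r + 1) h(x\<^sub>r, x\<^sub>r\<^sub>+\<^sub>1)\<close>; the relations
  reduce to identities between divided differences in the polynomial ring in three variables, where
  denominators can be cancelled. Its inverse has the same shape with \<open>E\<close> and \<open>L\<close> exchanged.
\<close>

section \<open>Coordinate changes between two orbits of affine maps\<close>

text \<open>The annihilating polynomials come from the relations alone: if \<open>f(x_r)\<close>
  vanishes, then at \<open>x_{r+1}\<close> so does the product of two copies of \<open>f\<close> and
  its two shifts along the orbit. Starting from the cyclotomic relation, this bounds roots and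
  multiplicities for every \<open>r\<close> in terms of \<Lambda> and \<open>d\<close>, by the same
  numbers in both algebras, so that \<open>E\<close> and \<open>L\<close> can be fixed in advance.

  The generators \<open>T_r + 1\<close> are preferred to \<open>T_r\<close> because they square to a
  scalar multiple of themselves and pass a polynomial at the cost of a linear factor times its
  divided difference. The change of generators is then right multiplication by \<open>h\<close>
  without additive correction, and the new quadratic and braid relations become conditions on
  \<open>h\<close> alone.

  Since \<open>E\<close> has its properties only up to finite order and each divided difference
  lowers that order by one, the order is tracked through every identity. Treating
  \<open>(q, 0)\<close> and \<open>(1, 1)\<close> as values of one parameter pair lets a single
  transfer statement provide both maps and both inverse laws.\<close>

definition comaximal :: "'a::comm_ring_1 \<Rightarrow> 'a \<Rightarrow> bool"
  where "comaximal a b \<longleftrightarrow> (\<exists>u v. u * a + v * b = 1)"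

lemma comaximal_commute: "comaximal a b \<longleftrightarrow> comaximal b a"
  unfolding comaximal_def by (metis add.commute)

lemma comaximal_mult_right:
  assumes "comaximal a b" "comaximal a c"
  shows "comaximal a (b * c)"
proof -
  obtain u v s t where "u * a + v * b = 1" "s * a + t * c = 1"
    using assms by (auto simp: comaximal_def)
  then have "(u * a + v * b) * (s * a + t * c) = 1"
    by simp
  then have "(u * (s * a + t * c) + v * b * s) * a + (v * t) * (b * c) = 1"
    by (simp add: algebra_simps)
  then show ?thesis
    unfolding comaximal_def by blast
qed

lemma comaximal_one_right: "comaximal a 1"
  unfolding comaximal_def by (metis add_0 mult_1 mult_zero_left)

lemma comaximal_power_right: "comaximal a b \<Longrightarrow> comaximal a (b ^ n)"
  by (induction n) (simp_all add: comaximal_one_right comaximal_mult_right)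

lemma comaximal_power: "comaximal a b \<Longrightarrow> comaximal (a ^ m) (b ^ n)"
  by (metis comaximal_commute comaximal_power_right)

lemma comaximal_prod_right:
  "(\<And>i. i \<in> S \<Longrightarrow> comaximal a (m i)) \<Longrightarrow> comaximal a (prod m S)"
  by (induction S rule: infinite_finite_induct)
    (simp_all add: comaximal_one_right comaximal_mult_right)

lemma comaximal_mult_dvd:
  assumes "comaximal a b" "a dvd f" "b dvd f"
  shows "a * b dvd f"
proof -
  obtain u v where "u * a + v * b = 1"
    using assms by (auto simp: comaximal_def)
  then have "f = u * (a * f) + v * (b * f)"
    by (metis distrib_right mult.assoc mult_1)
  then show ?thesis
    using assms by (metis dvd_add dvd_mult dvd_refl mult.commute mult_dvd_mono)
qed

lemma prod_dvd_if_comaximal: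
  assumes "finite S" "pairwise (\<lambda>i j. comaximal (m i) (m j)) S" "\<And>i. i \<in> S \<Longrightarrow> m i dvd f"
  shows "prod m S dvd f"
  using assms
proof (induction S)
  case (insert i S)
  then have "comaximal (m i) (prod m S)"
    by (intro comaximal_prod_right) (auto simp: pairwise_def)
  then show ?case
    using insert by (simp add: comaximal_mult_dvd pairwise_insert)
qed simp

lemma chinese_remainder_comaximal:
  assumes "finite S" "pairwise (\<lambda>i j. comaximal (m i) (m j)) S"
  shows "\<exists>f. \<forall>i\<in>S. m i dvd f - t i"
  using assms
proof (induction S)
  case (insert i S)
  then obtain f where f: "\<forall>j\<in>S. m j dvd f - t j"
    by (auto simp: pairwise_insert)
  have "comaximal (m i) (prod m S)"
    using insert by (intro comaximal_prod_right) (auto simp: pairwise_def)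
  then obtain u v where uv: "u * m i + v * prod m S = 1"
    by (auto simp: comaximal_def)
  \<comment> \<open>\<open>v * prod m S\<close> is 1 modulo \<open>m i\<close> and 0 modulo the
    moduli already treated, so only the residue at \<open>i\<close> is corrected.\<close>
  define g where "g = f + v * prod m S * (t i - f)"
  have "g - t i = (f - t i) * (1 - v * prod m S)"
    by (simp add: g_def algebra_simps)
  then have "m i dvd g - t i"
    by (simp flip: uv)
  moreover have "m j dvd g - t j" if "j \<in> S" for j
  proof -
    have "m j dvd prod m S"
      using that insert by (intro dvd_prodI) auto
    moreover have "g - t j = (f - t j) + prod m S * (v * (t i - f))"
      by (simp add: g_def algebra_simps)
    moreover have "m j dvd f - t j"
      using f that by blast
    ultimately show ?thesis
      by (metis dvd_add dvd_mult2)
  qed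
  ultimately show ?case
    by blast
qed simp

lemma comaximal_linear:
  fixes a b :: "'f::field"
  assumes "a \<noteq> b"
  shows "comaximal [:-a, 1:] [:-b, 1:]"
proof -
  have "[:1 / (b - a):] * [:-a, 1:] + [:- 1 / (b - a):] * [:-b, 1:] = 1"
    using assms by (simp add: one_pCons divide_simps)
  then show ?thesis
    unfolding comaximal_def by blast
qed

lemma dvd_diff_trans:
  fixes a :: "'a::comm_ring_1"
  assumes "a dvd x - y" "a dvd y - z"
  shows "a dvd x - z"
  using dvd_add[OF assms] by simp

section \<open>Polynomials with zeros of fixed order along a window of an orbit\<close>

definition orbit_poly :: "(int \<Rightarrow> 'f::field) \<Rightarrow> int set \<Rightarrow> nat \<Rightarrow> 'f poly"
  where "orbit_poly e S K = (\<Prod>i\<in>S. [:- e i, 1:] ^ K)"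

lemma orbit_poly_dvd:
  assumes "finite S" "inj e" "\<And>i. i \<in> S \<Longrightarrow> [:- e i, 1:] ^ K dvd f"
  shows "orbit_poly e S K dvd f"
  unfolding orbit_poly_def using assms
  by (intro prod_dvd_if_comaximal) (auto simp: pairwise_def inj_eq intro!: comaximal_power comaximal_linear)

lemma orbit_poly_mono:
  assumes "finite S" "S' \<subseteq> S" "K' \<le> K"
  shows "orbit_poly e S' K' dvd orbit_poly e S K"
proof -
  have "orbit_poly e S' K' dvd orbit_poly e S' K"
    unfolding orbit_poly_def using assms by (intro prod_dvd_prod le_imp_power_dvd)
  also have "\<dots> dvd orbit_poly e S K"
    unfolding orbit_poly_def using assms by (intro prod_dvd_prod_subset)
  finally show ?thesis .
qed

lemma orbit_poly_power: "orbit_poly e S K ^ m = orbit_poly e S (K * m)"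
  by (simp add: orbit_poly_def prod_power_distrib power_mult)

lemma orbit_poly_mult: "orbit_poly e S K * orbit_poly e S K' = orbit_poly e S (K + K')"
  by (simp add: orbit_poly_def prod.distrib power_add)

lemma pcompose_prod:
  "pcompose (prod f S) (p :: 'a::comm_ring_1 poly) = (\<Prod>i\<in>S. pcompose (f i) p)"
  by (induction S rule: infinite_finite_induct) (simp_all add: pcompose_mult pcompose_1)

lemma pcompose_power: "pcompose (f ^ n) (p :: 'a::comm_ring_1 poly) = pcompose f p ^ n"
  by (induction n) (simp_all add: pcompose_mult pcompose_1)

lemma pcompose_dvd: "f dvd g \<Longrightarrow> pcompose f p dvd pcompose g (p :: 'a::comm_ring_1 poly)"
  by (auto simp: dvd_def pcompose_mult)

lemma dvd_pcompose_diff: "p - q dvd pcompose f p - pcompose f (q :: 'a::comm_ring_1 poly)"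
proof (induction f)
  case (pCons c f)
  have "pcompose (pCons c f) p - pcompose (pCons c f) q
      = p * (pcompose f p - pcompose f q) + (p - q) * pcompose f q"
    by (simp add: pcompose_pCons algebra_simps)
  then show ?case
    using pCons by (metis dvd_add dvd_mult dvd_triv_left)
qed simp

text \<open>The instances are \<open>(q, 0)\<close> with the powers of \<open>q\<close> and
  \<open>(1, 1)\<close> with the integers. Injectivity of \<open>e\<close> is where \<open>q\<close>
  not being a root of unity and characteristic zero enter.\<close>

locale affine_orbit =
  fixes \<alpha> \<beta> :: "'f::field" and e :: "int \<Rightarrow> 'f"
  assumes alpha: "\<alpha> \<noteq> 0" and step: "e (i + 1) = \<alpha> * e i + \<beta>" and inj: "inj e"
begin

abbreviation \<sigma> :: "'f poly" where "\<sigma> \<equiv> [:\<beta>, \<alpha>:]"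
abbreviation \<sigma>inv :: "'f poly" where "\<sigma>inv \<equiv> [:- \<beta> / \<alpha>, 1 / \<alpha>:]"

lemma linear_sigma: "pcompose [:- e (i + 1), 1:] \<sigma> = smult \<alpha> [:- e i, 1:]"
  by (simp add: pcompose_pCons step)

lemma linear_sigmainv: "pcompose [:- e i, 1:] \<sigma>inv = smult (1 / \<alpha>) [:- e (i + 1), 1:]"
  unfolding step using alpha by (simp add: pcompose_pCons field_simps)

text \<open>Substituting \<open>\<sigma>\<close> turns a zero at \<open>e i\<close> into a zero at
  \<open>e (i - 1)\<close>; the constant that splits off is a power of \<alpha>, hence a
  unit.\<close>

lemma orbit_poly_sigma:
  "pcompose (orbit_poly e S K) \<sigma> dvd orbit_poly e ((\<lambda>i. i - 1) ` S) K"
proof -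
  have "pcompose (orbit_poly e S K) \<sigma> = (\<Prod>i\<in>S. smult (\<alpha> ^ K) ([:- e (i - 1), 1:] ^ K))"
    unfolding orbit_poly_def pcompose_prod pcompose_power
    using linear_sigma[of "i - 1" for i] by (simp only: diff_add_cancel smult_power)
  also have "\<dots> = smult ((\<alpha> ^ K) ^ card S) (\<Prod>i\<in>S. [:- e (i - 1), 1:] ^ K)"
    by (simp add: prod_smult)
  also have "(\<Prod>i\<in>S. [:- e (i - 1), 1:] ^ K) = orbit_poly e ((\<lambda>i. i - 1) ` S) K"
    unfolding orbit_poly_def by (simp add: prod.reindex inj_on_def)
  finally show "pcompose (orbit_poly e S K) \<sigma> dvd orbit_poly e ((\<lambda>i. i - 1) ` S) K"
    using alpha by (simp add: smult_dvd_iff)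
qed

lemma orbit_poly_sigmainv:
  "pcompose (orbit_poly e S K) \<sigma>inv dvd orbit_poly e ((\<lambda>i. i + 1) ` S) K"
proof -
  have "pcompose (orbit_poly e S K) \<sigma>inv = (\<Prod>i\<in>S. smult ((1 / \<alpha>) ^ K) ([:- e (i + 1), 1:] ^ K))"
    unfolding orbit_poly_def pcompose_prod pcompose_power linear_sigmainv by (simp only: smult_power)
  also have "\<dots> = smult (((1 / \<alpha>) ^ K) ^ card S) (\<Prod>i\<in>S. [:- e (i + 1), 1:] ^ K)"
    by (simp only: prod_smult prod_constant)
  also have "(\<Prod>i\<in>S. [:- e (i + 1), 1:] ^ K) = orbit_poly e ((\<lambda>i. i + 1) ` S) K"
    unfolding orbit_poly_def by (simp add: prod.reindex inj_on_def)
  finally show ?thesis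
    using alpha by (simp add: smult_dvd_iff)
qed

end

text \<open>\<open>E\<close> and \<open>L\<close> are interpolated independently by the Chinese
  remainder theorem. They are inverse to each other on the windows because their local models
  \<open>El i\<close> and \<open>Ll i\<close> are inverse affine maps, and they intertwine the two
  affine maps because neighbouring models do.\<close>

lemma orbit_coordinate_change:
  fixes e e' :: "int \<Rightarrow> 'f::field"
  assumes "affine_orbit \<alpha> \<beta> e" "affine_orbit \<alpha>' \<beta>' e'" and K: "K > 0"
  obtains E L where
    "\<And>i. \<bar>i\<bar> \<le> n \<Longrightarrow> poly E (e i) = e' i" "\<And>i. \<bar>i\<bar> \<le> n \<Longrightarrow> poly L (e' i) = e i"
    "orbit_poly e {-n..n} K dvd pcompose L E - [:0, 1:]"
    "orbit_poly e' {-n..n} K dvd pcompose E L - [:0, 1:]"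
    "orbit_poly e {-n..n} K dvd pcompose E [:\<beta>, \<alpha>:] - pcompose [:\<beta>', \<alpha>':] E"
    "orbit_poly e' {-n..n} K dvd pcompose L [:\<beta>', \<alpha>':] - pcompose [:\<beta>, \<alpha>:] L"
proof -
  interpret A: affine_orbit \<alpha> \<beta> e by fact
  interpret B: affine_orbit \<alpha>' \<beta>' e' by fact
  \<comment> \<open>Slope of the model at \<open>e i\<close>. That \<open>El (i + 1)\<close> and
    \<open>El i\<close> intertwine the affine maps forces
    \<open>c (i + 1) * \<alpha> = \<alpha>' * c i\<close>. From integers to powers of
    \<open>q\<close> the model is \<open>q^i (1 + x - i)\<close>.\<close>
  define c where "c i = (\<alpha>' / \<alpha>) powi i" for i
  \<comment> \<open>The window is enlarged because intertwining at \<open>i\<close> involves the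
    model at \<open>i + 1\<close>.\<close>
  define S where "S = {-n-1..n+1}"
  have c: "c i \<noteq> 0" "c (i + 1) * \<alpha> = \<alpha>' * c i" for i
    using A.alpha B.alpha by (auto simp: c_def power_int_add)
  define El where "El i = [:e' i - c i * e i, c i:]" for i
  define Ll where "Ll i = [:e i - inverse (c i) * e' i, inverse (c i):]" for i
  have fin: "finite S" by (simp add: S_def)
  have "pairwise (\<lambda>i j. comaximal ([:- e i, 1:] ^ K) ([:- e j, 1:] ^ K)) S"
    "pairwise (\<lambda>i j. comaximal ([:- e' i, 1:] ^ K) ([:- e' j, 1:] ^ K)) S"
    using A.inj B.inj
    by (auto simp: pairwise_def inj_eq intro!: comaximal_power comaximal_linear)
  from chinese_remainder_comaximal[OF fin this(1), of El]
    chinese_remainder_comaximal[OF fin this(2), of Ll]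
  obtain E L where E: "\<And>i. i \<in> S \<Longrightarrow> [:- e i, 1:] ^ K dvd E - El i"
    and L: "\<And>i. i \<in> S \<Longrightarrow> [:- e' i, 1:] ^ K dvd L - Ll i" by blast
  \<comment> \<open>The argument is symmetric in the two orbits, so one half is proved for abstract data.\<close>
  have half: "poly E (e i) = e' i" "[:- e i, 1:] ^ K dvd pcompose L E - [:0, 1:]"
    if "i \<in> S" and E: "\<And>i. i \<in> S \<Longrightarrow> [:- e i, 1:] ^ K dvd E - El i"
    and L: "\<And>i. i \<in> S \<Longrightarrow> [:- e' i, 1:] ^ K dvd L - Ll i"
    and inv: "pcompose (Ll i) (El i) = [:0, 1:]" and El: "poly (El i) (e i) = e' i"
      "pcompose [:- e' i, 1:] (El i) = smult (c i) [:- e i, 1:]"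
    for E L El Ll c i and e e' :: "int \<Rightarrow> 'f"
  proof -
    have "[:- e i, 1:] dvd E - El i"
      using E[OF \<open>i \<in> S\<close>] K by (meson dvd_power dvd_trans)
    then show "poly E (e i) = e' i"
      by (simp add: poly_eq_0_iff_dvd[symmetric] El)
    \<comment> \<open>As \<open>E - e' i\<close> vanishes at \<open>e i\<close>, substituting
      \<open>E\<close> carries agreement of \<open>L\<close> with its model to the same order at
      \<open>e i\<close>. Inside the model, \<open>E\<close> may then be replaced by
      \<open>El i\<close>.\<close>
    have lin: "[:- e i, 1:] dvd pcompose [:- e' i, 1:] E"
    proof -
      have "pcompose [:- e' i, 1:] E = (E - El i) + pcompose [:- e' i, 1:] (El i)"
        by (simp add: pcompose_pCons)
      then show ?thesis
        using \<open>[:- e i, 1:] dvd E - El i\<close> El by (metis dvd_add dvd_refl dvd_smult)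
    qed
    have "[:- e i, 1:] ^ K dvd pcompose ([:- e' i, 1:] ^ K) E"
      by (simp add: pcompose_power lin dvd_power_same)
    also have "\<dots> dvd pcompose (L - Ll i) E"
      using L[OF \<open>i \<in> S\<close>] by (rule pcompose_dvd)
    finally have 1: "[:- e i, 1:] ^ K dvd pcompose L E - pcompose (Ll i) E"
      by (simp add: pcompose_diff)
    have "[:- e i, 1:] ^ K dvd pcompose (Ll i) E - pcompose (Ll i) (El i)"
      using E[OF \<open>i \<in> S\<close>] dvd_pcompose_diff dvd_trans by blast
    from dvd_diff_trans[OF 1 this] show "[:- e i, 1:] ^ K dvd pcompose L E - [:0, 1:]"
      unfolding inv .
  qed
  have half2: "[:- e i, 1:] ^ K dvd pcompose E [:\<beta>, \<alpha>:] - pcompose [:\<beta>', \<alpha>':] E"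
    if "i \<in> S" "i + 1 \<in> S" and E: "\<And>i. i \<in> S \<Longrightarrow> [:- e i, 1:] ^ K dvd E - El i"
    and "affine_orbit \<alpha> \<beta> e"
    and El: "pcompose (El (i + 1)) [:\<beta>, \<alpha>:] = pcompose [:\<beta>', \<alpha>':] (El i)"
    for E El i and e :: "int \<Rightarrow> 'f" and \<alpha> \<beta> \<alpha>' \<beta>'
  proof -
    interpret affine_orbit \<alpha> \<beta> e by fact
    have "[:- e i, 1:] ^ K dvd pcompose ([:- e (i + 1), 1:] ^ K) [:\<beta>, \<alpha>:]"
      unfolding pcompose_power linear_sigma by (metis dvd_power_same dvd_refl dvd_smult)
    also have "\<dots> dvd pcompose (E - El (i + 1)) [:\<beta>, \<alpha>:]"
      using E[OF that(2)] by (rule pcompose_dvd)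
    finally have "[:- e i, 1:] ^ K dvd pcompose E [:\<beta>, \<alpha>:] - pcompose (El (i + 1)) [:\<beta>, \<alpha>:]"
      by (simp add: pcompose_diff)
    moreover have "[:- e i, 1:] ^ K dvd pcompose [:\<beta>', \<alpha>':] (El i) - pcompose [:\<beta>', \<alpha>':] E"
      unfolding dvd_diff_commute[of _ "pcompose [:\<beta>', \<alpha>':] (El i)"]
      using E[OF that(1)] dvd_pcompose_diff dvd_trans by blast
    ultimately show ?thesis
      unfolding El by (rule dvd_diff_trans)
  qed
  have inS: "i \<in> S" "i + 1 \<in> S" if "i \<in> {-n..n}" for i
    using that by (auto simp: S_def)
  have inS': "i \<in> S" if "\<bar>i\<bar> \<le> n" for i
    using that by (auto simp: S_def)
  have El: "pcompose (Ll i) (El i) = [:0, 1:]" "poly (El i) (e i) = e' i"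
      "pcompose [:- e' i, 1:] (El i) = smult (c i) [:- e i, 1:]"
      "pcompose (El (i + 1)) [:\<beta>, \<alpha>:] = pcompose [:\<beta>', \<alpha>':] (El i)" for i
  proof -
    show "pcompose (El (i + 1)) [:\<beta>, \<alpha>:] = pcompose [:\<beta>', \<alpha>':] (El i)"
      using arg_cong[OF c(2)[of i], of "\<lambda>z. z * e i"] c(2)[of i] unfolding El_def A.step B.step
      by (simp add: pcompose_pCons algebra_simps)
  qed (use c(1)[of i] in \<open>simp_all add: El_def Ll_def pcompose_pCons right_diff_distrib
      flip: mult.assoc\<close>)
  have Ll: "pcompose (El i) (Ll i) = [:0, 1:]" "poly (Ll i) (e' i) = e i"
      "pcompose [:- e i, 1:] (Ll i) = smult (inverse (c i)) [:- e' i, 1:]"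
      "pcompose (Ll (i + 1)) [:\<beta>', \<alpha>':] = pcompose [:\<beta>, \<alpha>:] (Ll i)" for i
  proof -
    have "inverse (c (i + 1)) * \<alpha>' = \<alpha> * inverse (c i)"
      using c[of i] c(1)[of "i + 1"] by (simp add: field_simps)
    from arg_cong[OF this, of "\<lambda>z. z * e' i"] this
    show "pcompose (Ll (i + 1)) [:\<beta>', \<alpha>':] = pcompose [:\<beta>, \<alpha>:] (Ll i)"
      unfolding Ll_def A.step B.step by (simp add: pcompose_pCons algebra_simps)
  qed (use c(1)[of i] in \<open>simp_all add: El_def Ll_def pcompose_pCons right_diff_distrib
      flip: mult.assoc\<close>)
  show thesis
  proof (rule that)
    show "poly E (e i) = e' i" if "\<bar>i\<bar> \<le> n" for i
      by (rule half(1)[OF inS'[OF that] E L El(1-3)])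
    show "poly L (e' i) = e i" if "\<bar>i\<bar> \<le> n" for i
      by (rule half(1)[OF inS'[OF that] L E Ll(1-3)])
    show "orbit_poly e {-n..n} K dvd pcompose L E - [:0, 1:]"
      by (rule orbit_poly_dvd[OF _ A.inj], simp, rule half(2)[OF inS(1) E L El(1-3)])
    show "orbit_poly e' {-n..n} K dvd pcompose E L - [:0, 1:]"
      by (rule orbit_poly_dvd[OF _ B.inj], simp, rule half(2)[OF inS(1) L E Ll(1-3)])
    show "orbit_poly e {-n..n} K dvd pcompose E [:\<beta>, \<alpha>:] - pcompose [:\<beta>', \<alpha>':] E"
      by (rule orbit_poly_dvd[OF _ A.inj], simp, rule half2[OF inS E assms(1) El(4)])
    show "orbit_poly e' {-n..n} K dvd pcompose L [:\<beta>', \<alpha>':] - pcompose [:\<beta>, \<alpha>:] L"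
      by (rule orbit_poly_dvd[OF _ B.inj], simp, rule half2[OF inS L assms(2) Ll(4)])
  qed
qed

section \<open>Rings modulo a congruence\<close>

text \<open>Horner's scheme in a noncommutative ring. The coefficient map \<open>h\<close> is
  arbitrary, so that nested evaluations treat polynomials in several variables.\<close>

definition poly_eval :: "('r::zero \<Rightarrow> 'a::ring_1) \<Rightarrow> 'a \<Rightarrow> 'r poly \<Rightarrow> 'a"
  where "poly_eval h z f = fold_coeffs (\<lambda>c acc. h c + z * acc) f 0"

lemma poly_eval_0 [simp]: "poly_eval h z 0 = 0"
  by (simp add: poly_eval_def)

lemma poly_eval_pCons [simp]:
  assumes "h 0 = 0"
  shows "poly_eval h z (pCons c f) = h c + z * poly_eval h z f"
  using assms unfolding poly_eval_def by (cases "c = 0 \<and> f = 0") (auto simp: fold_coeffs_pCons_eq)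

text \<open>The quotient \<open>(f(t) - f(u)) / (t - u)\<close> by Horner recursion: the first
  component is the value at \<open>t\<close>, the second the divided difference. No division occurs,
  so it makes sense in every ring.\<close>

definition divdiff :: "('f::zero \<Rightarrow> 'a::ring_1) \<Rightarrow> 'f poly \<Rightarrow> 'a \<Rightarrow> 'a \<Rightarrow> 'a"
  where "divdiff h f t u = snd (fold_coeffs (\<lambda>c (v, w). (h c + t * v, v + u * w)) f (0, 0))"

lemma divdiff_0 [simp]: "divdiff h 0 t u = 0"
  by (simp add: divdiff_def)

lemma divdiff_pCons [simp]:
  assumes "h 0 = 0"
  shows "divdiff h (pCons c f) t u = poly_eval h t f + u * divdiff h f t u"
proof -
  define F where "F f = fold_coeffs (\<lambda>c (v, w). (h c + t * v, v + u * w)) f (0, 0)" for f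
  have F_pCons: "F (pCons c f) = (h c + t * fst (F f), fst (F f) + u * snd (F f))" for c f
    using assms unfolding F_def
    by (cases "c = 0 \<and> f = 0") (auto simp: fold_coeffs_pCons_eq split: prod.splits)
  have "fst (F f) = poly_eval h t f"
    by (induction f) (simp_all add: F_pCons assms, simp add: F_def)
  then show ?thesis
    unfolding divdiff_def F_def[symmetric] by (simp add: F_pCons)
qed

text \<open>Relations are imposed by a congruence on a type of class \<open>ring_1\<close>, which
  avoids carriers. It is equality for polynomial rings and congruence modulo an ideal for the Hecke
  algebras.\<close>

locale ring_congruence =
  fixes eq :: "'a::ring_1 \<Rightarrow> 'a \<Rightarrow> bool" (infix "\<approx>" 50)
  assumes eq_refl [simp, intro!]: "x \<approx> x"
    and eq_sym: "x \<approx> y \<Longrightarrow> y \<approx> x"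
    and eq_trans [trans]: "x \<approx> y \<Longrightarrow> y \<approx> z \<Longrightarrow> x \<approx> z"
    and eq_add: "x \<approx> x' \<Longrightarrow> y \<approx> y' \<Longrightarrow> x + y \<approx> x' + y'"
    and eq_mult: "x \<approx> x' \<Longrightarrow> y \<approx> y' \<Longrightarrow> x * y \<approx> x' * y'"
begin

lemma eq_uminus: "x \<approx> x' \<Longrightarrow> - x \<approx> - x'"
  using eq_mult[of "-1" "-1" x x'] by simp

lemma eq_diff: "x \<approx> x' \<Longrightarrow> y \<approx> y' \<Longrightarrow> x - y \<approx> x' - y'"
  using eq_add[of x x' "- y" "- y'"] eq_uminus by simp

lemma eq_mult_left: "y \<approx> y' \<Longrightarrow> x * y \<approx> x * y'"
  by (simp add: eq_mult)

lemma eq_mult_right: "x \<approx> x' \<Longrightarrow> x * y \<approx> x' * y"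
  by (simp add: eq_mult)

lemma eq_iff_diff: "x \<approx> y \<longleftrightarrow> x - y \<approx> 0"
  using eq_diff[of x y y y] eq_add[of "x - y" 0 y y] by auto

lemma eq_0_mult_left: "y \<approx> 0 \<Longrightarrow> x * y \<approx> 0"
  using eq_mult_left[of y 0 x] by simp

lemma eq_0_mult_right: "x \<approx> 0 \<Longrightarrow> x * y \<approx> 0"
  using eq_mult_right[of x 0 y] by simp

lemma eq_0_add: "x \<approx> 0 \<Longrightarrow> y \<approx> 0 \<Longrightarrow> x + y \<approx> 0"
  using eq_add[of x 0 y 0] by simp

lemma eq_0_diff: "x \<approx> 0 \<Longrightarrow> y \<approx> 0 \<Longrightarrow> x - y \<approx> 0"
  using eq_diff[of x 0 y 0] by simp

definition com :: "'a \<Rightarrow> 'a \<Rightarrow> bool"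
  where "com x y \<longleftrightarrow> x * y \<approx> y * x"

lemma com_sym: "com x y \<Longrightarrow> com y x"
  by (simp add: com_def eq_sym)

lemma com_self [simp]: "com x x"
  by (simp add: com_def)

lemma com_0 [simp]: "com x 0" "com 0 x"
  by (simp_all add: com_def)

lemma com_1 [simp]: "com x 1" "com 1 x"
  by (simp_all add: com_def)

lemma com_add: "com x y \<Longrightarrow> com x z \<Longrightarrow> com x (y + z)"
  unfolding com_def distrib_left distrib_right by (rule eq_add)

lemma com_diff: "com x y \<Longrightarrow> com x z \<Longrightarrow> com x (y - z)"
  unfolding com_def left_diff_distrib right_diff_distrib by (rule eq_diff)

lemma com_mult:
  assumes "com x y" "com x z"
  shows "com x (y * z)"
proof -
  have "x * (y * z) = x * y * z" by (simp add: mult.assoc)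
  also have "\<dots> \<approx> y * x * z" using assms by (simp add: com_def eq_mult_right)
  also have "\<dots> = y * (x * z)" by (simp add: mult.assoc)
  also have "\<dots> \<approx> y * (z * x)" using assms by (simp add: com_def eq_mult_left)
  also have "\<dots> = y * z * x" by (simp add: mult.assoc)
  finally show ?thesis by (simp add: com_def)
qed

text \<open>Evaluation is multiplicative only up to the congruence, because the elements substituted
  for the variables commute only up to it; additivity stays exact.\<close>

definition hom_mod :: "('r::ring_1 \<Rightarrow> 'a) \<Rightarrow> bool"
  where "hom_mod h \<longleftrightarrow> h 0 = 0 \<and> h 1 = 1 \<and> (\<forall>x y. h (x + y) = h x + h y) \<and>
    (\<forall>x y. h (x * y) \<approx> h x * h y)"

lemma hom_modD:
  assumes "hom_mod h"
  shows "h 0 = 0" "h 1 = 1" "h (x + y) = h x + h y" "h (x * y) \<approx> h x * h y"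
    "h (- x) = - h x" "h (x - y) = h x - h y"
proof -
  show *: "h 0 = 0" "h 1 = 1" "h (x + y) = h x + h y" "h (x * y) \<approx> h x * h y" for x y
    using assms by (simp_all add: hom_mod_def)
  show **: "h (- x) = - h x" for x
    using *(3)[of x "- x"] *(1) by (metis add.right_inverse minus_unique)
  show "h (x - y) = h x - h y"
    using *(3)[of x "- y"] ** by simp
qed

lemma poly_eval_com:
  assumes "h 0 = 0" "com y z" "\<And>c. com y (h c)"
  shows "com y (poly_eval h z f)"
  by (induction f) (simp_all add: assms com_add com_mult)

lemma poly_eval_hom_mod:
  fixes h :: "'r::comm_ring_1 \<Rightarrow> 'a"
  assumes h: "hom_mod h" and com: "\<And>c. com z (h c)"
  shows "hom_mod (poly_eval h z)"
proof -
  note h0 [simp] = hom_modD(1)[OF h]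
  have add: "poly_eval h z (f + g) = poly_eval h z f + poly_eval h z g" for f g
  proof (induction f arbitrary: g)
    case (pCons c f)
    then show ?case
      by (cases g) (simp add: hom_modD[OF h] algebra_simps)
  qed simp
  have smult: "poly_eval h z (smult c g) \<approx> h c * poly_eval h z g" for c g
  proof (induction g)
    case (pCons b g)
    have "poly_eval h z (smult c (pCons b g)) = h (c * b) + z * poly_eval h z (smult c g)"
      by simp
    also have "\<dots> \<approx> h c * h b + z * (h c * poly_eval h z g)"
      by (intro eq_add eq_mult pCons hom_modD[OF h] eq_refl)
    also have "z * (h c * poly_eval h z g) = (z * h c) * poly_eval h z g"
      by (simp add: mult.assoc)
    also have "h c * h b + (z * h c) * poly_eval h z g \<approx> h c * h b + (h c * z) * poly_eval h z g"
      using com by (intro eq_add[OF eq_refl] eq_mult_right) (simp add: com_def)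
    also have "\<dots> = h c * poly_eval h z (pCons b g)"
      by (simp add: algebra_simps)
    finally show ?case .
  qed simp
  have "poly_eval h z (f * g) \<approx> poly_eval h z f * poly_eval h z g" for f g
  proof (induction f)
    case (pCons c f)
    have "poly_eval h z (pCons c f * g) = poly_eval h z (smult c g) + z * poly_eval h z (f * g)"
      by (simp add: add)
    also have "\<dots> \<approx> h c * poly_eval h z g + z * (poly_eval h z f * poly_eval h z g)"
      by (intro eq_add eq_mult smult pCons eq_refl)
    also have "\<dots> = poly_eval h z (pCons c f) * poly_eval h z g"
      by (simp add: algebra_simps)
    finally show ?case .
  qed simp
  then show ?thesis
    by (simp add: hom_mod_def add hom_modD(2)[OF h] one_pCons)
qed

end

locale algebra_congruence = ring_congruence eq
  for eq :: "'a::ring_1 \<Rightarrow> 'a \<Rightarrow> bool" (infix "\<approx>" 50) +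
  fixes sc :: "'f::field \<Rightarrow> 'a"
  assumes sc_0 [simp]: "sc 0 = 0" and sc_1 [simp]: "sc 1 = 1"
    and sc_add: "sc (b + c) = sc b + sc c" and sc_mult: "sc (b * c) = sc b * sc c"
    and sc_commute: "sc c * z = z * sc c"
begin

lemma sc_hom: "hom_mod sc"
  by (simp add: hom_mod_def sc_add sc_mult)

lemmas sc_diff = hom_modD(6)[OF sc_hom]
lemmas sc_minus = hom_modD(5)[OF sc_hom]

lemma sc_com [simp]: "com (sc c) z" "com z (sc c)"
  by (simp_all add: com_def sc_commute)

abbreviation pe :: "'f poly \<Rightarrow> 'a \<Rightarrow> 'a" where "pe f z \<equiv> poly_eval sc z f"

lemma pe_hom: "hom_mod (\<lambda>f. pe f z)"
  using poly_eval_hom_mod[OF sc_hom] by simp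

lemmas pe_add = hom_modD(3)[OF pe_hom]
lemmas pe_diff = hom_modD(6)[OF pe_hom]
lemmas pe_mult = hom_modD(4)[OF pe_hom]

lemma pe_smult: "pe (smult c f) z = sc c * pe f z"
  by (induction f) (simp_all add: sc_mult distrib_left flip: mult.assoc sc_commute[of _ z])

lemma pe_cong: "z \<approx> z' \<Longrightarrow> pe f z \<approx> pe f z'"
  by (induction f) (simp_all add: eq_add eq_mult)

lemma pe_com: "com y z \<Longrightarrow> com y (pe f z)"
  by (rule poly_eval_com) simp_all

lemma pe_pcompose: "pe (pcompose f g) z \<approx> pe f (pe g z)"
proof (induction f)
  case (pCons c f)
  have "pe (pcompose (pCons c f) g) z = sc c + pe (g * pcompose f g) z"
    by (simp add: pcompose_pCons pe_add)
  also have "\<dots> \<approx> sc c + pe g z * pe f (pe g z)"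
    by (meson eq_add eq_mult_left eq_refl eq_trans pCons.IH pe_mult)
  finally show ?case
    by simp
qed simp

lemma pe_dvd_0: "pe f z \<approx> 0 \<Longrightarrow> f dvd g \<Longrightarrow> pe g z \<approx> 0"
  by (metis dvd_def eq_0_mult_right eq_trans pe_mult)

lemma divdiff_cong: "t \<approx> t' \<Longrightarrow> u \<approx> u' \<Longrightarrow> divdiff sc f t u \<approx> divdiff sc f t' u'"
  by (induction f) (simp_all add: eq_add eq_mult pe_cong)

lemma divdiff_com: "com y t \<Longrightarrow> com y u \<Longrightarrow> com y (divdiff sc f t u)"
  by (induction f) (simp_all add: com_add com_mult pe_com)

lemma divdiff_add: "divdiff sc (f + g) t u = divdiff sc f t u + divdiff sc g t u"
proof (induction f arbitrary: g)
  case (pCons c f)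
  then show ?case
    by (cases g) (simp add: pe_add algebra_simps)
qed simp

lemma divdiff_diff: "divdiff sc (f - g) t u = divdiff sc f t u - divdiff sc g t u"
  using divdiff_add[of "f - g" g t u] by (simp add: algebra_simps)

lemma divdiff_spec:
  assumes "com t u"
  shows "pe f t - pe f u \<approx> (t - u) * divdiff sc f t u"
proof (induction f)
  case (pCons c f)
  have "pe (pCons c f) t - pe (pCons c f) u = (t - u) * pe f t + u * (pe f t - pe f u)"
    by (simp add: algebra_simps)
  also have "\<dots> \<approx> (t - u) * pe f t + u * ((t - u) * divdiff sc f t u)"
    by (intro eq_add eq_mult eq_refl pCons)
  also have "u * ((t - u) * divdiff sc f t u) = (u * (t - u)) * divdiff sc f t u"
    by (simp add: mult.assoc)
  also have "(t - u) * pe f t + (u * (t - u)) * divdiff sc f t u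
     \<approx> (t - u) * pe f t + ((t - u) * u) * divdiff sc f t u"
  proof (intro eq_add[OF eq_refl] eq_mult_right)
    have "com u (t - u)" using assms by (intro com_diff) (simp_all add: com_sym)
    then show "u * (t - u) \<approx> (t - u) * u" by (simp add: com_def)
  qed
  also have "\<dots> = (t - u) * divdiff sc (pCons c f) t u"
    by (simp add: algebra_simps)
  finally show ?case .
qed simp

lemma hom_poly_eval:
  assumes "hom_mod \<theta>" "\<And>c. \<theta> (k c) = sc c" "k 0 = 0"
  shows "\<theta> (poly_eval k t f) \<approx> pe f (\<theta> t)"
proof (induction f)
  case 0
  then show ?case by (simp add: hom_modD[OF assms(1)])
next
  case (pCons c f)
  then show ?case
    by (simp add: hom_modD[OF assms(1)] assms)
      (meson eq_add eq_mult_left eq_refl eq_trans hom_modD(4)[OF assms(1)])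
qed

lemma hom_divdiff:
  assumes "hom_mod \<theta>" "\<And>c. \<theta> (k c) = sc c" "k 0 = 0"
  shows "\<theta> (divdiff k f t u) \<approx> divdiff sc f (\<theta> t) (\<theta> u)"
proof (induction f)
  case 0
  then show ?case by (simp add: hom_modD[OF assms(1)])
next
  case (pCons c f)
  have "\<theta> (divdiff k (pCons c f) t u) = \<theta> (poly_eval k t f) + \<theta> (u * divdiff k f t u)"
    by (simp add: assms hom_modD[OF assms(1)])
  also have "\<dots> \<approx> pe f (\<theta> t) + \<theta> u * divdiff sc f (\<theta> t) (\<theta> u)"
    by (meson eq_add eq_mult_left eq_trans hom_modD(4)[OF assms(1)] hom_poly_eval assms pCons)
  finally show ?case by simp
qed

abbreviation ev :: "'a \<Rightarrow> 'a \<Rightarrow> 'a \<Rightarrow> 'f poly poly poly \<Rightarrow> 'a"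
  where "ev t u w \<equiv> poly_eval (poly_eval (poly_eval sc t) u) w"

lemma ev_hom:
  assumes "com t u" "com t w" "com u w"
  shows "hom_mod (ev t u w)"
proof (intro poly_eval_hom_mod sc_hom sc_com)
  show "com u (pe c t)" for c
    using assms by (intro pe_com) (simp add: com_sym)
  show "com w (poly_eval (poly_eval sc t) u c)" for c
    using assms by (intro poly_eval_com) (simp_all add: com_sym)
qed

end

section \<open>Polynomials in three variables\<close>

type_synonym 'f pol3 = "'f poly poly poly"

definition cst :: "'f::field \<Rightarrow> 'f pol3" where "cst c = [:[:[:c:]:]:]"
definition V1 :: "'f::field pol3" where "V1 = [:[:[:0, 1:]:]:]"
definition V2 :: "'f::field pol3" where "V2 = [:[:0, 1:]:]"
definition V3 :: "'f::field pol3" where "V3 = [:0, 1:]"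

lemma V_distinct [simp]:
  "V1 \<noteq> V2" "V2 \<noteq> V1" "V1 \<noteq> V3" "V3 \<noteq> V1" "V2 \<noteq> V3" "V3 \<noteq> V2"
  by (simp_all add: V1_def V2_def V3_def one_pCons)

text \<open>With equality as congruence, the general facts on \<open>pe\<close>,
  \<open>divdiff\<close> and \<open>ev\<close> become exact identities between polynomials;
  \<open>hom_poly_eval\<close> and \<open>hom_divdiff\<close> carry these back to an
  algebra.\<close>

interpretation P: algebra_congruence "(=)" "cst :: 'f::field \<Rightarrow> 'f pol3"
  by unfold_locales (simp_all add: cst_def one_pCons)

lemma (in algebra_congruence) ev_var [simp]:
  "ev t u w (cst c) = sc c" "ev t u w V1 = t" "ev t u w V2 = u" "ev t u w V3 = w"
  by (simp_all add: cst_def V1_def V2_def V3_def one_pCons)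

lemma pol3_induct [case_names cst V1 V2 V3 add mult]:
  fixes f :: "'f::field pol3"
  assumes cst: "\<And>c. Q (cst c)" and V: "Q V1" "Q V2" "Q V3"
    and add: "\<And>f g. Q f \<Longrightarrow> Q g \<Longrightarrow> Q (f + g)" and mult: "\<And>f g. Q f \<Longrightarrow> Q g \<Longrightarrow> Q (f * g)"
  shows "Q f"
proof -
  have 0: "Q 0" using cst[of 0] by (simp add: cst_def)
  have 1: "Q [:[:f:]:]" for f
  proof (induction f)
    case (pCons c f)
    have "[:[:pCons c f:]:] = cst c + V1 * [:[:f:]:]"
      by (simp add: cst_def V1_def)
    then show ?case using add[OF cst mult[OF V(1) pCons(2)]] by simp
  qed (simp add: 0)
  have 2: "Q [:f:]" for f
  proof (induction f)
    case (pCons c f)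
    have "[:pCons c f:] = [:[:c:]:] + V2 * [:f:]"
      by (simp add: V2_def)
    then show ?case using add[OF 1 mult[OF V(2) pCons(2)]] by simp
  qed (simp add: 0)
  show ?thesis
  proof (induction f)
    case (pCons c f)
    have "pCons c f = [:c:] + V3 * f"
      by (simp add: V3_def)
    then show ?case using add[OF 2 mult[OF V(3) pCons(2)]] by simp
  qed (simp add: 0)
qed

section \<open>Divided differences\<close>

lemma (in ring_congruence) com_prod_left: "com x z \<Longrightarrow> com y z \<Longrightarrow> com (x * y) z"
  by (meson com_mult com_sym)

lemma P_com [simp]: "P.com f g"
  by (simp add: P.com_def mult.commute)



lemma P_divdiff_spec: "(t - u) * divdiff cst f t u = P.pe f t - P.pe f u"
  using P.divdiff_spec[of t u f] by simp

text \<open>Cancellation in an integral domain; the product and chain rules for divided differences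
  rest on it.\<close>

lemma P_divdiff_unique: "t \<noteq> u \<Longrightarrow> (t - u) * g = P.pe f t - P.pe f u \<Longrightarrow> divdiff cst f t u = g"
  using P_divdiff_spec[of t u f] by (metis mult_left_cancel right_minus_eq)

lemma P_divdiff_mult:
  assumes "t \<noteq> u"
  shows "divdiff cst (f * g) t u = P.pe f t * divdiff cst g t u + divdiff cst f t u * P.pe g u"
proof (rule P_divdiff_unique[OF assms])
  have "(t - u) * (P.pe f t * divdiff cst g t u + divdiff cst f t u * P.pe g u)
    = P.pe f t * ((t - u) * divdiff cst g t u) + ((t - u) * divdiff cst f t u) * P.pe g u"
    by (simp only: algebra_simps)
  also have "\<dots> = P.pe (f * g) t - P.pe (f * g) u"
    unfolding P_divdiff_spec P.pe_mult by (simp add: algebra_simps)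
  finally show "(t - u) * (P.pe f t * divdiff cst g t u + divdiff cst f t u * P.pe g u)
    = P.pe (f * g) t - P.pe (f * g) u" .
qed

lemma P_divdiff_pcompose:
  assumes "t \<noteq> u"
  shows "divdiff cst (pcompose f g) t u = divdiff cst f (P.pe g t) (P.pe g u) * divdiff cst g t u"
proof (rule P_divdiff_unique[OF assms])
  have "(t - u) * (divdiff cst f (P.pe g t) (P.pe g u) * divdiff cst g t u)
    = divdiff cst f (P.pe g t) (P.pe g u) * ((t - u) * divdiff cst g t u)"
    by (simp add: algebra_simps)
  also have "\<dots> = P.pe (pcompose f g) t - P.pe (pcompose f g) u"
    unfolding P_divdiff_spec P.pe_pcompose by (subst mult.commute) (rule P_divdiff_spec)
  finally show "(t - u) * (divdiff cst f (P.pe g t) (P.pe g u) * divdiff cst g t u)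
    = P.pe (pcompose f g) t - P.pe (pcompose f g) u" .
qed

lemma P_divdiff_id: "divdiff cst [:0, 1:] t u = 1"
  by simp

lemma P_divdiff_commute: "t \<noteq> u \<Longrightarrow> divdiff cst f t u = divdiff cst f u t"
  by (rule P_divdiff_unique) (use P_divdiff_spec[of u t f] in \<open>simp_all add: algebra_simps\<close>)

section \<open>Demazure operators for a transposition of two variables\<close>

abbreviation vars :: "'f::field pol3 set" where "vars \<equiv> {V1, V2, V3}"

locale swap =
  fixes s :: "'f::field pol3 \<Rightarrow> 'f pol3" and U W Z :: "'f pol3"
  assumes hom: "P.hom_mod s" and cst: "s (cst c) = cst c"
    and swap: "s U = W" "s W = U" "s Z = Z" and vars: "vars = {U, W, Z}" and neq: "U \<noteq> W"
begin

lemmas s_simps = hom[THEN P.hom_modD(1)] hom[THEN P.hom_modD(2)] hom[THEN P.hom_modD(3)]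
  hom[THEN P.hom_modD(4)] hom[THEN P.hom_modD(5)] hom[THEN P.hom_modD(6)] cst swap

lemma vars_induct [case_names cst U W Z add mult]:
  assumes "\<And>c. Q (cst c)" "Q U" "Q W" "Q Z"
    and "\<And>f g. Q f \<Longrightarrow> Q g \<Longrightarrow> Q (f + g)" "\<And>f g. Q f \<Longrightarrow> Q g \<Longrightarrow> Q (f * g)"
  shows "Q f"
proof -
  have "Q v" if "v \<in> vars" for v
    using that assms(2-4) unfolding vars by auto
  then show ?thesis
    using assms by (induction f rule: pol3_induct) simp_all
qed

lemma s_vars: "v \<in> vars \<Longrightarrow> s v \<in> vars"
  unfolding vars using swap by auto

lemma s_pe: "s (P.pe f t) = P.pe f (s t)"
  by (rule P.hom_poly_eval[OF hom cst]) simp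

lemma s_divdiff: "s (divdiff cst f t u) = divdiff cst f (s t) (s u)"
  by (rule P.hom_divdiff[OF hom cst]) simp

text \<open>The Demazure operator of the transposition \<open>s\<close>; \<open>dl_spec\<close>
  shows that the division is exact.\<close>

definition dl :: "'f pol3 \<Rightarrow> 'f pol3"
  where "dl f = (f - s f) div (U - W)"

lemma dl_unique: "(U - W) * g = f - s f \<Longrightarrow> dl f = g"
  unfolding dl_def using neq by (metis nonzero_mult_div_cancel_left right_minus_eq)

lemma dl_spec: "(U - W) * dl f = f - s f"
proof -
  \<comment> \<open>Divisibility of \<open>f - s f\<close> passes to sums and, by the Leibniz rule,
    to products, so constants and variables suffice.\<close>
  have "\<exists>g. (U - W) * g = f - s f"
  proof (induction f rule: vars_induct)
    case (cst c)
    show ?case by (rule exI[of _ 0]) (simp add: s_simps)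
  next
    case U
    show ?case by (rule exI[of _ 1]) (simp add: s_simps)
  next
    case W
    show ?case by (rule exI[of _ "-1"]) (simp add: s_simps)
  next
    case Z
    show ?case by (rule exI[of _ 0]) (simp add: s_simps)
  next
    case (add f g)
    then obtain f' g' where "(U - W) * f' = f - s f" "(U - W) * g' = g - s g" by blast
    then show ?case by (intro exI[of _ "f' + g'"]) (simp add: s_simps algebra_simps)
  next
    case (mult f g)
    then obtain f' g' where *: "(U - W) * f' = f - s f" "(U - W) * g' = g - s g" by blast
    have "(U - W) * (f' * g + s f * g') = ((U - W) * f') * g + s f * ((U - W) * g')"
      by (simp add: algebra_simps)
    then show ?case unfolding * by (intro exI[of _ "f' * g + s f * g'"]) (simp add: s_simps algebra_simps)
  qed
  then show ?thesis using dl_unique by blast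
qed

lemma dl_add: "dl (f + g) = dl f + dl g"
  by (rule dl_unique) (simp add: distrib_left dl_spec s_simps)

lemma dl_diff: "dl (f - g) = dl f - dl g"
  by (rule dl_unique) (simp add: right_diff_distrib dl_spec s_simps)

lemma dl_mult: "dl (f * g) = dl f * s g + f * dl g"
proof (rule dl_unique)
  have "(U - W) * (dl f * s g + f * dl g) = ((U - W) * dl f) * s g + f * ((U - W) * dl g)"
    by (simp only: algebra_simps)
  then show "(U - W) * (dl f * s g + f * dl g) = f * g - s (f * g)"
    unfolding dl_spec by (simp add: s_simps algebra_simps)
qed

lemma dl_mult': "dl (f * g) = dl f * g + s f * dl g"
  using dl_mult[of g f] by (simp add: algebra_simps)

lemma dl_sym: "s f = f \<Longrightarrow> dl f = 0"
  by (rule dl_unique) simp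

lemma dl_mult_sym: "s f = f \<Longrightarrow> dl (f * g) = f * dl g"
  by (simp add: dl_mult dl_sym)

lemma dl_var [simp]: "dl (cst c) = 0" "dl U = 1" "dl W = -1" "dl Z = 0"
  by (simp_all add: dl_unique s_simps)

end

text \<open>The correction term obeys the twisted Leibniz rule \<open>dl_mult\<close>, so commuting
  \<open>a\<close> past the three variables determines how it commutes past every
  polynomial.\<close>

lemma (in algebra_congruence) dl_commutation:
  assumes "swap s U W Z" and th_hom: "hom_mod \<theta>" "\<And>c. \<theta> (cst c) = sc c"
    and rel: "\<theta> U * a \<approx> a * \<theta> W + \<theta> v" "\<theta> W * a \<approx> a * \<theta> U - \<theta> v" "\<theta> Z * a \<approx> a * \<theta> Z"
  shows "\<theta> f * a \<approx> a * \<theta> (s f) + \<theta> (swap.dl s U W f * v)"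
proof -
  interpret swap s U W Z by fact
  note th = hom_modD[OF th_hom(1)]
  show ?thesis
  proof (induction f rule: vars_induct)
    case (mult f g)
    have "\<theta> (f * g) * a \<approx> \<theta> f * (\<theta> g * a)"
      using eq_mult_right[OF th(4)] by (simp add: mult.assoc)
    also have "\<dots> \<approx> \<theta> f * (a * \<theta> (s g) + \<theta> (dl g * v))"
      by (rule eq_mult_left[OF mult(2)])
    also have "\<dots> = (\<theta> f * a) * \<theta> (s g) + \<theta> f * \<theta> (dl g * v)"
      by (simp add: algebra_simps)
    also have "\<dots> \<approx> (a * \<theta> (s f) + \<theta> (dl f * v)) * \<theta> (s g) + \<theta> (f * (dl g * v))"
      by (intro eq_add eq_mult_right mult eq_sym[OF th(4)])
    also have "\<dots> = a * (\<theta> (s f) * \<theta> (s g)) + (\<theta> (dl f * v) * \<theta> (s g) + \<theta> (f * (dl g * v)))"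
      by (simp add: algebra_simps)
    also have "\<dots> \<approx> a * \<theta> (s f * s g) + (\<theta> (dl f * v * s g) + \<theta> (f * (dl g * v)))"
      by (intro eq_add eq_mult_left eq_sym[OF th(4)] eq_refl)
    also have "\<dots> = a * \<theta> (s (f * g)) + \<theta> (dl (f * g) * v)"
      by (simp add: s_simps dl_mult algebra_simps flip: th(3))
    finally show ?case .
  next
    case (add f g)
    have "\<theta> (f + g) * a = \<theta> f * a + \<theta> g * a"
      by (simp add: th algebra_simps)
    also have "\<dots> \<approx> (a * \<theta> (s f) + \<theta> (dl f * v)) + (a * \<theta> (s g) + \<theta> (dl g * v))"
      by (intro eq_add add)
    also have "\<dots> = a * \<theta> (s (f + g)) + \<theta> (dl (f + g) * v)"
      by (simp add: s_simps dl_add th algebra_simps)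
    finally show ?case .
  qed (use rel in \<open>simp_all add: s_simps th_hom(2) th sc_commute\<close>)
qed

text \<open>
  \<open>null p m\<close> is the \<open>m\<close>-th power of the ideal generated by \<open>p(V\<^sub>1)\<close>, \<open>p(V\<^sub>2)\<close>, \<open>p(V\<^sub>3)\<close>. A divided difference
  lowers the power by one, so identities that hold up to a high power survive two of them.
\<close>

inductive null :: "'f::field poly \<Rightarrow> nat \<Rightarrow> 'f pol3 \<Rightarrow> bool" for p where
  null_0: "null p 0 f"
| null_gen: "null p m f \<Longrightarrow> v \<in> vars \<Longrightarrow> null p (Suc m) (P.pe p v * f)"
| null_add: "null p m f \<Longrightarrow> null p m g \<Longrightarrow> null p m (f + g)"

lemma null_mult: "null p m f \<Longrightarrow> null p m (f * g)"
  by (induction rule: null.induct) (auto simp: distrib_right mult.assoc intro: null.intros)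

lemma null_mult': "null p m f \<Longrightarrow> null p m (g * f)"
  by (metis mult.commute null_mult)

lemma null_uminus: "null p m f \<Longrightarrow> null p m (- f)"
  using null_mult[of p m f "-1"] by simp

lemma null_diff: "null p m f \<Longrightarrow> null p m g \<Longrightarrow> null p m (f - g)"
  using null_add[of p m f "- g"] null_uminus by auto

lemma null_pred: "null p m f \<Longrightarrow> null p (m - 1) f"
proof (induction rule: null.induct)
  case (null_gen m f v)
  then show ?case by (simp add: null_mult')
qed (auto intro: null.intros)

lemma null_le: "null p m f \<Longrightarrow> m' \<le> m \<Longrightarrow> null p m' f"
proof (induction m)
  case (Suc m)
  then show ?case
    using null_pred[of p "Suc m" f] by (cases "m' = Suc m") auto
qed simp

text \<open>The Leibniz rule for \<open>p(v) * f\<close> gives one term that loses the factor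
  \<open>p(v)\<close> and one that keeps \<open>p(s v)\<close>, again a generator because
  \<open>s\<close> permutes the variables.\<close>

lemma (in swap) null_dl:
  assumes "null p m f"
  shows "null p (m - 1) (dl f)"
  using assms
proof (induction rule: null.induct)
  case (null_gen m f v)
  have "null p m (P.pe p (s v) * dl f)"
    using null_gen s_vars by (cases m) (auto intro: null.intros)
  then show ?case
    unfolding dl_mult' s_pe using null_gen by (simp add: null_add null_mult')
qed (auto simp: dl_add intro: null.intros)

lemma (in algebra_congruence) null_eq_0:
  assumes "null p m f" "m > 0" and hom: "hom_mod \<theta>" "\<And>c. \<theta> (cst c) = sc c"
    and p: "\<And>v. v \<in> vars \<Longrightarrow> pe p (\<theta> v) \<approx> 0"
  shows "\<theta> f \<approx> 0"
  using assms(1,2)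
proof (induction rule: null.induct)
  case (null_gen m f v)
  have "\<theta> (P.pe p v) \<approx> 0"
    using hom_poly_eval[OF hom, where t = v and f = p] p[OF null_gen(2)] by (auto intro: eq_trans)
  then show ?case
    using hom_modD(4)[OF hom(1)] eq_0_mult_right eq_trans by blast
next
  case (null_add m f g)
  then show ?case
    by (simp add: hom_modD(3)[OF hom(1)] eq_0_add)
qed simp

lemma null_pe:
  assumes "p ^ m dvd f" "v \<in> vars"
  shows "null p m (P.pe f v)"
  using assms(1)
proof (induction m arbitrary: f)
  case (Suc m)
  from Suc.prems obtain g where "f = p ^ Suc m * g" by (rule dvdE)
  then have "f = p * (p ^ m * g)"
    by (simp add: mult.assoc)
  then show ?case
    using Suc.IH[of "p ^ m * g"] assms(2) by (simp add: P.pe_mult null_gen del: insert_iff)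
qed (simp add: null_0)

text \<open>In the product rule for \<open>p * (p ^ Suc m * g)\<close>, one term keeps
  \<open>p(v)\<close> and the other contains the value of \<open>p ^ Suc m * g\<close> at
  \<open>w\<close>; so at most one power is lost.\<close>

lemma null_divdiff:
  assumes "p ^ Suc m dvd f" "v \<in> vars" "w \<in> vars" "v \<noteq> w"
  shows "null p m (divdiff cst f v w)"
  using assms(1)
proof (induction m arbitrary: f)
  case (Suc m)
  from Suc.prems obtain g where "f = p ^ Suc (Suc m) * g" by (rule dvdE)
  then have f: "f = p * (p ^ Suc m * g)"
    by (simp add: mult.assoc)
  have "null p (Suc m) (P.pe p v * divdiff cst (p ^ Suc m * g) v w)"
    using Suc.IH[of "p ^ Suc m * g"] assms(2) by (intro null_gen) auto
  moreover have "null p (Suc m) (P.pe (p ^ Suc m * g) w)"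
    using assms(3) by (intro null_pe) auto
  ultimately show ?case
    unfolding f P_divdiff_mult[OF assms(4), of p "p ^ Suc m * g"]
    by (intro null_add null_mult'[of _ _ "P.pe _ w"])
qed (simp add: null_0)

section \<open>The quadratic and braid identities\<close>

interpretation S12: swap "P.ev V2 V1 V3 :: 'f::field pol3 \<Rightarrow> _" V1 V2 V3
proof unfold_locales
  show "P.hom_mod (P.ev V2 V1 V3 :: 'f pol3 \<Rightarrow> _)" by (rule P.ev_hom) simp_all
qed (simp_all add: insert_commute)

interpretation S23: swap "P.ev V1 V3 V2 :: 'f::field pol3 \<Rightarrow> _" V2 V3 V1
proof unfold_locales
  show "P.hom_mod (P.ev V1 V3 V2 :: 'f pol3 \<Rightarrow> _)" by (rule P.ev_hom) simp_all
qed (simp_all add: insert_commute)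

abbreviation s12 :: "'f::field pol3 \<Rightarrow> 'f pol3" where "s12 \<equiv> P.ev V2 V1 V3"
abbreviation s23 :: "'f::field pol3 \<Rightarrow> 'f pol3" where "s23 \<equiv> P.ev V1 V3 V2"
abbreviation dl12 :: "'f::field pol3 \<Rightarrow> 'f pol3" where "dl12 \<equiv> swap.dl s12 V1 V2"
abbreviation dl23 :: "'f::field pol3 \<Rightarrow> 'f pol3" where "dl23 \<equiv> swap.dl s23 V2 V3"

text \<open>An inverse modulo \<open>null\<close> is enough for cancelling. This is how the
  denominators \<open>E1\<close> disappear, being units only in this weak sense.\<close>

lemma null_cancel:
  assumes "null p m (e * b - 1)" "null p m (e * x)"
  shows "null p m x"
proof -
  have "x = b * (e * x) - (e * b - 1) * x"
    by (simp add: algebra_simps)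
  then show ?thesis
    using assms by (metis null_diff null_mult null_mult')
qed

lemma (in swap) null_dl_diff:
  assumes "null p (Suc m) (x - y)"
  shows "null p m (dl x - dl y)"
  using null_dl[OF assms] by (simp add: dl_diff)

lemma null_mult_diff:
  assumes "null p m (x - x')" "null p m (y - y')"
  shows "null p m (x * y - x' * y')"
proof -
  have "x * y - x' * y' = (x - x') * y + x' * (y - y')"
    by (simp add: algebra_simps)
  then show ?thesis
    using assms by (simp add: null_add null_mult null_mult')
qed

text \<open>The exponent 4 pays for the divided difference that inverts \<open>E1\<close> and for
  the two Demazure operators in the braid relation; the one remaining power of \<open>p\<close>
  makes the error vanish under evaluation.\<close>

locale coordinate_change =
  fixes \<alpha> \<beta> \<alpha>' \<beta>' :: "'f::field" and p E L :: "'f poly"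
  assumes inverse: "p ^ 4 dvd pcompose L E - [:0, 1:]"
    and twist: "p ^ 4 dvd pcompose E [:\<beta>, \<alpha>:] - pcompose [:\<beta>', \<alpha>':] E"
begin

definition sg :: "'f pol3 \<Rightarrow> 'f pol3" where "sg t = cst \<beta> + t * cst \<alpha>"
definition X :: "'f pol3 \<Rightarrow> 'f pol3" where "X t = P.pe E t"
definition E1 :: "'f pol3 \<Rightarrow> 'f pol3 \<Rightarrow> 'f pol3" where "E1 t u = divdiff cst E t u"
definition D :: "'f pol3 \<Rightarrow> 'f pol3 \<Rightarrow> 'f pol3" where "D t u = divdiff cst L (X t) (X u)"
text \<open>\<open>D t u\<close> plays the role of \<open>1 / E1 t u\<close>. Up to
  \<open>null\<close> this is \<open>(E(t) - \<alpha>' E(u) - \<beta>') (t - u) / ((t - \<alpha> u -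
  \<beta>) (E(t) - E(u)))\<close>, written as a polynomial.\<close>

definition h :: "'f pol3 \<Rightarrow> 'f pol3 \<Rightarrow> 'f pol3" where "h t u = divdiff cst E t (sg u) * D t u"
definition v :: "'f pol3 \<Rightarrow> 'f pol3 \<Rightarrow> 'f pol3" where "v t u = t - sg u"
definition k :: "'f pol3 \<Rightarrow> 'f pol3 \<Rightarrow> 'f pol3" where "k t u = v t u * h t u"
definition w :: "'f pol3 \<Rightarrow> 'f pol3 \<Rightarrow> 'f pol3" where "w t u = X t - cst \<alpha>' * X u - cst \<beta>'"

text \<open>The chain rule for \<open>pcompose L E\<close>, which is the identity up to a multiple
  of \<open>p ^ 4\<close>; taking the divided difference costs one power.\<close>

lemma E1_D:
  assumes "t \<in> vars" "u \<in> vars" "t \<noteq> u"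
  shows "null p 3 (E1 t u * D t u - 1)"
proof -
  have "null p 3 (divdiff cst (pcompose L E - [:0, 1:]) t u)"
    using assms inverse by (intro null_divdiff) (simp_all add: eval_nat_numeral)
  also have "divdiff cst (pcompose L E - [:0, 1:]) t u = E1 t u * D t u - 1"
    unfolding P.divdiff_diff P_divdiff_pcompose[OF assms(3)] P_divdiff_id E1_def D_def X_def by (simp add: mult.commute)
  finally show ?thesis .
qed

lemma E1_spec: "(t - u) * E1 t u = X t - X u"
  by (simp add: E1_def X_def P_divdiff_spec)

lemma E1_commute: "t \<noteq> u \<Longrightarrow> E1 u t = E1 t u"
  unfolding E1_def by (rule P_divdiff_commute) auto

text \<open>The factor \<open>v t u\<close> cancels the denominator of the divided difference at
  \<open>t\<close> and \<open>sg u\<close>. What is left, \<open>E(t) - E(sg u)\<close>, differs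
  from \<open>w t u\<close> by the error in \<open>twist\<close> at \<open>u\<close>.\<close>

lemma k_w:
  assumes "u \<in> vars"
  shows "null p 4 (k t u - w t u * D t u)"
proof -
  have sg: "sg u = P.pe [:\<beta>, \<alpha>:] u"
    by (simp add: sg_def)
  have "k t u = (P.pe E t - P.pe E (sg u)) * D t u"
    unfolding k_def v_def h_def P_divdiff_spec[symmetric] by (simp add: mult.assoc)
  moreover have "P.pe (pcompose [:\<beta>', \<alpha>':] E) u = cst \<alpha>' * X u + cst \<beta>'"
    by (simp add: P.pe_pcompose X_def algebra_simps)
  ultimately have "k t u - w t u * D t u
      = - P.pe (pcompose E [:\<beta>, \<alpha>:] - pcompose [:\<beta>', \<alpha>':] E) u * D t u"
    unfolding P.pe_diff P.pe_pcompose[where f = E] sg w_def by (simp add: X_def algebra_simps)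
  then show ?thesis
    using null_pe[OF twist assms] by (simp add: null_mult null_uminus)
qed

lemma E1_k:
  assumes "t \<in> vars" "u \<in> vars" "t \<noteq> u"
  shows "null p 3 (E1 t u * k t u - w t u)"
proof -
  have "E1 t u * k t u - w t u = E1 t u * (k t u - w t u * D t u) + w t u * (E1 t u * D t u - 1)"
    by (simp add: algebra_simps)
  then show ?thesis
    using null_le[OF k_w, of u 3] E1_D assms by (simp add: null_add null_mult')
qed

end

locale change_swap = coordinate_change \<alpha> \<beta> \<alpha>' \<beta>' p E L + swap s U W Z
  for \<alpha> \<beta> \<alpha>' \<beta>' :: "'f::field" and p E L and s :: "'f pol3 \<Rightarrow> 'f pol3" and U W Z
begin

lemma s_cc: "s (sg t) = sg (s t)" "s (X t) = X (s t)" "s (E1 t u) = E1 (s t) (s u)"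
  "s (D t u) = D (s t) (s u)" "s (h t u) = h (s t) (s u)" "s (v t u) = v (s t) (s u)"
  "s (k t u) = k (s t) (s u)" "s (w t u) = w (s t) (s u)"
  by (simp_all add: sg_def X_def E1_def D_def h_def v_def k_def w_def s_simps s_pe s_divdiff)

lemma s_E1: "s (E1 U W) = E1 U W"
  using neq by (simp add: s_cc swap E1_commute)

lemma dl_w: "dl (w U W) = cst (1 + \<alpha>') * E1 U W"
proof (rule dl_unique)
  have "(U - W) * (cst (1 + \<alpha>') * E1 U W) = cst (1 + \<alpha>') * (X U - X W)"
    unfolding E1_spec[symmetric] by (simp add: algebra_simps)
  then show "(U - W) * (cst (1 + \<alpha>') * E1 U W) = w U W - s (w U W)"
    unfolding s_cc swap by (simp add: w_def P.sc_add algebra_simps)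
qed

text \<open>The condition on \<open>h\<close> behind the new quadratic relation. Multiplication by
  the symmetric \<open>E1 U W\<close> commutes with \<open>dl\<close> and replaces \<open>k\<close>
  by \<open>w\<close>, for which the Demazure operator is known exactly.\<close>

lemma quadratic: "null p 2 (dl (k U W) - cst (1 + \<alpha>'))"
proof (rule null_cancel)
  have UW: "U \<in> vars" "W \<in> vars" unfolding vars by auto
  show "null p 2 (E1 U W * D U W - 1)"
    using E1_D[OF UW neq] by (rule null_le) simp
  have "null p 2 (dl (E1 U W * k U W) - dl (w U W))"
    using E1_k[OF UW neq] by (intro null_dl_diff) (simp add: eval_nat_numeral)
  then show "null p 2 (E1 U W * (dl (k U W) - cst (1 + \<alpha>')))"
    by (simp add: dl_mult_sym[OF s_E1] dl_w algebra_simps)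
qed

lemma dl_E: "dl (X U) = E1 U W"
  by (rule dl_unique) (simp add: E1_spec s_cc swap)

lemma dl_v: "dl (v U W) = cst (1 + \<alpha>)"
  by (rule dl_unique) (simp add: v_def sg_def s_simps P.sc_add algebra_simps)

end

text \<open>Multiplication by the Vandermonde product of the \<open>x\<close>s clears all
  denominators; the differences of the \<open>x\<close>s combine with the \<open>e\<close>s into
  differences of the \<open>X\<close>s, and a cubic identity in the \<open>X\<close>s
  remains.\<close>

lemma braid_identity:
  fixes x1 x2 x3 :: "'a::idom"
  assumes "x1 \<noteq> x2" "x2 \<noteq> x3" "x1 \<noteq> x3"
    and "(x1 - x2) * e12 = X1 - X2" "(x2 - x3) * e23 = X2 - X3" "(x1 - x3) * e13 = X1 - X3"
    and d: "(x2 - x3) * d = e13 * (X1 - a * X2 - b) - e12 * (X1 - a * X3 - b)"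
    and d': "(x1 - x3) * d' = e23 * (X2 - a * X1 - b) - e12 * (X2 - a * X3 - b)"
    and g: "(x1 - x2) * g = (X2 - a * X3 - b) * d - (X1 - a * X3 - b) * d'"
  shows "g = a * (e12 * e13 * e23)"
proof -
  let ?V = "(x1 - x2) * (x2 - x3) * (x1 - x3)"
  have "?V * g = (x2 - x3) * (x1 - x3) * ((x1 - x2) * g)"
    by (simp only: mult_ac)
  also have "\<dots> = (X2 - a * X3 - b) * (x1 - x3) * ((x2 - x3) * d) - (X1 - a * X3 - b) * (x2 - x3) * ((x1 - x3) * d')"
    unfolding g by (simp add: algebra_simps)
  also have "\<dots> = (X2 - a * X3 - b) * (X1 - a * X2 - b) * ((x1 - x3) * e13)
      - (X1 - a * X3 - b) * (X2 - a * X1 - b) * ((x2 - x3) * e23)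
      - (X2 - a * X3 - b) * (X1 - a * X3 - b) * ((x1 - x2) * e12)"
    unfolding d d' by (simp add: algebra_simps)
  also have "\<dots> = a * ((X1 - X2) * (X1 - X3) * (X2 - X3))"
    unfolding assms(4-6) by (simp add: algebra_simps)
  also have "\<dots> = ?V * (a * (e12 * e13 * e23))"
    unfolding assms(4-6)[symmetric] by (simp add: algebra_simps)
  finally show ?thesis
    using assms(1-3) by simp
qed

text \<open>Counterpart for the opposite order of the two operators. Reversing the three indices
  does not preserve the form \<open>X_i - a X_j - b\<close> of the factors, so the cubic identity is
  a different one.\<close>

lemma braid_identity':
  fixes x1 x2 x3 :: "'a::idom"
  assumes "x1 \<noteq> x2" "x2 \<noteq> x3" "x1 \<noteq> x3"
    and "(x1 - x2) * e12 = X1 - X2" "(x2 - x3) * e23 = X2 - X3" "(x1 - x3) * e13 = X1 - X3"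
    and d: "(x1 - x2) * d = e13 * (X2 - a * X3 - b) - e23 * (X1 - a * X3 - b)"
    and d': "(x1 - x3) * d' = e12 * (X3 - a * X2 - b) - e23 * (X1 - a * X2 - b)"
    and g: "(x2 - x3) * g = (X1 - a * X2 - b) * d - (X1 - a * X3 - b) * d'"
  shows "g = a * (e12 * e13 * e23)"
proof -
  let ?V = "(x1 - x2) * (x2 - x3) * (x1 - x3)"
  have "?V * g = (x1 - x2) * (x1 - x3) * ((x2 - x3) * g)"
    by (simp only: mult_ac)
  also have "\<dots> = (X1 - a * X2 - b) * (x1 - x3) * ((x1 - x2) * d) - (X1 - a * X3 - b) * (x1 - x2) * ((x1 - x3) * d')"
    unfolding g by (simp add: algebra_simps)
  also have "\<dots> = (X1 - a * X2 - b) * (X2 - a * X3 - b) * ((x1 - x3) * e13)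
      - (X1 - a * X3 - b) * (X3 - a * X2 - b) * ((x1 - x2) * e12)
      - (X1 - a * X2 - b) * (X1 - a * X3 - b) * ((x2 - x3) * e23)"
    unfolding d d' by (simp add: algebra_simps)
  also have "\<dots> = a * ((X1 - X2) * (X1 - X3) * (X2 - X3))"
    unfolding assms(4-6) by (simp add: algebra_simps)
  also have "\<dots> = ?V * (a * (e12 * e13 * e23))"
    unfolding assms(4-6)[symmetric] by (simp add: algebra_simps)
  finally show ?thesis
    using assms(1-3) by simp
qed


lemma null_one_mult: "null p m (x - 1) \<Longrightarrow> null p m (y - 1) \<Longrightarrow> null p m (x * y - 1)"
  using null_mult_diff[of p m x 1 y 1] by simp

context coordinate_change
begin

interpretation C12: change_swap \<alpha> \<beta> \<alpha>' \<beta>' p E L s12 V1 V2 V3 ..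
interpretation C23: change_swap \<alpha> \<beta> \<alpha>' \<beta>' p E L s23 V2 V3 V1 ..

text \<open>A common denominator: invariant under both transpositions, hence passing through
  \<open>dl12\<close> and \<open>dl23\<close>, and invertible modulo \<open>null\<close>.\<close>

definition e :: "'f pol3" where "e = E1 V1 V2 * E1 V1 V3 * E1 V2 V3"

lemma s_e: "s12 e = e" "s23 e = e"
  unfolding e_def S12.s_simps S23.s_simps C12.s_cc C23.s_cc S12.swap S23.swap
  by (simp_all add: E1_commute mult_ac)

lemma e_inverse: "null p 3 (e * (D V1 V2 * D V1 V3 * D V2 V3) - 1)"
proof -
  have "null p 3 ((E1 V1 V2 * D V1 V2) * (E1 V1 V3 * D V1 V3) * (E1 V2 V3 * D V2 V3) - 1)"
    by (intro null_one_mult E1_D) simp_all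
  then show ?thesis
    by (simp add: e_def mult_ac)
qed

lemma e_k:
  "null p 3 (e * k V1 V2 - E1 V1 V3 * E1 V2 V3 * w V1 V2)"
  "null p 3 (e * k V2 V3 - E1 V1 V2 * E1 V1 V3 * w V2 V3)"
proof -
  have "null p 3 (E1 V1 V3 * E1 V2 V3 * (E1 V1 V2 * k V1 V2 - w V1 V2))"
    "null p 3 (E1 V1 V2 * E1 V1 V3 * (E1 V2 V3 * k V2 V3 - w V2 V3))"
    by (intro null_mult' E1_k; simp)+
  then show "null p 3 (e * k V1 V2 - E1 V1 V3 * E1 V2 V3 * w V1 V2)"
    "null p 3 (e * k V2 V3 - E1 V1 V2 * E1 V1 V3 * w V2 V3)"
    by (simp_all add: e_def algebra_simps)
qed

lemma braid_w:
  "dl12 (w V2 V3 * (E1 V1 V2 * E1 V1 V3) * dl23 (E1 V1 V3 * E1 V2 V3 * w V1 V2)) = cst \<alpha>' * e * e"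
proof -
  define d where "d = dl23 (E1 V1 V3 * w V1 V2)"
  have "dl23 (E1 V2 V3 * (E1 V1 V3 * w V1 V2)) = E1 V2 V3 * d"
    unfolding d_def by (rule S23.dl_mult_sym[OF C23.s_E1])
  then have "w V2 V3 * (E1 V1 V2 * E1 V1 V3) * dl23 (E1 V1 V3 * E1 V2 V3 * w V1 V2) = e * (w V2 V3 * d)"
    by (simp add: e_def mult_ac)
  then have "dl12 (w V2 V3 * (E1 V1 V2 * E1 V1 V3) * dl23 (E1 V1 V3 * E1 V2 V3 * w V1 V2))
      = e * dl12 (w V2 V3 * d)"
    by (simp only: S12.dl_mult_sym[OF s_e(1)])
  also have "dl12 (w V2 V3 * d) = cst \<alpha>' * (E1 V1 V2 * E1 V1 V3 * E1 V2 V3)"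
  proof (rule braid_identity[where ?x1.0 = V1 and ?x2.0 = V2 and ?x3.0 = V3
        and ?X1.0 = "X V1" and ?X2.0 = "X V2" and ?X3.0 = "X V3" and b = "cst \<beta>'"])
    show d: "(V2 - V3) * d = E1 V1 V3 * (X V1 - cst \<alpha>' * X V2 - cst \<beta>')
        - E1 V1 V2 * (X V1 - cst \<alpha>' * X V3 - cst \<beta>')"
      unfolding d_def S23.dl_spec S23.s_simps C23.s_cc S23.swap by (simp add: w_def)
    have "s12 ((V2 - V3) * d) = s12 (E1 V1 V3 * (X V1 - cst \<alpha>' * X V2 - cst \<beta>')
        - E1 V1 V2 * (X V1 - cst \<alpha>' * X V3 - cst \<beta>'))"
      unfolding d ..
    then show "(V1 - V3) * s12 d = E1 V2 V3 * (X V2 - cst \<alpha>' * X V1 - cst \<beta>')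
        - E1 V1 V2 * (X V2 - cst \<alpha>' * X V3 - cst \<beta>')"
      unfolding S12.s_simps C12.s_cc S12.swap by (simp add: E1_commute)
    show "(V1 - V2) * dl12 (w V2 V3 * d) = (X V2 - cst \<alpha>' * X V3 - cst \<beta>') * d
        - (X V1 - cst \<alpha>' * X V3 - cst \<beta>') * s12 d"
      unfolding S12.dl_spec S12.s_simps C12.s_cc S12.swap by (simp add: w_def)
  qed (simp_all add: E1_spec)
  finally show ?thesis
    by (simp add: e_def mult_ac)
qed

text \<open>One factor \<open>e\<close> clears the denominator of each \<open>k\<close>, whence
  \<open>e * e\<close>. The order is 3 for the cleared factors, 2 after \<open>dl23\<close> and 1
  after \<open>dl12\<close>.\<close>

lemma braid_k: "null p 1 (dl12 (k V2 V3 * dl23 (k V1 V2)) - cst \<alpha>')"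
proof (rule null_cancel)
  let ?b = "D V1 V2 * D V1 V3 * D V2 V3"
  have "null p 3 ((e * ?b) * (e * ?b) - 1)"
    by (intro null_one_mult e_inverse)
  then have "null p 1 ((e * ?b) * (e * ?b) - 1)"
    by (rule null_le) simp
  then show "null p 1 ((e * e) * (?b * ?b) - 1)"
    by (simp add: mult_ac)
  have "null p 2 (dl23 (e * k V1 V2) - dl23 (E1 V1 V3 * E1 V2 V3 * w V1 V2))"
    using e_k(1) by (intro S23.null_dl_diff) (simp add: eval_nat_numeral)
  moreover have "null p 2 (e * k V2 V3 - w V2 V3 * (E1 V1 V2 * E1 V1 V3))"
    using null_le[OF e_k(2), of 2] by (simp add: mult_ac)
  ultimately have "null p 2 (e * k V2 V3 * dl23 (e * k V1 V2)
      - w V2 V3 * (E1 V1 V2 * E1 V1 V3) * dl23 (E1 V1 V3 * E1 V2 V3 * w V1 V2))"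
    by (rule null_mult_diff[rotated])
  then have "null p 1 (dl12 (e * k V2 V3 * dl23 (e * k V1 V2)) - cst \<alpha>' * e * e)"
    unfolding braid_w[symmetric] by (intro S12.null_dl_diff) (simp add: eval_nat_numeral)
  moreover have "dl12 (e * k V2 V3 * dl23 (e * k V1 V2)) = e * e * dl12 (k V2 V3 * dl23 (k V1 V2))"
  proof -
    have "e * k V2 V3 * dl23 (e * k V1 V2) = e * (e * (k V2 V3 * dl23 (k V1 V2)))"
      by (simp only: S23.dl_mult_sym[OF s_e(2)] mult_ac)
    then show ?thesis
      by (simp only: S12.dl_mult_sym[OF s_e(1)] mult.assoc)
  qed
  ultimately show "null p 1 (e * e * (dl12 (k V2 V3 * dl23 (k V1 V2)) - cst \<alpha>'))"
    by (simp add: algebra_simps)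
qed

text \<open>The shape required by \<open>braid_half\<close>. As
  \<open>v V1 V3 - v V1 V2 = \<alpha> (V2 - V3)\<close>, the product
  \<open>v V1 V2 * dl23 (h V1 V2)\<close> equals \<open>dl23 (k V1 V2) + \<alpha> h V1 V3\<close>.
  The first summand leads to \<open>braid_k\<close>, the second to the correction with
  \<alpha>.\<close>

lemma braid:
  "null p 1 (dl12 (v V1 V2 * (dl23 (h V1 V2) * v V2 V3 * h V2 V3))
    + cst \<alpha> * (h V1 V3 * h V2 V3) - cst \<alpha>')"
proof -
  define d where "d = dl23 (h V1 V2)"
  have 1: "(V2 - V3) * d = h V1 V2 - h V1 V3"
    unfolding d_def S23.dl_spec C23.s_cc S23.swap ..
  have "v V1 V2 * (d * v V2 V3 * h V2 V3)
      = k V2 V3 * dl23 (k V1 V2) + (h V1 V3 * h V2 V3) * (cst \<alpha> * v V2 V3)"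
  proof -
    have "(V2 - V3) * (v V1 V2 * (d * v V2 V3 * h V2 V3)) = v V1 V2 * v V2 V3 * h V2 V3 * ((V2 - V3) * d)"
      by (simp only: mult_ac)
    also have "\<dots> = k V2 V3 * (k V1 V2 - k V1 V3) + (V2 - V3) * ((h V1 V3 * h V2 V3) * (cst \<alpha> * v V2 V3))"
      unfolding 1 k_def v_def sg_def by (simp add: algebra_simps)
    also have "k V1 V2 - k V1 V3 = (V2 - V3) * dl23 (k V1 V2)"
      unfolding S23.dl_spec C23.s_cc S23.swap ..
    finally have "(V2 - V3) * (v V1 V2 * (d * v V2 V3 * h V2 V3))
      = (V2 - V3) * (k V2 V3 * dl23 (k V1 V2) + (h V1 V3 * h V2 V3) * (cst \<alpha> * v V2 V3))"
      by (simp add: algebra_simps)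
    then show ?thesis by simp
  qed
  moreover have "dl12 ((h V1 V3 * h V2 V3) * (cst \<alpha> * v V2 V3)) = - cst \<alpha> * (h V1 V3 * h V2 V3)"
  proof -
    have "dl12 (cst \<alpha> * v V2 V3) = - cst \<alpha>"
      by (rule S12.dl_unique) (simp add: v_def sg_def S12.s_simps algebra_simps)
    moreover have "s12 (h V1 V3 * h V2 V3) = h V1 V3 * h V2 V3"
      unfolding S12.s_simps C12.s_cc S12.swap by (rule mult.commute)
    ultimately show ?thesis by (simp add: S12.dl_mult_sym)
  qed
  ultimately show ?thesis
    using braid_k by (simp add: S12.dl_add d_def)
qed

lemma braid_w':
  "dl23 (w V1 V2 * (E1 V1 V3 * E1 V2 V3) * dl12 (E1 V1 V2 * E1 V1 V3 * w V2 V3)) = cst \<alpha>' * e * e"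
proof -
  define d where "d = dl12 (E1 V1 V3 * w V2 V3)"
  have "dl12 (E1 V1 V2 * (E1 V1 V3 * w V2 V3)) = E1 V1 V2 * d"
    unfolding d_def by (rule S12.dl_mult_sym[OF C12.s_E1])
  then have "w V1 V2 * (E1 V1 V3 * E1 V2 V3) * dl12 (E1 V1 V2 * E1 V1 V3 * w V2 V3) = e * (w V1 V2 * d)"
    by (simp add: e_def mult_ac)
  then have "dl23 (w V1 V2 * (E1 V1 V3 * E1 V2 V3) * dl12 (E1 V1 V2 * E1 V1 V3 * w V2 V3))
      = e * dl23 (w V1 V2 * d)"
    by (simp only: S23.dl_mult_sym[OF s_e(2)])
  also have "dl23 (w V1 V2 * d) = cst \<alpha>' * (E1 V1 V2 * E1 V1 V3 * E1 V2 V3)"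
  proof (rule braid_identity'[where ?x1.0 = V1 and ?x2.0 = V2 and ?x3.0 = V3
        and ?X1.0 = "X V1" and ?X2.0 = "X V2" and ?X3.0 = "X V3" and b = "cst \<beta>'"])
    show d: "(V1 - V2) * d = E1 V1 V3 * (X V2 - cst \<alpha>' * X V3 - cst \<beta>')
        - E1 V2 V3 * (X V1 - cst \<alpha>' * X V3 - cst \<beta>')"
      unfolding d_def S12.dl_spec S12.s_simps C12.s_cc S12.swap by (simp add: w_def)
    have "s23 ((V1 - V2) * d) = s23 (E1 V1 V3 * (X V2 - cst \<alpha>' * X V3 - cst \<beta>')
        - E1 V2 V3 * (X V1 - cst \<alpha>' * X V3 - cst \<beta>'))"
      unfolding d ..
    then show "(V1 - V3) * s23 d = E1 V1 V2 * (X V3 - cst \<alpha>' * X V2 - cst \<beta>')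
        - E1 V2 V3 * (X V1 - cst \<alpha>' * X V2 - cst \<beta>')"
      unfolding S23.s_simps C23.s_cc S23.swap by (simp add: E1_commute)
    show "(V2 - V3) * dl23 (w V1 V2 * d) = (X V1 - cst \<alpha>' * X V2 - cst \<beta>') * d
        - (X V1 - cst \<alpha>' * X V3 - cst \<beta>') * s23 d"
      unfolding S23.dl_spec S23.s_simps C23.s_cc S23.swap by (simp add: w_def)
  qed (simp_all add: E1_spec)
  finally show ?thesis
    by (simp add: e_def mult_ac)
qed

lemma braid_k': "null p 1 (dl23 (k V1 V2 * dl12 (k V2 V3)) - cst \<alpha>')"
proof (rule null_cancel)
  let ?b = "D V1 V2 * D V1 V3 * D V2 V3"
  have "null p 3 ((e * ?b) * (e * ?b) - 1)"
    by (intro null_one_mult e_inverse)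
  then have "null p 1 ((e * ?b) * (e * ?b) - 1)"
    by (rule null_le) simp
  then show "null p 1 ((e * e) * (?b * ?b) - 1)"
    by (simp add: mult_ac)
  have "null p 2 (dl12 (e * k V2 V3) - dl12 (E1 V1 V2 * E1 V1 V3 * w V2 V3))"
    using e_k(2) by (intro S12.null_dl_diff) (simp add: eval_nat_numeral)
  moreover have "null p 2 (e * k V1 V2 - w V1 V2 * (E1 V1 V3 * E1 V2 V3))"
    using null_le[OF e_k(1), of 2] by (simp add: mult_ac)
  ultimately have "null p 2 (e * k V1 V2 * dl12 (e * k V2 V3)
      - w V1 V2 * (E1 V1 V3 * E1 V2 V3) * dl12 (E1 V1 V2 * E1 V1 V3 * w V2 V3))"
    by (rule null_mult_diff[rotated])
  then have "null p 1 (dl23 (e * k V1 V2 * dl12 (e * k V2 V3)) - cst \<alpha>' * e * e)"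
    unfolding braid_w'[symmetric] by (intro S23.null_dl_diff) (simp add: eval_nat_numeral)
  moreover have "dl23 (e * k V1 V2 * dl12 (e * k V2 V3)) = e * e * dl23 (k V1 V2 * dl12 (k V2 V3))"
  proof -
    have "e * k V1 V2 * dl12 (e * k V2 V3) = e * (e * (k V1 V2 * dl12 (k V2 V3)))"
      by (simp only: S12.dl_mult_sym[OF s_e(1)] mult_ac)
    then show ?thesis
      by (simp only: S23.dl_mult_sym[OF s_e(2)] mult.assoc)
  qed
  ultimately show "null p 1 (e * e * (dl23 (k V1 V2 * dl12 (k V2 V3)) - cst \<alpha>'))"
    by (simp add: algebra_simps)
qed

text \<open>Here the correction arises without \<alpha>, since
  \<open>v V1 V3 - v V2 V3 = V1 - V2\<close>; the coefficient comes only afterwards, from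
  \<open>dl23 (v V1 V2) = - \<alpha>\<close>.\<close>

lemma braid':
  "null p 1 (dl23 (v V2 V3 * (dl12 (h V2 V3) * v V1 V2 * h V1 V2))
    + cst \<alpha> * (h V1 V3 * h V1 V2) - cst \<alpha>')"
proof -
  define d where "d = dl12 (h V2 V3)"
  have 1: "(V1 - V2) * d = h V2 V3 - h V1 V3"
    unfolding d_def S12.dl_spec C12.s_cc S12.swap ..
  have "v V2 V3 * (d * v V1 V2 * h V1 V2)
      = k V1 V2 * dl12 (k V2 V3) + (h V1 V3 * h V1 V2) * v V1 V2"
  proof -
    have "(V1 - V2) * (v V2 V3 * (d * v V1 V2 * h V1 V2)) = v V2 V3 * v V1 V2 * h V1 V2 * ((V1 - V2) * d)"
      by (simp only: mult_ac)
    also have "\<dots> = k V1 V2 * (k V2 V3 - k V1 V3) + (V1 - V2) * ((h V1 V3 * h V1 V2) * v V1 V2)"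
      unfolding 1 k_def v_def sg_def by (simp add: algebra_simps)
    also have "k V2 V3 - k V1 V3 = (V1 - V2) * dl12 (k V2 V3)"
      unfolding S12.dl_spec C12.s_cc S12.swap ..
    finally have "(V1 - V2) * (v V2 V3 * (d * v V1 V2 * h V1 V2))
      = (V1 - V2) * (k V1 V2 * dl12 (k V2 V3) + (h V1 V3 * h V1 V2) * v V1 V2)"
      by (simp add: algebra_simps)
    then show ?thesis by simp
  qed
  moreover have "dl23 ((h V1 V3 * h V1 V2) * v V1 V2) = - cst \<alpha> * (h V1 V3 * h V1 V2)"
  proof -
    have "dl23 (v V1 V2) = - cst \<alpha>"
      by (rule S23.dl_unique) (simp add: v_def sg_def S23.s_simps algebra_simps)
    moreover have "s23 (h V1 V3 * h V1 V2) = h V1 V3 * h V1 V2"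
      unfolding S23.s_simps C23.s_cc S23.swap by (rule mult.commute)
    ultimately show ?thesis by (simp add: S23.dl_mult_sym)
  qed
  ultimately show ?thesis
    using braid_k' by (simp add: S23.dl_add d_def)
qed

end

section \<open>Hecke relations with affine parameters\<close>

text \<open>
  The affine Hecke relations and their degeneration in one family: \<open>a\<^sub>r\<close> is \<open>T\<^sub>r + 1\<close> or \<open>s\<^sub>r + 1\<close>, and
  \<open>(\<alpha>, \<beta>)\<close> is \<open>(q, 0)\<close> or \<open>(1, 1)\<close>. In both cases \<open>f a\<^sub>r = a\<^sub>r s\<^sub>r(f) + (x\<^sub>r - \<alpha> x\<^sub>r\<^sub>+\<^sub>1 - \<beta>) \<partial>\<^sub>r f\<close>.
\<close>

locale hecke_datum = algebra_congruence eq sc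
  for eq :: "'a::ring_1 \<Rightarrow> 'a \<Rightarrow> bool" (infix "\<approx>" 50) and sc :: "'f::field \<Rightarrow> 'a" +
  fixes \<alpha> \<beta> :: 'f and g :: "'f poly" and d :: nat and x a :: "nat \<Rightarrow> 'a"
  assumes alpha: "\<alpha> \<noteq> 0"
    and x_com: "r \<in> {1..d} \<Longrightarrow> s \<in> {1..d} \<Longrightarrow> com (x r) (x s)"
    and x_a: "1 \<le> r \<Longrightarrow> r < d \<Longrightarrow>
      x r * a r \<approx> a r * x (Suc r) + (x r - sc \<alpha> * x (Suc r) - sc \<beta>)"
    and a_x_com: "1 \<le> r \<Longrightarrow> r < d \<Longrightarrow> s \<in> {1..d} \<Longrightarrow> s \<noteq> r \<Longrightarrow> s \<noteq> Suc r \<Longrightarrow> com (a r) (x s)"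
    and a_sq: "1 \<le> r \<Longrightarrow> r < d \<Longrightarrow> a r * a r \<approx> sc (1 + \<alpha>) * a r"
    and a_braid: "1 \<le> r \<Longrightarrow> Suc r < d \<Longrightarrow>
      a r * a (Suc r) * a r - sc \<alpha> * a r \<approx> a (Suc r) * a r * a (Suc r) - sc \<alpha> * a (Suc r)"
    and a_com: "1 \<le> r \<Longrightarrow> Suc r < s \<Longrightarrow> s < d \<Longrightarrow> com (a r) (a s)"
    and cyclotomic: "1 \<le> d \<Longrightarrow> pe g (x 1) \<approx> 0"
begin

text \<open>By \<open>a_sq\<close> and \<alpha> being nonzero, \<open>a r - 1\<close> is invertible,
  and this turns the commutation of \<open>x r\<close> into that of
  \<open>x (Suc r)\<close>.\<close>

lemma x_a':
  assumes "1 \<le> r" "r < d"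
  shows "x (Suc r) * a r \<approx> a r * x r - (x r - sc \<alpha> * x (Suc r) - sc \<beta>)"
proof -
  define A B b T y z where "A = sc \<alpha>" "B = sc \<beta>" "b = a r" "T = b - 1" "y = x (Suc r)" "z = x r"
  note defs = this
  have central: "t * A = A * t" "t * B = B * t" for t
    by (simp_all add: defs sc_commute)
  have central': "t * (A * u) = A * (t * u)" "t * (B * u) = B * (t * u)" for t u
    by (metis central mult.assoc)+
  define R1 where "R1 = z * b - (b * y + (z - A * y - B))"
  define R2 where "R2 = b * b - (1 + A) * b"
  define C where "C = T * R1 + R2 * y"
  have R: "R1 \<approx> 0" "R2 \<approx> 0"
    using x_a[OF assms] a_sq[OF assms]
    by (simp_all add: R1_def R2_def defs sc_add flip: eq_iff_diff)
  \<comment> \<open>\<open>C\<close> equals \<open>T * z * T - A * y + T * B\<close> and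
    \<open>R2\<close> equals \<open>T * (T - A + 1) - A\<close>. So \<open>T - A + 1\<close> is
    \<open>A\<close> times the inverse of \<open>T\<close> modulo \<open>R2\<close>, and multiplying
    \<open>C\<close> by it on the right removes the last \<open>T\<close>.\<close>
  have "A * (y * b - (b * z - (z - A * y - B))) = (T * z + B) * R2 - C * (T - A + 1)"
    unfolding C_def R1_def R2_def \<open>T = b - 1\<close>
    by (simp add: algebra_simps central[of b] central[of y] central[of z] central'[of b] central'[of y]
        central'[of z] central(2)[of A] central'(2)[of A])
  also have "\<dots> \<approx> 0"
    unfolding C_def by (intro eq_0_diff eq_0_mult_left eq_0_mult_right eq_0_add R)
  finally have "sc (inverse \<alpha>) * (A * (y * b - (b * z - (z - A * y - B)))) \<approx> 0"
    by (rule eq_0_mult_left)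
  then have "y * b - (b * z - (z - A * y - B)) \<approx> 0"
    using alpha by (simp add: defs flip: mult.assoc sc_mult)
  then show ?thesis
    by (simp add: defs flip: eq_iff_diff)
qed

lemma ev_commutation:
  assumes r: "1 \<le> r" "r < d" and z: "com (x r) z" "com (x (Suc r)) z" "com (a r) z"
  shows "ev (x r) (x (Suc r)) z f * a r \<approx> a r * ev (x r) (x (Suc r)) z (s12 f)
    + ev (x r) (x (Suc r)) z (dl12 f * (V1 - cst \<alpha> * V2 - cst \<beta>))"
proof (rule dl_commutation)
  let ?e = "ev (x r) (x (Suc r)) z"
  have hom: "hom_mod ?e"
    using r z by (intro ev_hom x_com) auto
  note e = hom_modD[OF hom]
  have v: "?e (V1 - cst \<alpha> * V2 - cst \<beta>) \<approx> x r - sc \<alpha> * x (Suc r) - sc \<beta>"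
    using e(4)[of "cst \<alpha>" V2] by (simp add: e(6) eq_diff)
  show "swap s12 V1 V2 V3" ..
  show "hom_mod ?e" by fact
  show "?e V1 * a r \<approx> a r * ?e V2 + ?e (V1 - cst \<alpha> * V2 - cst \<beta>)"
    using x_a[OF r] v by (simp, meson eq_add eq_refl eq_sym eq_trans)
  show "?e V2 * a r \<approx> a r * ?e V1 - ?e (V1 - cst \<alpha> * V2 - cst \<beta>)"
    using x_a'[OF r] v by (simp, meson eq_diff eq_refl eq_sym eq_trans)
  show "?e V3 * a r \<approx> a r * ?e V3"
    using z(3) by (simp add: com_def eq_sym)
qed simp

lemma ev_commutation':
  assumes r: "1 \<le> r" "Suc r < d"
  shows "ev (x r) (x (Suc r)) (x (Suc (Suc r))) f * a (Suc r)
    \<approx> a (Suc r) * ev (x r) (x (Suc r)) (x (Suc (Suc r))) (s23 f)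
    + ev (x r) (x (Suc r)) (x (Suc (Suc r))) (dl23 f * (V2 - cst \<alpha> * V3 - cst \<beta>))"
proof (rule dl_commutation)
  let ?e = "ev (x r) (x (Suc r)) (x (Suc (Suc r)))"
  have hom: "hom_mod ?e"
    using r by (intro ev_hom x_com) auto
  note e = hom_modD[OF hom]
  have v: "?e (V2 - cst \<alpha> * V3 - cst \<beta>) \<approx> x (Suc r) - sc \<alpha> * x (Suc (Suc r)) - sc \<beta>"
    using e(4)[of "cst \<alpha>" V3] by (simp add: e(6) eq_diff)
  show "swap s23 V2 V3 V1" ..
  show "hom_mod ?e" by fact
  show "?e V2 * a (Suc r) \<approx> a (Suc r) * ?e V3 + ?e (V2 - cst \<alpha> * V3 - cst \<beta>)"
    using x_a[of "Suc r"] r v by (simp, meson eq_add eq_refl eq_sym eq_trans)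
  show "?e V3 * a (Suc r) \<approx> a (Suc r) * ?e V2 - ?e (V2 - cst \<alpha> * V3 - cst \<beta>)"
    using x_a'[of "Suc r"] r v by (simp, meson eq_diff eq_refl eq_sym eq_trans)
  show "?e V1 * a (Suc r) \<approx> a (Suc r) * ?e V1"
    using a_x_com[of "Suc r" r] r by (simp add: com_def eq_sym)
qed simp

text \<open>
  If \<open>f(x\<^sub>r) = 0\<close>, then \<open>f(x\<^sub>r\<^sub>+\<^sub>1)\<close> commutes with \<open>a\<^sub>r\<close>, their product being \<open>W = - v \<partial>f\<close>. Evaluating \<open>W\<^sup>2\<close>
  with the quadratic relation for \<open>a\<^sub>r\<close> leaves a relation between \<open>x\<^sub>r\<close> and \<open>x\<^sub>r\<^sub>+\<^sub>1\<close> only.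
\<close>

lemma annihilator_step:
  assumes r: "1 \<le> r" "r < d" and f: "pe f (x r) \<approx> 0"
  shows "pe (f * f * pcompose f [:\<beta>, \<alpha>:] * pcompose f [:- \<beta> / \<alpha>, 1 / \<alpha>:]) (x (Suc r)) \<approx> 0"
proof -
  let ?e = "ev (x r) (x (Suc r)) 0"
  have hom: "hom_mod ?e"
    using r by (intro ev_hom x_com) auto
  note e = hom_modD[OF hom]
  define F G v v' where "F = P.pe f V1" "G = P.pe f V2"
    "v = V1 - cst \<alpha> * V2 - cst \<beta>" "v' = V2 - cst \<alpha> * V1 - cst \<beta>"
  note defs = this
  define \<delta> where "\<delta> = dl12 F"
  define S R :: "'f pol3" where "S = P.pe [:\<beta>, \<alpha>:] V2" "R = P.pe [:- \<beta> / \<alpha>, 1 / \<alpha>:] V2"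
  note SR = this
  have F_s: "s12 F = G" "s12 G = F"
    by (simp_all add: defs S12.s_pe S12.swap)
  have dl_G: "dl12 G = - \<delta>"
    by (rule S12.dl_unique) (simp add: F_s S12.dl_spec \<delta>_def)
  have F: "?e F \<approx> 0"
    using hom_poly_eval[OF hom, of cst V1 f] f by (auto simp: defs intro: eq_trans)
  have comm: "?e f * a r \<approx> a r * ?e (s12 f) + ?e (dl12 f * v)" for f
    unfolding defs using ev_commutation[OF r, of 0 f] by simp
  have Q_mult: "?e (c * u) \<approx> 0" if "?e u \<approx> 0" for c u
    using e(4)[of c u] eq_0_mult_left[OF that] eq_trans by blast
  have Q_reduce: "?e z \<approx> 0" if "?e u \<approx> 0" "c * u = z + t * F" for c u z t
    using eq_0_diff[OF Q_mult[OF that(1), of c] Q_mult[OF F, of t]] by (simp add: that(2) e(3))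
  have 1: "a r * ?e G \<approx> - ?e (\<delta> * v)"
  proof -
    have "a r * ?e G + ?e (\<delta> * v) \<approx> ?e F * a r"
      using eq_sym[OF comm[of F]] by (simp add: F_s \<delta>_def)
    also have "\<dots> \<approx> 0" by (rule eq_0_mult_right[OF F])
    finally show ?thesis by (subst eq_iff_diff) simp
  qed
  have 2: "?e G * a r \<approx> - ?e (\<delta> * v)"
  proof -
    have "?e G * a r \<approx> a r * ?e F + ?e (- (\<delta> * v))"
      using comm[of G] by (simp add: F_s dl_G)
    also have "\<dots> \<approx> 0 + ?e (- (\<delta> * v))"
      by (intro eq_add eq_refl eq_0_mult_left F)
    finally show ?thesis by (simp add: e)
  qed
  have "?e (\<delta> * v) * ?e (\<delta> * v) \<approx> (?e G * a r) * (a r * ?e G)"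
    using eq_mult[OF eq_sym[OF 2] eq_sym[OF 1]] by simp
  also have "\<dots> = ?e G * (a r * a r) * ?e G"
    by (simp add: mult.assoc)
  also have "\<dots> \<approx> ?e G * (sc (1 + \<alpha>) * a r) * ?e G"
    by (intro eq_mult_left eq_mult_right a_sq r)
  also have "\<dots> = sc (1 + \<alpha>) * ?e G * (a r * ?e G)"
    by (simp add: mult.assoc sc_commute[of "1 + \<alpha>"])
  also have "\<dots> \<approx> sc (1 + \<alpha>) * ?e G * (- ?e (\<delta> * v))"
    by (rule eq_mult_left[OF 1])
  also have "\<dots> = - (?e (cst (1 + \<alpha>)) * (?e G * ?e (\<delta> * v)))"
    by (simp add: mult.assoc)
  also have "\<dots> \<approx> - ?e (cst (1 + \<alpha>) * (G * (\<delta> * v)))"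
    by (meson e(4) eq_mult_left eq_sym eq_trans eq_uminus)
  finally have "?e (\<delta> * v) * ?e (\<delta> * v) \<approx> - ?e (cst (1 + \<alpha>) * (G * (\<delta> * v)))" .
  from eq_trans[OF e(4) this]
  have Q: "?e (\<delta> * v * (\<delta> * v) + cst (1 + \<alpha>) * (G * (\<delta> * v))) \<approx> 0"
    unfolding e(3) by (subst (asm) eq_iff_diff) simp
  have \<delta>: "(V1 - V2) * \<delta> = F - G"
    by (simp add: \<delta>_def S12.dl_spec F_s)
  have vv: "v' = v - cst (1 + \<alpha>) * (V1 - V2)"
    by (simp add: defs P.sc_add algebra_simps)
  \<comment> \<open>Replacing \<open>G\<close> by \<open>F - (V1 - V2) * \<delta>\<close> changes
    one factor \<open>v\<close> into \<open>v'\<close>.\<close>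
  have Q1: "?e (\<delta> * \<delta> * v * v') \<approx> 0"
  proof (rule Q_reduce[OF Q, of 1 _ "cst (1 + \<alpha>) * \<delta> * v"])
    have F_G: "F = G + (V1 - V2) * \<delta>" by (simp add: \<delta>)
    show "1 * (\<delta> * v * (\<delta> * v) + cst (1 + \<alpha>) * (G * (\<delta> * v))) =
      \<delta> * \<delta> * v * v' + cst (1 + \<alpha>) * \<delta> * v * F"
      unfolding vv F_G by (simp add: algebra_simps)
  qed
  \<comment> \<open>Multiplication by \<open>(V1 - V2)\<close> twice turns the two
    \<open>\<delta>\<close> into \<open>F - G\<close>, whose square is \<open>G * G\<close> up to
    multiples of \<open>F\<close>.\<close>
  have Q2: "?e (G * G * v * v') \<approx> 0"
  proof (rule Q_reduce[OF Q1, of "(V1 - V2) * (V1 - V2)" _ "(F - 2 * G) * v * v'"])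
    have "(V1 - V2) * (V1 - V2) * (\<delta> * \<delta> * v * v') = ((V1 - V2) * \<delta>) * ((V1 - V2) * \<delta>) * v * v'"
      by (simp only: mult_ac)
    then show "(V1 - V2) * (V1 - V2) * (\<delta> * \<delta> * v * v') = G * G * v * v' + (F - 2 * G) * v * v' * F"
      unfolding \<delta> by (simp add: algebra_simps)
  qed
  \<comment> \<open>\<open>v = V1 - S\<close> divides \<open>F - f(S)\<close>, and \<open>F\<close>
    evaluates to zero, so \<open>v\<close> is traded for \<open>f(S)\<close>, a polynomial in
    \<open>V2\<close> only. The same is done next with \<open>v'\<close> and
    \<open>R\<close>.\<close>
  have Q3: "?e (G * G * P.pe f S * v') \<approx> 0"
  proof (rule Q_reduce[OF Q2, of "- divdiff cst f V1 S" _ "- G * G * v'"])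
    have "v = V1 - S" by (simp add: defs SR algebra_simps)
    then have "v * divdiff cst f V1 S = F - P.pe f S"
      by (simp only: P_divdiff_spec defs(1))
    note eq = this
    have "- divdiff cst f V1 S * (G * G * v * v') = - G * G * (v * divdiff cst f V1 S) * v'"
      by (simp add: mult_ac)
    then show "- divdiff cst f V1 S * (G * G * v * v') = G * G * P.pe f S * v' + - G * G * v' * F"
      unfolding eq by (simp add: algebra_simps)
  qed
  have Q4: "?e (G * G * P.pe f S * P.pe f R) \<approx> 0"
  proof (rule Q_reduce[OF Q3, of "cst (1 / \<alpha>) * divdiff cst f V1 R" _ "- G * G * P.pe f S"])
    have "cst (1 / \<alpha>) * v' = - (V1 - R)"
    proof -
      have "cst (1 / \<alpha>) * cst \<alpha> = 1" using alpha by (simp flip: P.sc_mult)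
      moreover have "cst (1 / \<alpha>) * cst \<beta> = cst (\<beta> / \<alpha>)" by (simp flip: P.sc_mult)
      ultimately show ?thesis
        by (simp add: defs SR P.sc_minus right_diff_distrib algebra_simps flip: mult.assoc)
    qed
    then have "cst (1 / \<alpha>) * v' * divdiff cst f V1 R = - ((V1 - R) * divdiff cst f V1 R)"
      by (simp only: mult_minus_left)
    also have "\<dots> = P.pe f R - F"
      unfolding P_divdiff_spec by (simp add: defs)
    finally have eq: "cst (1 / \<alpha>) * v' * divdiff cst f V1 R = P.pe f R - F" .
    have "cst (1 / \<alpha>) * divdiff cst f V1 R * (G * G * P.pe f S * v')
        = G * G * P.pe f S * (cst (1 / \<alpha>) * v' * divdiff cst f V1 R)"
      by (simp only: mult_ac)
    then show "cst (1 / \<alpha>) * divdiff cst f V1 R * (G * G * P.pe f S * v')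
        = G * G * P.pe f S * P.pe f R + - G * G * P.pe f S * F"
      unfolding eq by (simp add: algebra_simps)
  qed
  have eq: "G * G * P.pe f S * P.pe f R = P.pe (f * f * pcompose f [:\<beta>, \<alpha>:] * pcompose f [:- \<beta> / \<alpha>, 1 / \<alpha>:]) V2"
    unfolding SR defs by (simp only: P.pe_mult P.pe_pcompose)
  have "?e (P.pe q V2) \<approx> pe q (x (Suc r))" for q
    using hom_poly_eval[OF hom, of cst V2 q] by simp
  from eq_trans[OF eq_sym[OF this] Q4[unfolded eq]] show ?thesis .
qed

end

context algebra_congruence
begin

text \<open>The counterpart of \<open>h\<close> with algebra elements in place of variables;
  \<open>\<theta>_h\<close> compares the two.\<close>

definition twist_factor :: "'f \<Rightarrow> 'f \<Rightarrow> 'f poly \<Rightarrow> 'f poly \<Rightarrow> 'a \<Rightarrow> 'a \<Rightarrow> 'a"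
  where "twist_factor \<alpha> \<beta> E L t u = divdiff sc E t (sc \<beta> + u * sc \<alpha>) * divdiff sc L (pe E t) (pe E u)"

lemma twist_factor_com: "com y t \<Longrightarrow> com y u \<Longrightarrow> com y (twist_factor \<alpha> \<beta> E L t u)"
  unfolding twist_factor_def by (intro com_mult divdiff_com com_add pe_com sc_com)

lemma pe_sc: "pe f (sc c) = sc (poly f c)"
  by (induction f) (simp_all add: sc_add sc_mult)

text \<open>
  Both sides of the braid relation of the new generators equal the element \<open>a b a - \<alpha> a = b a b - \<alpha> b\<close>
  times the symmetric product \<open>h\<^sub>1\<^sub>2 h\<^sub>1\<^sub>3 h\<^sub>2\<^sub>3\<close>.
\<close>

lemma braid_half:
  assumes hom: "hom_mod \<theta>" and cst: "\<And>c. \<theta> (cst c) = sc c"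
    and S1: "swap s1 U1 W1 Z1" and S2: "swap s2 U2 W2 Z2"
    and a: "a * a \<approx> sc (1 + \<alpha>) * a"
    and rel_a: "\<And>f. \<theta> f * a \<approx> a * \<theta> (s1 f) + \<theta> (swap.dl s1 U1 W1 f * v1)"
    and rel_b: "\<And>f. \<theta> f * b \<approx> b * \<theta> (s2 f) + \<theta> (swap.dl s2 U2 W2 f * v2)"
    and v1: "swap.dl s1 U1 W1 v1 = cst (1 + \<alpha>)"
    and m: "s2 f * g = m" "s1 m = m"
    and braid: "\<theta> (swap.dl s1 U1 W1 (v1 * (swap.dl s2 U2 W2 f * v2 * g)) + cst \<alpha> * m - cst \<alpha>') \<approx> 0"
  shows "a * \<theta> f * (b * \<theta> g) * (a * \<theta> f) - sc \<alpha>' * (a * \<theta> f) \<approx> (a * b * a - sc \<alpha> * a) * \<theta> (m * f)"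
proof -
  interpret S1: swap s1 U1 W1 Z1 by fact
  interpret S2: swap s2 U2 W2 Z2 by fact
  note th = hom_modD[OF hom]
  define r where "r = S2.dl f * v2 * g"
  have "\<theta> f * b * \<theta> g \<approx> (b * \<theta> (s2 f) + \<theta> (S2.dl f * v2)) * \<theta> g"
    by (intro eq_mult_right rel_b)
  also have "\<dots> = b * (\<theta> (s2 f) * \<theta> g) + \<theta> (S2.dl f * v2) * \<theta> g"
    by (simp add: algebra_simps)
  also have "\<dots> \<approx> b * \<theta> m + \<theta> r"
    unfolding m(1)[symmetric] r_def by (intro eq_add eq_mult_left eq_sym[OF th(4)])
  finally have fbg: "\<theta> f * b * \<theta> g \<approx> b * \<theta> m + \<theta> r" .
  have ma: "\<theta> m * a \<approx> a * \<theta> m"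
    using rel_a[of m] by (simp add: m(2) S1.dl_sym th)
  \<comment> \<open>The coefficient \<open>1 + \<alpha>\<close> produced by \<open>a * a\<close> is
    also the Demazure derivative of \<open>v1\<close>, so the Leibniz rule merges both terms into
    one.\<close>
  have ara: "a * (\<theta> r * a) \<approx> a * \<theta> (S1.dl (v1 * r))"
  proof -
    have "a * (\<theta> r * a) \<approx> a * (a * \<theta> (s1 r) + \<theta> (S1.dl r * v1))"
      by (intro eq_mult_left rel_a)
    also have "\<dots> = (a * a) * \<theta> (s1 r) + a * \<theta> (S1.dl r * v1)"
      by (simp add: algebra_simps)
    also have "\<dots> \<approx> (sc (1 + \<alpha>) * a) * \<theta> (s1 r) + a * \<theta> (S1.dl r * v1)"
      by (intro eq_add eq_mult_right a eq_refl)
    also have "\<dots> = a * (\<theta> (cst (1 + \<alpha>)) * \<theta> (s1 r)) + a * \<theta> (S1.dl r * v1)"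
      unfolding cst sc_commute[of _ a] by (simp add: mult.assoc)
    also have "\<dots> \<approx> a * \<theta> (cst (1 + \<alpha>) * s1 r) + a * \<theta> (S1.dl r * v1)"
      by (intro eq_add eq_mult_left eq_sym[OF th(4)] eq_refl)
    also have "\<dots> = a * \<theta> (S1.dl (v1 * r))"
      unfolding S1.dl_mult[of v1 r] v1 th(3) by (simp add: mult.commute distrib_left)
    finally show ?thesis .
  qed
  have "a * \<theta> f * (b * \<theta> g) * (a * \<theta> f) = a * (\<theta> f * b * \<theta> g) * a * \<theta> f"
    by (simp add: mult.assoc)
  also have "\<dots> \<approx> a * (b * \<theta> m + \<theta> r) * a * \<theta> f"
    by (intro eq_mult_right eq_mult_left fbg)
  also have "\<dots> = (a * b * (\<theta> m * a) + a * (\<theta> r * a)) * \<theta> f"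
    by (simp add: algebra_simps)
  also have "\<dots> \<approx> (a * b * (a * \<theta> m) + a * \<theta> (S1.dl (v1 * r))) * \<theta> f"
    by (intro eq_mult_right eq_add eq_mult_left ma ara)
  also have "\<dots> \<approx> (a * b * (a * \<theta> m) + a * (sc \<alpha>' - sc \<alpha> * \<theta> m)) * \<theta> f"
  proof (intro eq_mult_right eq_add eq_mult_left eq_refl)
    have "\<theta> (S1.dl (v1 * r)) + \<theta> (cst \<alpha> * m) - sc \<alpha>' \<approx> 0"
      using braid unfolding r_def by (simp add: th(3,6) cst)
    then have "\<theta> (S1.dl (v1 * r)) \<approx> sc \<alpha>' - \<theta> (cst \<alpha> * m)"
      by (subst eq_iff_diff) (simp add: algebra_simps)
    also have "\<dots> \<approx> sc \<alpha>' - sc \<alpha> * \<theta> m"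
      using th(4)[of "cst \<alpha>" m] by (intro eq_diff eq_refl) (simp add: cst)
    finally show "\<theta> (S1.dl (v1 * r)) \<approx> sc \<alpha>' - sc \<alpha> * \<theta> m" .
  qed
  also have "\<dots> = (a * b * a - sc \<alpha> * a) * (\<theta> m * \<theta> f) + sc \<alpha>' * (a * \<theta> f)"
  proof -
    have "sc c * (a * z) = a * (sc c * z)" for c z
      by (metis mult.assoc sc_commute)
    then show ?thesis
      by (simp add: algebra_simps)
  qed
  also have "\<dots> \<approx> (a * b * a - sc \<alpha> * a) * \<theta> (m * f) + sc \<alpha>' * (a * \<theta> f)"
    by (intro eq_add eq_mult_left eq_sym[OF th(4)] eq_refl)
  finally show ?thesis
    by (subst (asm) eq_iff_diff, subst eq_iff_diff) (simp add: algebra_simps)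
qed

end

section \<open>Transfer of the Hecke relations along a change of coordinates\<close>

locale hecke_change = hecke_datum eq sc \<alpha> \<beta> g d x a + coordinate_change \<alpha> \<beta> \<alpha>' \<beta>' p E L
  for eq :: "'a::ring_1 \<Rightarrow> 'a \<Rightarrow> bool" (infix "\<approx>" 50) and sc :: "'f::field \<Rightarrow> 'a"
    and \<alpha> \<beta> g d x a \<alpha>' \<beta>' p E L +
  fixes c0 :: 'f and g' :: "'f poly"
  assumes alpha': "\<alpha>' \<noteq> 0"
    and p_x: "r \<in> {1..d} \<Longrightarrow> pe p (x r) \<approx> 0" and p_root: "poly p c0 = 0"
    and g': "1 \<le> d \<Longrightarrow> pe g' (pe E (x 1)) \<approx> 0"
begin

definition X' :: "nat \<Rightarrow> 'a" where "X' r = pe E (x r)"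
definition a' :: "nat \<Rightarrow> 'a" where "a' r = a r * twist_factor \<alpha> \<beta> E L (x r) (x (Suc r))"

text \<open>A third variable is only available if \<open>r + 1 < d\<close>; otherwise a scalar annihilated by \<open>p\<close> takes its place.\<close>

definition \<theta> :: "nat \<Rightarrow> 'f pol3 \<Rightarrow> 'a"
  where "\<theta> r = ev (x r) (x (Suc r)) (if Suc r < d then x (Suc (Suc r)) else sc c0)"

context
  fixes r :: nat
  assumes r: "1 \<le> r" "r < d"
begin

lemma \<theta>_hom: "hom_mod (\<theta> r)"
  unfolding \<theta>_def using r by (intro ev_hom) (simp_all add: x_com)

lemmas \<theta>_simps = hom_modD[OF \<theta>_hom]

lemma \<theta>_var [simp]: "\<theta> r (cst c) = sc c" "\<theta> r V1 = x r" "\<theta> r V2 = x (Suc r)"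
  "Suc r < d \<Longrightarrow> \<theta> r V3 = x (Suc (Suc r))"
  by (simp_all add: \<theta>_def)

lemma \<theta>_null: "null p m f \<Longrightarrow> m > 0 \<Longrightarrow> \<theta> r f \<approx> 0"
proof (rule null_eq_0[OF _ _ \<theta>_hom])
  show "pe p (\<theta> r v) \<approx> 0" if "v \<in> vars" for v
    using that r p_x[of r] p_x[of "Suc r"] p_x[of "Suc (Suc r)"] by (auto simp: \<theta>_def pe_sc p_root)
qed simp_all

lemma \<theta>_null_diff: "null p m (f1 - f2) \<Longrightarrow> m > 0 \<Longrightarrow> \<theta> r f1 \<approx> \<theta> r f2"
  using \<theta>_null[of m "f1 - f2"] by (subst eq_iff_diff) (simp add: \<theta>_simps)

lemma \<theta>_X: "\<theta> r (X t) \<approx> pe E (\<theta> r t)"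
  unfolding X_def by (rule hom_poly_eval[OF \<theta>_hom]) simp_all

lemma \<theta>_h: "\<theta> r (h t u) \<approx> twist_factor \<alpha> \<beta> E L (\<theta> r t) (\<theta> r u)"
proof -
  have "\<theta> r (sg u) \<approx> sc \<beta> + \<theta> r u * sc \<alpha>"
    using \<theta>_simps(4)[of u "cst \<alpha>"] by (simp add: sg_def \<theta>_simps(3) eq_add)
  then have "\<theta> r (divdiff cst E t (sg u)) \<approx> divdiff sc E (\<theta> r t) (sc \<beta> + \<theta> r u * sc \<alpha>)"
    by (intro eq_trans[OF hom_divdiff[OF \<theta>_hom] divdiff_cong[OF eq_refl]]) simp_all
  moreover have "\<theta> r (D t u) \<approx> divdiff sc L (pe E (\<theta> r t)) (pe E (\<theta> r u))"
    unfolding D_def by (intro eq_trans[OF hom_divdiff[OF \<theta>_hom] divdiff_cong[OF \<theta>_X \<theta>_X]]) simp_all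
  ultimately show ?thesis
    unfolding h_def twist_factor_def using \<theta>_simps(4) eq_mult eq_trans by blast
qed

lemma \<theta>_a: "\<theta> r f * a r \<approx> a r * \<theta> r (s12 f) + \<theta> r (dl12 f * v V1 V2)"
proof -
  have "v V1 V2 = V1 - cst \<alpha> * V2 - cst \<beta>"
    by (simp add: v_def sg_def algebra_simps)
  moreover have "com (a r) (if Suc r < d then x (Suc (Suc r)) else sc c0)"
    using r by (auto intro: a_x_com)
  ultimately show ?thesis
    unfolding \<theta>_def using r by (auto intro!: ev_commutation simp: x_com)
qed

lemma a'_eq: "a' r \<approx> a r * \<theta> r (h V1 V2)"
  unfolding a'_def using \<theta>_h[of V1 V2] by (intro eq_mult_left) (simp add: eq_sym)

lemma \<theta>_a_Suc:
  assumes "Suc r < d"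
  shows "\<theta> r f * a (Suc r) \<approx> a (Suc r) * \<theta> r (s23 f) + \<theta> r (dl23 f * v V2 V3)"
proof -
  have "v V2 V3 = V2 - cst \<alpha> * V3 - cst \<beta>"
    by (simp add: v_def sg_def algebra_simps)
  then show ?thesis
    unfolding \<theta>_def using r assms ev_commutation'[of r f] by simp
qed

lemma a'_Suc_eq:
  assumes "Suc r < d"
  shows "a' (Suc r) \<approx> a (Suc r) * \<theta> r (h V2 V3)"
  unfolding a'_def using \<theta>_h[of V2 V3] assms by (intro eq_mult_left) (simp add: eq_sym)

interpretation C12: change_swap \<alpha> \<beta> \<alpha>' \<beta>' p E L s12 V1 V2 V3 ..
interpretation C23: change_swap \<alpha> \<beta> \<alpha>' \<beta>' p E L s23 V2 V3 V1 ..

text \<open>Moving \<open>E(x r)\<close> past \<open>a r\<close> produces \<open>E1 * v\<close>; the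
  factor \<open>h\<close> completes it to \<open>E1 * k\<close>, which is \<open>w\<close>, the
  linear term of the new relation.\<close>

lemma X'_a': "X' r * a' r \<approx> a' r * X' (Suc r) + (X' r - sc \<alpha>' * X' (Suc r) - sc \<beta>')"
proof -
  let ?\<theta> = "\<theta> r" and ?h = "h V1 V2"
  have X: "X' r \<approx> ?\<theta> (X V1)" "X' (Suc r) \<approx> ?\<theta> (X V2)"
    using \<theta>_X[of V1] \<theta>_X[of V2] by (simp_all add: X'_def eq_sym)
  have "X' r * a' r \<approx> ?\<theta> (X V1) * (a r * ?\<theta> ?h)"
    by (intro eq_mult X a'_eq)
  also have "\<dots> = (?\<theta> (X V1) * a r) * ?\<theta> ?h"
    by (simp add: mult.assoc)
  also have "\<dots> \<approx> (a r * ?\<theta> (X V2) + ?\<theta> (E1 V1 V2 * v V1 V2)) * ?\<theta> ?h"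
    using \<theta>_a[of "X V1"] unfolding C12.dl_E C12.s_cc S12.swap by (rule eq_mult_right)
  also have "\<dots> = a r * (?\<theta> (X V2) * ?\<theta> ?h) + ?\<theta> (E1 V1 V2 * v V1 V2) * ?\<theta> ?h"
    by (simp add: algebra_simps)
  also have "\<dots> \<approx> a r * ?\<theta> (X V2 * ?h) + ?\<theta> (E1 V1 V2 * v V1 V2 * ?h)"
    by (intro eq_add eq_mult_left eq_sym[OF \<theta>_simps(4)])
  also have "\<dots> \<approx> a r * (?\<theta> ?h * ?\<theta> (X V2)) + ?\<theta> (w V1 V2)"
  proof (intro eq_add eq_mult_left)
    show "?\<theta> (X V2 * ?h) \<approx> ?\<theta> ?h * ?\<theta> (X V2)"
      by (subst mult.commute) (rule \<theta>_simps(4))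
    show "?\<theta> (E1 V1 V2 * v V1 V2 * ?h) \<approx> ?\<theta> (w V1 V2)"
      using E1_k[of V1 V2] by (intro \<theta>_null_diff[of 3]) (simp_all add: k_def mult.assoc)
  qed
  also have "\<dots> = (a r * ?\<theta> ?h) * ?\<theta> (X V2) + (?\<theta> (X V1) - ?\<theta> (cst \<alpha>' * X V2) - sc \<beta>')"
    by (simp add: w_def \<theta>_simps(6) mult.assoc)
  also have "\<dots> \<approx> a' r * X' (Suc r) + (X' r - sc \<alpha>' * X' (Suc r) - sc \<beta>')"
  proof (intro eq_add eq_diff eq_mult eq_refl)
    show "?\<theta> (cst \<alpha>' * X V2) \<approx> sc \<alpha>' * X' (Suc r)"
      by (intro eq_trans[OF \<theta>_simps(4)]) (simp add: eq_mult_left eq_sym[OF X(2)])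
  qed (auto intro: eq_sym a'_eq X)
  finally show ?thesis .
qed

text \<open>Moving the inner \<open>h\<close> past \<open>a r\<close> and using \<open>a_sq\<close>
  collects everything into \<open>dl12 (k V1 V2)\<close>, which \<open>quadratic\<close>
  evaluates.\<close>

lemma a'_sq: "a' r * a' r \<approx> sc (1 + \<alpha>') * a' r"
proof -
  let ?\<theta> = "\<theta> r" and ?h = "h V1 V2"
  have "a' r * a' r \<approx> (a r * ?\<theta> ?h) * (a r * ?\<theta> ?h)"
    by (intro eq_mult a'_eq)
  also have "\<dots> = a r * (?\<theta> ?h * a r) * ?\<theta> ?h"
    by (simp add: mult.assoc)
  also have "\<dots> \<approx> a r * (a r * ?\<theta> (s12 ?h) + ?\<theta> (dl12 ?h * v V1 V2)) * ?\<theta> ?h"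
    by (intro eq_mult_left eq_mult_right \<theta>_a)
  also have "\<dots> = ((a r * a r) * ?\<theta> (s12 ?h) + a r * ?\<theta> (dl12 ?h * v V1 V2)) * ?\<theta> ?h"
    by (simp add: algebra_simps)
  also have "\<dots> \<approx> ((sc (1 + \<alpha>) * a r) * ?\<theta> (s12 ?h) + a r * ?\<theta> (dl12 ?h * v V1 V2)) * ?\<theta> ?h"
    using r by (intro eq_mult_right eq_add eq_refl a_sq)
  also have "\<dots> = a r * (?\<theta> (cst (1 + \<alpha>)) * ?\<theta> (s12 ?h) + ?\<theta> (dl12 ?h * v V1 V2)) * ?\<theta> ?h"
    unfolding \<theta>_var sc_commute[of _ "a r"] by (simp add: algebra_simps)
  also have "\<dots> \<approx> a r * (?\<theta> (cst (1 + \<alpha>) * s12 ?h) + ?\<theta> (dl12 ?h * v V1 V2)) * ?\<theta> ?h"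
    by (intro eq_mult_right eq_mult_left eq_add eq_sym[OF \<theta>_simps(4)] eq_refl)
  also have "\<dots> = a r * ?\<theta> (dl12 (k V1 V2)) * ?\<theta> ?h"
    by (simp add: k_def S12.dl_mult C12.dl_v \<theta>_simps(3) mult.commute)
  also have "\<dots> \<approx> a r * ?\<theta> (cst (1 + \<alpha>')) * ?\<theta> ?h"
    by (intro eq_mult_right eq_mult_left \<theta>_null_diff[of 2] C12.quadratic) simp
  also have "\<dots> = sc (1 + \<alpha>') * (a r * ?\<theta> ?h)"
    by (simp add: sc_commute[of _ "a r"] flip: mult.assoc)
  also have "\<dots> \<approx> sc (1 + \<alpha>') * a' r"
    by (intro eq_mult_left eq_sym[OF a'_eq])
  finally show ?thesis .
qed

lemma a'_braid:
  assumes "Suc r < d"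
  shows "a' r * a' (Suc r) * a' r - sc \<alpha>' * a' r \<approx> a' (Suc r) * a' r * a' (Suc r) - sc \<alpha>' * a' (Suc r)"
proof -
  let ?a = "a r" and ?b = "a (Suc r)" and ?f = "\<theta> r (h V1 V2)" and ?g = "\<theta> r (h V2 V3)"
  have "a' r * a' (Suc r) * a' r - sc \<alpha>' * a' r \<approx> ?a * ?f * (?b * ?g) * (?a * ?f) - sc \<alpha>' * (?a * ?f)"
    by (intro eq_diff eq_mult_left eq_mult a'_eq a'_Suc_eq assms)
  also have "\<dots> \<approx> (?a * ?b * ?a - sc \<alpha> * ?a) * \<theta> r ((h V1 V3 * h V2 V3) * h V1 V2)"
  proof (rule braid_half[OF \<theta>_hom _ S12.swap_axioms S23.swap_axioms])
    show "\<theta> r f * a r \<approx> a r * \<theta> r (s12 f) + \<theta> r (dl12 f * v V1 V2)"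
      "\<theta> r f * a (Suc r) \<approx> a (Suc r) * \<theta> r (s23 f) + \<theta> r (dl23 f * v V2 V3)" for f
      by (rule \<theta>_a \<theta>_a_Suc assms)+
    show "s23 (h V1 V2) * h V2 V3 = h V1 V3 * h V2 V3" "s12 (h V1 V3 * h V2 V3) = h V1 V3 * h V2 V3"
      unfolding S12.s_simps C12.s_cc S12.swap C23.s_cc S23.swap by (rule refl mult.commute)+
    show "\<theta> r (dl12 (v V1 V2 * (dl23 (h V1 V2) * v V2 V3 * h V2 V3))
      + cst \<alpha> * (h V1 V3 * h V2 V3) - cst \<alpha>') \<approx> 0"
      by (rule \<theta>_null[OF braid]) simp
  qed (use r C12.dl_v in \<open>auto intro: a_sq\<close>)
  also have "\<dots> \<approx> (?b * ?a * ?b - sc \<alpha> * ?b) * \<theta> r ((h V1 V3 * h V1 V2) * h V2 V3)"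
    unfolding mult.assoc[of "h V1 V3"] mult.commute[of "h V2 V3"]
    by (intro eq_mult_right a_braid r assms)
  also have "\<dots> \<approx> ?b * ?g * (?a * ?f) * (?b * ?g) - sc \<alpha>' * (?b * ?g)"
  proof (rule eq_sym, rule braid_half[OF \<theta>_hom _ S23.swap_axioms S12.swap_axioms])
    show "\<theta> r f * a r \<approx> a r * \<theta> r (s12 f) + \<theta> r (dl12 f * v V1 V2)"
      "\<theta> r f * a (Suc r) \<approx> a (Suc r) * \<theta> r (s23 f) + \<theta> r (dl23 f * v V2 V3)" for f
      by (rule \<theta>_a \<theta>_a_Suc assms)+
    show "s12 (h V2 V3) * h V1 V2 = h V1 V3 * h V1 V2" "s23 (h V1 V3 * h V1 V2) = h V1 V3 * h V1 V2"
      unfolding S23.s_simps C12.s_cc S12.swap C23.s_cc S23.swap by (rule refl mult.commute)+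
    show "\<theta> r (dl23 (v V2 V3 * (dl12 (h V2 V3) * v V1 V2 * h V1 V2))
      + cst \<alpha> * (h V1 V3 * h V1 V2) - cst \<alpha>') \<approx> 0"
      by (rule \<theta>_null[OF braid']) simp
  qed (use r assms C23.dl_v in \<open>auto intro: a_sq\<close>)
  also have "\<dots> \<approx> a' (Suc r) * a' r * a' (Suc r) - sc \<alpha>' * a' (Suc r)"
    by (intro eq_diff eq_mult_left eq_mult eq_sym[OF a'_eq] eq_sym[OF a'_Suc_eq] assms)
  finally show ?thesis .
qed

end



theorem hecke_datum_change: "hecke_datum eq sc \<alpha>' \<beta>' g' d X' a'"
proof unfold_locales
  show "com (X' r) (X' s)" if "r \<in> {1..d}" "s \<in> {1..d}" for r s
    unfolding X'_def using that by (meson com_sym pe_com x_com)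
  show "X' r * a' r \<approx> a' r * X' (Suc r) + (X' r - sc \<alpha>' * X' (Suc r) - sc \<beta>')"
    "a' r * a' r \<approx> sc (1 + \<alpha>') * a' r" if "1 \<le> r" "r < d" for r
    using that by (rule X'_a' a'_sq)+
  show "a' r * a' (Suc r) * a' r - sc \<alpha>' * a' r \<approx> a' (Suc r) * a' r * a' (Suc r) - sc \<alpha>' * a' (Suc r)"
    if "1 \<le> r" "Suc r < d" for r
    using that by (intro a'_braid) auto
  show "com (a' r) (X' s)" if "1 \<le> r" "r < d" "s \<in> {1..d}" "s \<noteq> r" "s \<noteq> Suc r" for r s
  proof -
    have "com (x s) (twist_factor \<alpha> \<beta> E L (x r) (x (Suc r)))"
      using that by (intro twist_factor_com x_com) auto
    then have "com (a' r) (x s)"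
      unfolding a'_def using that by (intro com_prod_left a_x_com) (auto intro: com_sym)
    then show ?thesis
      unfolding X'_def by (rule pe_com)
  qed
  show "com (a' r) (a' s)" if "1 \<le> r" "Suc r < s" "s < d" for r s
  proof -
    let ?t = "\<lambda>r. twist_factor \<alpha> \<beta> E L (x r) (x (Suc r))"
    have "com (x i) (?t r)" if "i \<in> {1..d}" for i
      using that \<open>1 \<le> r\<close> \<open>Suc r < s\<close> \<open>s < d\<close> by (intro twist_factor_com x_com) auto
    from this[of s] this[of "Suc s"] have tt: "com (?t r) (?t s)"
      using that by (intro twist_factor_com) (auto intro: com_sym)
    have "com (a r) (?t s)" "com (a s) (?t r)"
      using that by (auto intro!: twist_factor_com a_x_com)
    with tt a_com[OF that] show ?thesis
      unfolding a'_def by (intro com_mult com_prod_left) (auto intro: com_sym)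
  qed
qed (use g' alpha' in \<open>simp_all add: X'_def\<close>)

end

context hecke_datum
begin

text \<open>One step multiplies two copies of the polynomial and its two shifts: the window grows by
  one at each end, the multiplicity by the factor 4.\<close>

lemma annihilator:
  assumes "affine_orbit \<alpha> \<beta> e" and g: "g dvd orbit_poly e {-n..n} M" and r: "1 \<le> r" "r \<le> d"
  shows "pe (orbit_poly e {-(n + int r)..n + int r} (M * 4 ^ r)) (x r) \<approx> 0"
  using r
proof (induction r rule: dec_induct)
  case base
  have "g dvd orbit_poly e {-(n + int 1)..n + int 1} (M * 4 ^ 1)"
    using g by (rule dvd_trans) (intro orbit_poly_mono, auto)
  then show ?case
    using pe_dvd_0[OF cyclotomic] base by simp
next
  case prems: (step r)
  interpret affine_orbit \<alpha> \<beta> e by fact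
  define I J where "I = {-(n + int r)..n + int r}" and "J = {-(n + int (Suc r))..n + int (Suc r)}"
  let ?f = "orbit_poly e I (M * 4 ^ r)" and ?F = "orbit_poly e J (M * 4 ^ r)"
  have fin: "finite J" by (simp add: J_def)
  have 1: "?f dvd ?F"
    by (rule orbit_poly_mono[OF fin]) (auto simp: I_def J_def)
  have 2: "pcompose ?f \<sigma> dvd ?F"
    by (rule dvd_trans[OF orbit_poly_sigma], rule orbit_poly_mono[OF fin]) (auto simp: I_def J_def)
  have 3: "pcompose ?f \<sigma>inv dvd ?F"
    by (rule dvd_trans[OF orbit_poly_sigmainv], rule orbit_poly_mono[OF fin]) (auto simp: I_def J_def)
  have "?f * ?f * pcompose ?f \<sigma> * pcompose ?f \<sigma>inv dvd ?F * ?F * ?F * ?F"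
    by (intro mult_dvd_mono 1 2 3)
  also have "?F * ?F * ?F * ?F = orbit_poly e J (M * 4 ^ Suc r)"
  proof -
    have "M * 4 ^ r + M * 4 ^ r + M * 4 ^ r + M * 4 ^ r = M * 4 ^ Suc r"
      by simp
    then show ?thesis
      unfolding orbit_poly_mult by (rule arg_cong)
  qed
  finally have dvd: "?f * ?f * pcompose ?f \<sigma> * pcompose ?f \<sigma>inv dvd orbit_poly e J (M * 4 ^ Suc r)" .
  have "pe ?f (x r) \<approx> 0"
    using prems by (simp add: I_def)
  then have "pe (?f * ?f * pcompose ?f \<sigma> * pcompose ?f \<sigma>inv) (x (Suc r)) \<approx> 0"
    using prems by (intro annihilator_step) auto
  then show ?case
    unfolding J_def[symmetric] using dvd by (rule pe_dvd_0)
qed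

end

context hecke_change
begin

lemma inverse_coordinate:
  assumes "r \<in> {1..d}"
  shows "pe L (X' r) \<approx> x r"
proof -
  have "pe (pcompose L E - [:0, 1:]) (x r) \<approx> 0"
    using p_x[OF assms] dvd_trans[OF dvd_power inverse] by (rule pe_dvd_0) simp
  then have "pe (pcompose L E) (x r) \<approx> x r"
    by (subst eq_iff_diff) (simp add: pe_diff)
  then show ?thesis
    unfolding X'_def by (rule eq_trans[OF eq_sym[OF pe_pcompose]])
qed

text \<open>The two factors multiply to \<open>(N' * N) * (E1 * D)\<close>, where the chain rule
  makes both brackets 1. The first bracket is a divided difference at \<open>V1\<close> and
  \<open>sg V2\<close>; the shifted \<open>p\<close> in \<open>inv\<close> takes the value
  \<open>p(V2)\<close> at \<open>sg V2\<close>, which again vanishes under evaluation.\<close>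

lemma inverse_generator:
  assumes r: "1 \<le> r" "r < d" and inv: "p * pcompose p [:- \<beta> / \<alpha>, 1 / \<alpha>:] dvd pcompose L E - [:0, 1:]"
  shows "a' r * twist_factor \<alpha>' \<beta>' L E (X' r) (X' (Suc r)) \<approx> a r"
proof -
  note hom = \<theta>_hom[OF r] and \<theta>_simps = \<theta>_simps[OF r] and \<theta>_var = \<theta>_var[OF r]
  define N N' where "N = divdiff cst E V1 (sg V2)" and "N' = divdiff cst L (X V1) (P.pe E (sg V2))"
  have neq: "V1 \<noteq> sg V2"
  proof
    assume *: "V1 = sg V2"
    \<comment> \<open>Setting \<open>V2\<close> to 0 would give \<open>V1\<close> the same value for
      every choice of \<open>t\<close>.\<close>
    have "P.ev t 0 0 V1 = cst \<beta>" for t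
      unfolding * sg_def by (simp add: P.hom_modD[OF P.ev_hom])
    then have "(0 :: 'f pol3) = cst \<beta>" "(1 :: 'f pol3) = cst \<beta>"
      by (metis P.ev_var(2))+
    then show False by simp
  qed
  have "null p 1 (N' * N - 1)"
  proof -
    obtain c where c: "pcompose L E - [:0, 1:] = p * (pcompose p [:- \<beta> / \<alpha>, 1 / \<alpha>:] * c)"
      using inv by (auto simp: dvd_def mult.assoc)
    have "P.pe (pcompose p [:- \<beta> / \<alpha>, 1 / \<alpha>:]) (sg V2)
        = P.pe (pcompose (pcompose p [:- \<beta> / \<alpha>, 1 / \<alpha>:]) [:\<beta>, \<alpha>:]) V2"
      by (simp add: P.pe_pcompose[where g = "[:\<beta>, \<alpha>:]"] sg_def)
    also have "pcompose (pcompose p [:- \<beta> / \<alpha>, 1 / \<alpha>:]) [:\<beta>, \<alpha>:] = p"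
      using alpha by (simp add: pcompose_assoc[symmetric] pcompose_pCons flip: add_divide_distrib)
    finally have 1: "P.pe (pcompose p [:- \<beta> / \<alpha>, 1 / \<alpha>:]) (sg V2) = P.pe p V2" .
    have "N' * N - 1 = divdiff cst (pcompose L E - [:0, 1:]) V1 (sg V2)"
      unfolding P.divdiff_diff P_divdiff_pcompose[OF neq] P_divdiff_id N_def N'_def X_def ..
    also have "\<dots> = P.pe p V1 * divdiff cst (pcompose p [:- \<beta> / \<alpha>, 1 / \<alpha>:] * c) V1 (sg V2)
        + P.pe p V2 * (divdiff cst p V1 (sg V2) * P.pe c (sg V2))"
      unfolding c P_divdiff_mult[OF neq, of p] P.pe_mult 1 by (simp add: mult_ac)
    also have "null p 1 \<dots>"
      unfolding One_nat_def by (intro null_add null_gen null_0) simp_all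
    finally show ?thesis .
  qed
  then have NN: "null p 1 ((N' * N) * (E1 V1 V2 * D V1 V2) - 1)"
    using null_le[OF E1_D[of V1 V2], of 1] by (rule null_one_mult) simp_all
  have \<sigma>: "\<theta> r (sg V2) \<approx> sc \<beta> + x (Suc r) * sc \<alpha>"
    using \<theta>_simps(4)[of V2 "cst \<alpha>"] by (simp add: sg_def \<theta>_simps(3) \<theta>_var eq_add)
  have X: "\<theta> r (X V1) \<approx> X' r" "\<theta> r (X V2) \<approx> X' (Suc r)"
    using \<theta>_X[OF r, of V1] \<theta>_X[OF r, of V2] by (simp_all add: X'_def \<theta>_var)
  have "\<theta> r (P.pe E (sg V2)) \<approx> sc \<beta>' + X' (Suc r) * sc \<alpha>'"
  proof -
    have "\<theta> r (P.pe E (sg V2) - (cst \<beta>' + X V2 * cst \<alpha>')) \<approx> 0"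
    proof (rule \<theta>_null[OF r, of 4])
      have "P.pe E (sg V2) - (cst \<beta>' + X V2 * cst \<alpha>')
        = P.pe (pcompose E [:\<beta>, \<alpha>:] - pcompose [:\<beta>', \<alpha>':] E) V2"
        unfolding P.pe_diff P.pe_pcompose by (simp add: sg_def X_def)
      then show "null p 4 (P.pe E (sg V2) - (cst \<beta>' + X V2 * cst \<alpha>'))"
        using null_pe[OF twist] by simp
    qed simp
    then have "\<theta> r (P.pe E (sg V2)) \<approx> sc \<beta>' + \<theta> r (X V2 * cst \<alpha>')"
      by (subst eq_iff_diff) (simp add: \<theta>_simps \<theta>_var)
    also have "\<dots> \<approx> sc \<beta>' + \<theta> r (X V2) * \<theta> r (cst \<alpha>')"
      by (intro eq_add eq_refl \<theta>_simps(4))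
    also have "\<dots> \<approx> sc \<beta>' + X' (Suc r) * sc \<alpha>'"
      unfolding \<theta>_var by (intro eq_add eq_refl eq_mult_right X)
    finally show ?thesis .
  qed
  then have N': "\<theta> r N' \<approx> divdiff sc L (X' r) (sc \<beta>' + X' (Suc r) * sc \<alpha>')"
    unfolding N'_def by (intro eq_trans[OF hom_divdiff[OF hom] divdiff_cong[OF X(1)]]) (simp_all add: \<theta>_var)
  have E1: "\<theta> r (E1 V1 V2) \<approx> divdiff sc E (pe L (X' r)) (pe L (X' (Suc r)))"
  proof -
    have "\<theta> r (E1 V1 V2) \<approx> divdiff sc E (x r) (x (Suc r))"
      unfolding E1_def using hom_divdiff[OF hom, of cst E V1 V2] by (simp add: \<theta>_var)
    also have "\<dots> \<approx> divdiff sc E (pe L (X' r)) (pe L (X' (Suc r)))"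
      using r by (intro divdiff_cong eq_sym[OF inverse_coordinate]) auto
    finally show ?thesis .
  qed
  have "\<theta> r (N' * E1 V1 V2) \<approx> twist_factor \<alpha>' \<beta>' L E (X' r) (X' (Suc r))"
    unfolding twist_factor_def by (rule eq_trans[OF \<theta>_simps(4) eq_mult[OF N' E1]])
  then have "a' r * twist_factor \<alpha>' \<beta>' L E (X' r) (X' (Suc r))
      \<approx> (a r * \<theta> r (h V1 V2)) * \<theta> r (N' * E1 V1 V2)"
    by (intro eq_mult a'_eq r) (rule eq_sym)
  also have "\<dots> = a r * (\<theta> r (h V1 V2) * \<theta> r (N' * E1 V1 V2))"
    by (rule mult.assoc)
  also have "\<dots> \<approx> a r * \<theta> r (h V1 V2 * (N' * E1 V1 V2))"
    by (intro eq_mult_left eq_sym[OF \<theta>_simps(4)])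
  also have "h V1 V2 * (N' * E1 V1 V2) = (N' * N) * (E1 V1 V2 * D V1 V2)"
    by (simp add: h_def N_def mult_ac)
  also have "a r * \<theta> r ((N' * N) * (E1 V1 V2 * D V1 V2)) \<approx> a r * \<theta> r 1"
    by (intro eq_mult_left \<theta>_null_diff[OF r NN]) simp
  finally show ?thesis
    by (simp add: \<theta>_simps)
qed

end

section \<open>Cyclotomic polynomials and bounds common to both algebras\<close>

definition weight_poly :: "(int \<Rightarrow> 'f::field) \<Rightarrow> (int \<Rightarrow>\<^sub>0 nat) \<Rightarrow> 'f poly"
  where "weight_poly e \<Lambda> = (\<Prod>i\<in>Poly_Mapping.keys \<Lambda>. [:- e i, 1:] ^ Poly_Mapping.lookup \<Lambda> i)"

definition support_bound :: "(int \<Rightarrow>\<^sub>0 nat) \<Rightarrow> int"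
  where "support_bound \<Lambda> = (\<Sum>i\<in>Poly_Mapping.keys \<Lambda>. \<bar>i\<bar>)"

text \<open>\<open>Suc\<close> keeps the bound positive for \<Lambda> = 0: the interpolation asks
  for a positive order, and \<open>annihilating_poly\<close> has to have a root.\<close>

definition mult_bound :: "(int \<Rightarrow>\<^sub>0 nat) \<Rightarrow> nat"
  where "mult_bound \<Lambda> = Suc (\<Sum>i\<in>Poly_Mapping.keys \<Lambda>. Poly_Mapping.lookup \<Lambda> i)"

lemma support_bound: "0 \<le> support_bound \<Lambda>" "Poly_Mapping.keys \<Lambda> \<subseteq> {- support_bound \<Lambda>..support_bound \<Lambda>}"
proof -
  show "0 \<le> support_bound \<Lambda>"
    unfolding support_bound_def by (rule sum_nonneg) simp
  have "\<bar>i\<bar> \<le> support_bound \<Lambda>" if "i \<in> Poly_Mapping.keys \<Lambda>" for i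
    unfolding support_bound_def using that by (auto intro: member_le_sum)
  then show "Poly_Mapping.keys \<Lambda> \<subseteq> {- support_bound \<Lambda>..support_bound \<Lambda>}"
    by (force simp: abs_le_iff)
qed

lemma weight_poly_dvd:
  "weight_poly e \<Lambda> dvd orbit_poly e {- support_bound \<Lambda>..support_bound \<Lambda>} (mult_bound \<Lambda>)"
proof -
  have "Poly_Mapping.lookup \<Lambda> i \<le> mult_bound \<Lambda>" if "i \<in> Poly_Mapping.keys \<Lambda>" for i
    unfolding mult_bound_def using that by (intro le_SucI member_le_sum) auto
  then have "weight_poly e \<Lambda> dvd (\<Prod>i\<in>Poly_Mapping.keys \<Lambda>. [:- e i, 1:] ^ mult_bound \<Lambda>)"
    unfolding weight_poly_def by (intro prod_dvd_prod le_imp_power_dvd)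
  also have "\<dots> dvd orbit_poly e {- support_bound \<Lambda>..support_bound \<Lambda>} (mult_bound \<Lambda>)"
    unfolding orbit_poly_def using support_bound(2) by (intro prod_dvd_prod_subset) auto
  finally show ?thesis .
qed

definition annihilating_poly :: "(int \<Rightarrow> 'f::field) \<Rightarrow> (int \<Rightarrow>\<^sub>0 nat) \<Rightarrow> nat \<Rightarrow> 'f poly"
  where "annihilating_poly e \<Lambda> d =
    orbit_poly e {-(support_bound \<Lambda> + int d)..support_bound \<Lambda> + int d} (mult_bound \<Lambda> * 4 ^ d)"

lemma hecke_datum_annihilating_poly:
  fixes eq :: "'a::ring_1 \<Rightarrow> 'a \<Rightarrow> bool" and sc :: "'f::field \<Rightarrow> 'a"
  assumes "affine_orbit \<alpha> \<beta> e" "hecke_datum eq sc \<alpha> \<beta> (weight_poly e \<Lambda>) d x a" "r \<in> {1..d}"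
  shows "eq (poly_eval sc (x r) (annihilating_poly e \<Lambda> d)) 0"
proof -
  interpret hecke_datum eq sc \<alpha> \<beta> "weight_poly e \<Lambda>" d x a by fact
  show ?thesis
  proof (rule pe_dvd_0[OF annihilator[OF assms(1) weight_poly_dvd]])
    show "orbit_poly e {-(support_bound \<Lambda> + int r)..support_bound \<Lambda> + int r} (mult_bound \<Lambda> * 4 ^ r)
        dvd annihilating_poly e \<Lambda> d"
      unfolding annihilating_poly_def using assms(3)
      by (intro orbit_poly_mono) (auto simp: power_increasing)
  qed (use assms(3) in auto)
qed

text \<open>The window exceeds that of \<open>annihilating_poly\<close> by one at each end to
  contain its shift by \<open>\<sigma>inv\<close>, and the last factor 4 provides its fourth power.
  The values on the support of \<Lambda> serve the cyclotomic relation.\<close>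

definition coordinate_pair where
  "coordinate_pair \<alpha> \<beta> e \<alpha>' \<beta>' e' \<Lambda> d E L \<longleftrightarrow>
    (\<forall>i\<in>Poly_Mapping.keys \<Lambda>. poly E (e i) = e' i) \<and>
    (\<exists>P. P = orbit_poly e {-(support_bound \<Lambda> + int d + 1)..support_bound \<Lambda> + int d + 1}
        (mult_bound \<Lambda> * 4 ^ d * 4) \<and>
      P dvd pcompose L E - [:0, 1:] \<and> P dvd pcompose E [:\<beta>, \<alpha>:] - pcompose [:\<beta>', \<alpha>':] E)"

lemma coordinate_pair_exists:
  fixes e e' :: "int \<Rightarrow> 'f::field"
  assumes "affine_orbit \<alpha> \<beta> e" "affine_orbit \<alpha>' \<beta>' e'"
  obtains E L where "coordinate_pair \<alpha> \<beta> e \<alpha>' \<beta>' e' \<Lambda> d E L" "coordinate_pair \<alpha>' \<beta>' e' \<alpha> \<beta> e \<Lambda> d L E"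
proof -
  define n where "n = support_bound \<Lambda> + int d + 1"
  have keys: "\<bar>i\<bar> \<le> n" if "i \<in> Poly_Mapping.keys \<Lambda>" for i
    using support_bound(2)[of \<Lambda>] that by (auto simp: n_def abs_le_iff)
  have "mult_bound \<Lambda> * 4 ^ d * 4 > 0" by (simp add: mult_bound_def)
  from orbit_coordinate_change[OF assms this, of n] obtain E L where EL:
    "\<And>i. \<bar>i\<bar> \<le> n \<Longrightarrow> poly E (e i) = e' i" "\<And>i. \<bar>i\<bar> \<le> n \<Longrightarrow> poly L (e' i) = e i"
    "orbit_poly e {-n..n} (mult_bound \<Lambda> * 4 ^ d * 4) dvd pcompose L E - [:0, 1:]"
    "orbit_poly e' {-n..n} (mult_bound \<Lambda> * 4 ^ d * 4) dvd pcompose E L - [:0, 1:]"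
    "orbit_poly e {-n..n} (mult_bound \<Lambda> * 4 ^ d * 4) dvd pcompose E [:\<beta>, \<alpha>:] - pcompose [:\<beta>', \<alpha>':] E"
    "orbit_poly e' {-n..n} (mult_bound \<Lambda> * 4 ^ d * 4) dvd pcompose L [:\<beta>', \<alpha>':] - pcompose [:\<beta>, \<alpha>:] L"
    by blast
  show thesis
    by (rule that[of E L]) (use EL keys in \<open>simp_all add: coordinate_pair_def flip: n_def\<close>)
qed

text \<open>Formulated for arbitrary parameters so that it applies to each of the two algebras, with
  the roles of \<open>E\<close> and \<open>L\<close> exchanged. Its last two conclusions say that
  changing back returns the old generators.\<close>

lemma hecke_datum_transfer:
  fixes eq :: "'a::ring_1 \<Rightarrow> 'a \<Rightarrow> bool" and sc :: "'f::field \<Rightarrow> 'a"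
  assumes "affine_orbit \<alpha> \<beta> e" "affine_orbit \<alpha>' \<beta>' e'"
    and "hecke_datum eq sc \<alpha> \<beta> (weight_poly e \<Lambda>) d x a"
    and "coordinate_pair \<alpha> \<beta> e \<alpha>' \<beta>' e' \<Lambda> d E L"
    and X_def: "X = (\<lambda>r. poly_eval sc (x r) E)"
    and b_def: "b = (\<lambda>r. a r * algebra_congruence.twist_factor sc \<alpha> \<beta> E L (x r) (x (Suc r)))"
  shows "hecke_datum eq sc \<alpha>' \<beta>' (weight_poly e' \<Lambda>) d X b"
    and "\<And>r. r \<in> {1..d} \<Longrightarrow> eq (poly_eval sc (X r) L) (x r)"
    and "\<And>r. r \<in> {1..<d} \<Longrightarrow>
      eq (b r * algebra_congruence.twist_factor sc \<alpha>' \<beta>' L E (X r) (X (Suc r))) (a r)"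
proof -
  interpret O: affine_orbit \<alpha> \<beta> e by fact
  interpret O': affine_orbit \<alpha>' \<beta>' e' by fact
  interpret H: hecke_datum eq sc \<alpha> \<beta> "weight_poly e \<Lambda>" d x a by fact
  define n M where "n = support_bound \<Lambda>" and "M = mult_bound \<Lambda>"
  obtain P where P: "P = orbit_poly e {-(n + int d + 1)..n + int d + 1} (M * 4 ^ d * 4)"
    and E: "\<And>i. i \<in> Poly_Mapping.keys \<Lambda> \<Longrightarrow> poly E (e i) = e' i"
    and P_dvd: "P dvd pcompose L E - [:0, 1:]" "P dvd pcompose E [:\<beta>, \<alpha>:] - pcompose [:\<beta>', \<alpha>':] E"
    using assms(4) unfolding coordinate_pair_def n_def M_def by blast
  have M: "M > 0" and n: "n \<ge> 0"
    by (simp_all add: M_def mult_bound_def n_def support_bound)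
  define p where "p = orbit_poly e {-(n + int d)..n + int d} (M * 4 ^ d)"
  have p_P: "p ^ 4 dvd P"
    unfolding p_def P orbit_poly_power by (rule orbit_poly_mono) auto
  have "p * pcompose p O.\<sigma>inv dvd P"
  proof -
    have "pcompose p O.\<sigma>inv dvd orbit_poly e {-(n + int d + 1)..n + int d + 1} (M * 4 ^ d)"
      unfolding p_def by (rule dvd_trans[OF O.orbit_poly_sigmainv], rule orbit_poly_mono) auto
    moreover have "p dvd orbit_poly e {-(n + int d + 1)..n + int d + 1} (M * 4 ^ d)"
      unfolding p_def by (rule orbit_poly_mono) auto
    ultimately have "p * pcompose p O.\<sigma>inv dvd orbit_poly e {-(n + int d + 1)..n + int d + 1} (M * 4 ^ d + M * 4 ^ d)"
      unfolding orbit_poly_mult[symmetric] by (intro mult_dvd_mono)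
    also have "\<dots> dvd P"
      unfolding P by (rule orbit_poly_mono) auto
    finally show ?thesis .
  qed
  then have inv: "p * pcompose p O.\<sigma>inv dvd pcompose L E - [:0, 1:]"
    using P_dvd(1) by (rule dvd_trans)
  interpret C: hecke_change eq sc \<alpha> \<beta> "weight_poly e \<Lambda>" d x a \<alpha>' \<beta>' p E L "e 0" "weight_poly e' \<Lambda>"
  proof unfold_locales
    show "p ^ 4 dvd pcompose L E - [:0, 1:]" "p ^ 4 dvd pcompose E [:\<beta>, \<alpha>:] - pcompose [:\<beta>', \<alpha>':] E"
      using p_P P_dvd dvd_trans by blast+
    show "eq (poly_eval sc (x r) p) 0" if "r \<in> {1..d}" for r
      using hecke_datum_annihilating_poly[OF assms(1,3) that]
      by (simp add: p_def n_def M_def annihilating_poly_def)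
    have "[:- e 0, 1:] ^ 1 dvd [:- e 0, 1:] ^ (M * 4 ^ d)"
      using M by (intro le_imp_power_dvd) (simp add: Suc_le_eq)
    also have "\<dots> dvd p"
      unfolding p_def orbit_poly_def using n by (intro dvd_prodI) auto
    finally show "poly p (e 0) = 0"
      by (simp add: poly_eq_0_iff_dvd)
    show "eq (poly_eval sc (poly_eval sc (x 1) E) (weight_poly e' \<Lambda>)) 0" if "1 \<le> d"
    proof -
      \<comment> \<open>Since \<open>E - e' i\<close> vanishes at \<open>e i\<close>, the
        divisibility holds factor by factor with the same exponents, so the old cyclotomic relation
        implies the new one.\<close>
      have "weight_poly e \<Lambda> dvd pcompose (weight_poly e' \<Lambda>) E"
        unfolding weight_poly_def pcompose_prod pcompose_power
      proof (intro prod_dvd_prod dvd_power_same)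
        fix i assume "i \<in> Poly_Mapping.keys \<Lambda>"
        then have "poly (pcompose [:- e' i, 1:] E) (e i) = 0"
          using E by (simp add: poly_pcompose)
        then show "[:- e i, 1:] dvd pcompose [:- e' i, 1:] E"
          by (simp only: poly_eq_0_iff_dvd)
      qed
      then have "eq (poly_eval sc (x 1) (pcompose (weight_poly e' \<Lambda>) E)) 0"
        using H.pe_dvd_0 H.cyclotomic[OF that] by blast
      then show ?thesis
        using H.eq_trans[OF H.eq_sym[OF H.pe_pcompose]] by blast
    qed
  qed (use O'.alpha in auto)
  have X: "X = C.X'" and b: "b = C.a'"
    by (simp_all add: X_def b_def C.X'_def C.a'_def fun_eq_iff)
  show "hecke_datum eq sc \<alpha>' \<beta>' (weight_poly e' \<Lambda>) d X b"
    unfolding X b by (rule C.hecke_datum_change)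
  show "eq (poly_eval sc (X r) L) (x r)" if "r \<in> {1..d}" for r
    unfolding X using that by (rule C.inverse_coordinate)
  show "eq (b r * H.twist_factor \<alpha>' \<beta>' L E (X r) (X (Suc r))) (a r)" if "r \<in> {1..<d}" for r
    unfolding X b using that inv by (intro C.inverse_generator) auto
qed

section \<open>Quotients of free algebras\<close>

definition two_sided_ideal :: "'a::ring_1 set \<Rightarrow> bool"
  where "two_sided_ideal K \<longleftrightarrow> 0 \<in> K \<and> (\<forall>a\<in>K. \<forall>b\<in>K. a - b \<in> K) \<and> (\<forall>a\<in>K. \<forall>r. r * a \<in> K \<and> a * r \<in> K)"

definition generated_ideal :: "'a::ring_1 set \<Rightarrow> 'a set"
  where "generated_ideal S = \<Inter>{K. two_sided_ideal K \<and> S \<subseteq> K}"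

lemma two_sided_idealD:
  assumes "two_sided_ideal K"
  shows "0 \<in> K" "a \<in> K \<Longrightarrow> b \<in> K \<Longrightarrow> a - b \<in> K" "a \<in> K \<Longrightarrow> b \<in> K \<Longrightarrow> a + b \<in> K"
    "a \<in> K \<Longrightarrow> - a \<in> K" "a \<in> K \<Longrightarrow> r * a \<in> K" "a \<in> K \<Longrightarrow> a * r \<in> K"
proof -
  show *: "0 \<in> K" "a \<in> K \<Longrightarrow> b \<in> K \<Longrightarrow> a - b \<in> K" for a b
    using assms by (simp_all add: two_sided_ideal_def)
  show "a \<in> K \<Longrightarrow> - a \<in> K" "a \<in> K \<Longrightarrow> b \<in> K \<Longrightarrow> a + b \<in> K" for a b
    using *(2)[of 0 a] *(2)[of a "0 - b"] *(2)[of 0 b] *(1) by auto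
  show "a \<in> K \<Longrightarrow> r * a \<in> K" "a \<in> K \<Longrightarrow> a * r \<in> K"
    using assms by (simp_all add: two_sided_ideal_def)
qed

lemma ideal_generated: "two_sided_ideal (generated_ideal S)"
  unfolding two_sided_ideal_def[of "generated_ideal S"]
  by (auto simp: generated_ideal_def intro: two_sided_idealD)

lemma generated_ideal_superset: "S \<subseteq> generated_ideal S"
  by (auto simp: generated_ideal_def)

lemma generated_ideal_minimal: "two_sided_ideal K \<Longrightarrow> S \<subseteq> K \<Longrightarrow> generated_ideal S \<subseteq> K"
  by (auto simp: generated_ideal_def)

lemma ring_congruence_ideal:
  assumes K: "two_sided_ideal K"
  shows "ring_congruence (\<lambda>x y. x - y \<in> K)"
proof
  note K = two_sided_idealD[OF K]
  show "x - x \<in> K" for x by (simp add: K)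
  show "y - x \<in> K" if "x - y \<in> K" for x y
    using K(4)[OF that] by simp
  show "x - z \<in> K" if "x - y \<in> K" "y - z \<in> K" for x y z
    using K(3)[OF that] by simp
  show "x + y - (x' + y') \<in> K" if "x - x' \<in> K" "y - y' \<in> K" for x x' y y'
    using K(3)[OF that] by (simp add: algebra_simps)
  show "x * y - x' * y' \<in> K" if "x - x' \<in> K" "y - y' \<in> K" for x x' y y'
    using K(3)[OF K(6)[OF that(1), of y] K(5)[OF that(2), of x']] by (simp add: algebra_simps)
qed

text \<open>Exhibits a record with a carrier as the image of a whole type of class
  \<open>ring_1\<close>, so that computations can be made upstairs with the operations of the
  type.\<close>

locale algebra_epi =
  fixes B :: "('f::field, 'b) module" and sc :: "'f \<Rightarrow> 'a::ring_1" and \<pi> :: "'a \<Rightarrow> 'b"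
  assumes range: "range \<pi> = carrier B"
    and zero: "\<pi> 0 = \<zero>\<^bsub>B\<^esub>" and one: "\<pi> 1 = \<one>\<^bsub>B\<^esub>"
    and add: "\<pi> (z + w) = \<pi> z \<oplus>\<^bsub>B\<^esub> \<pi> w" and mult: "\<pi> (z * w) = \<pi> z \<otimes>\<^bsub>B\<^esub> \<pi> w"
    and smult: "\<pi> (sc c * z) = c \<odot>\<^bsub>B\<^esub> \<pi> z"
begin

lemma closed [simp]: "\<pi> z \<in> carrier B"
  using range by auto

lemma ring: "ring B"
proof (rule ringI[OF abelian_groupI monoidI])
  fix u assume "u \<in> carrier B"
  then obtain z where u: "u = \<pi> z" using range by auto
  show "\<exists>v\<in>carrier B. v \<oplus>\<^bsub>B\<^esub> u = \<zero>\<^bsub>B\<^esub>"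
    unfolding u by (rule bexI[of _ "\<pi> (- z)"]) (simp_all add: zero flip: add)
qed (auto simp: algebra_simps simp flip: range zero one add mult)

sublocale B: ring B by (rule ring)

lemma uminus: "\<pi> (- z) = \<ominus>\<^bsub>B\<^esub> \<pi> z"
  by (rule B.minus_equality[symmetric]) (simp_all flip: add zero)

lemma diff: "\<pi> (z - w) = \<pi> z \<ominus>\<^bsub>B\<^esub> \<pi> w"
  using add[of z "- w"] by (simp add: uminus a_minus_def)

lemma eq_iff: "\<pi> z = \<pi> w \<longleftrightarrow> \<pi> (z - w) = \<zero>\<^bsub>B\<^esub>"
proof
  show "\<pi> z = \<pi> w" if "\<pi> (z - w) = \<zero>\<^bsub>B\<^esub>"
    using that add[of "z - w" w] by simp
qed (simp add: diff B.minus_eq B.r_neg)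

lemma power: "\<pi> (z ^ n) = \<pi> z [^]\<^bsub>B\<^esub> n"
  by (induction n) (simp_all add: one mult power_Suc2 del: power_Suc)

lemma ideal_image:
  assumes "two_sided_ideal K"
  shows "ideal (\<pi> ` K) B"
proof (rule idealI[OF ring])
  note K = two_sided_idealD[OF assms]
  show "subgroup (\<pi> ` K) (add_monoid B)"
  proof (rule B.add.subgroupI)
    show "\<pi> ` K \<subseteq> carrier B" by auto
    show "\<pi> ` K \<noteq> {}" using K(1) by auto
    show "\<ominus>\<^bsub>B\<^esub> u \<in> \<pi> ` K" if "u \<in> \<pi> ` K" for u
      using that K(4) by (auto simp flip: uminus)
    show "u \<oplus>\<^bsub>B\<^esub> v \<in> \<pi> ` K" if "u \<in> \<pi> ` K" "v \<in> \<pi> ` K" for u v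
      using that K(3) by (auto simp flip: add)
  qed
  show "v \<otimes>\<^bsub>B\<^esub> u \<in> \<pi> ` K" "u \<otimes>\<^bsub>B\<^esub> v \<in> \<pi> ` K" if "u \<in> \<pi> ` K" "v \<in> carrier B" for u v
    using that K(5,6) by (auto simp flip: mult range)
qed

lemma algebra_epi_quotient:
  assumes "ideal J B"
  shows "algebra_epi (quotient_algebra B J) sc (\<lambda>z. J +>\<^bsub>B\<^esub> \<pi> z)"
proof -
  interpret J: ideal J B by fact
  show ?thesis
  proof
    show "range (\<lambda>z. J +>\<^bsub>B\<^esub> \<pi> z) = carrier (quotient_algebra B J)"
      by (auto simp: quotient_algebra_def FactRing_def A_RCOSETS_def' simp flip: range)
    show "J +>\<^bsub>B\<^esub> \<pi> 0 = \<zero>\<^bsub>quotient_algebra B J\<^esub>"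
      by (simp add: quotient_algebra_def FactRing_def zero J.a_rcos_const)
    show "J +>\<^bsub>B\<^esub> \<pi> 1 = \<one>\<^bsub>quotient_algebra B J\<^esub>"
      by (simp add: quotient_algebra_def FactRing_def one)
    show "J +>\<^bsub>B\<^esub> \<pi> (z + w) = (J +>\<^bsub>B\<^esub> \<pi> z) \<oplus>\<^bsub>quotient_algebra B J\<^esub> (J +>\<^bsub>B\<^esub> \<pi> w)" for z w
      by (simp add: quotient_algebra_def FactRing_def add J.a_rcos_sum)
    show "J +>\<^bsub>B\<^esub> \<pi> (z * w) = (J +>\<^bsub>B\<^esub> \<pi> z) \<otimes>\<^bsub>quotient_algebra B J\<^esub> (J +>\<^bsub>B\<^esub> \<pi> w)" for z w
      by (simp add: quotient_algebra_def FactRing_def mult J.rcoset_mult_add)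
    show "J +>\<^bsub>B\<^esub> \<pi> (sc c * z) = c \<odot>\<^bsub>quotient_algebra B J\<^esub> (J +>\<^bsub>B\<^esub> \<pi> z)" for c z
    proof -
      have "J +>\<^bsub>B\<^esub> (c \<odot>\<^bsub>B\<^esub> u) = J +>\<^bsub>B\<^esub> \<pi> (sc c * z)" if u: "u \<in> J +>\<^bsub>B\<^esub> \<pi> z" for u
      proof -
        have "u \<in> carrier B"
          using u B.a_r_coset_subset_G[OF J.a_subset closed] by auto
        then obtain w where w: "u = \<pi> w" using range by auto
        have "J +>\<^bsub>B\<^esub> u = J +>\<^bsub>B\<^esub> \<pi> z"
          using J.a_repr_independence'[OF u] by simp
        \<comment> \<open>A scalar acts as multiplication by an element of the ring, so all
          representatives in the union that defines the scalar product yield the same coset.\<close>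
        moreover have "c \<odot>\<^bsub>B\<^esub> u = \<pi> (sc c) \<otimes>\<^bsub>B\<^esub> u" unfolding w by (simp flip: smult mult)
        ultimately show ?thesis
          by (simp add: mult w flip: J.rcoset_mult_add)
      qed
      moreover have "\<pi> z \<in> J +>\<^bsub>B\<^esub> \<pi> z"
        by (rule J.a_rcos_self) simp
      ultimately show ?thesis
        by (auto simp: quotient_algebra_def)
    qed
  qed
qed

text \<open>Collapses an iterated quotient to one by a single ideal upstairs. It is applied first to
  the defining relations and then to the cyclotomic element.\<close>

lemma kernel_quotient:
  assumes kernel: "{z. \<pi> z = \<zero>\<^bsub>B\<^esub>} = generated_ideal S" and C: "C = \<pi> ` C'"
  shows "{z. Idl\<^bsub>B\<^esub> C +>\<^bsub>B\<^esub> \<pi> z = \<zero>\<^bsub>quotient_algebra B (Idl\<^bsub>B\<^esub> C)\<^esub>} = generated_ideal (S \<union> C')"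
proof -
  have C_carrier: "C \<subseteq> carrier B" by (auto simp: C)
  define J where "J = Idl\<^bsub>B\<^esub> C"
  interpret J: ideal J B
    unfolding J_def by (rule B.genideal_ideal[OF C_carrier])
  interpret Q: algebra_epi "quotient_algebra B J" sc "\<lambda>z. J +>\<^bsub>B\<^esub> \<pi> z"
    by (rule algebra_epi_quotient) unfold_locales
  have in_J: "J +>\<^bsub>B\<^esub> \<pi> z = \<zero>\<^bsub>quotient_algebra B J\<^esub> \<longleftrightarrow> \<pi> z \<in> J" for z
    by (simp add: quotient_algebra_def FactRing_def)
      (metis J.a_rcos_const J.rcos_const_imp_mem closed)
  have "{z. \<pi> z \<in> J} = generated_ideal (S \<union> C')"
  proof (intro equalityI subsetI)
    let ?K = "generated_ideal (S \<union> C')"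
    note K = ideal_generated[of "S \<union> C'"]
    fix z assume "z \<in> {z. \<pi> z \<in> J}"
    moreover have "J \<subseteq> \<pi> ` ?K"
      unfolding J_def C using generated_ideal_superset[of "S \<union> C'"]
      by (intro B.genideal_minimal ideal_image K) auto
    ultimately obtain k where k: "k \<in> ?K" "\<pi> z = \<pi> k" by auto
    then have "\<pi> (z - k) = \<zero>\<^bsub>B\<^esub>" by (simp add: diff B.minus_eq B.r_neg)
    then have "z - k \<in> generated_ideal S" using kernel by auto
    also have "generated_ideal S \<subseteq> ?K"
      using generated_ideal_superset[of "S \<union> C'"] by (intro generated_ideal_minimal K) auto
    finally show "z \<in> ?K"
      using two_sided_idealD(3)[OF K _ k(1)] by fastforce
  next
    fix z assume z: "z \<in> generated_ideal (S \<union> C')"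
    have "two_sided_ideal {z. \<pi> z \<in> J}"
      unfolding two_sided_ideal_def
      by (auto simp: zero diff mult J.I_l_closed J.I_r_closed a_minus_def)
    moreover have "S \<union> C' \<subseteq> {z. \<pi> z \<in> J}"
    proof -
      have "\<pi> z \<in> J" if "z \<in> S" for z
      proof -
        have "\<pi> z = \<zero>\<^bsub>B\<^esub>" using that kernel generated_ideal_superset[of S] by blast
        then show ?thesis by simp
      qed
      moreover have "\<pi> z \<in> J" if "z \<in> C'" for z
        using that B.genideal_self[OF C_carrier] by (auto simp: J_def C)
      ultimately show ?thesis by auto
    qed
    ultimately show "z \<in> {z. \<pi> z \<in> J}"
      using z generated_ideal_minimal by blast
  qed
  then show ?thesis
    unfolding J_def[symmetric] in_J .
qed

end

text \<open>The map between carriers is defined through chosen representatives; compatibility of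
  \<open>\<phi>\<close> with the two projections makes it independent of the choice.\<close>

lemma algebra_isomorphic_if_inverse:
  assumes "algebra_epi B sc \<pi>" "algebra_epi B' sc' \<pi>'"
    and \<phi>: "\<And>z w. \<phi> (z + w) = \<phi> z + \<phi> w" "\<And>z w. \<phi> (z * w) = \<phi> z * \<phi> w" "\<phi> 1 = 1"
      "\<And>c. \<phi> (sc c) = sc' c"
    and \<phi>_cong: "\<And>z w. \<pi> z = \<pi> w \<Longrightarrow> \<pi>' (\<phi> z) = \<pi>' (\<phi> w)"
    and \<psi>_cong: "\<And>z w. \<pi>' z = \<pi>' w \<Longrightarrow> \<pi> (\<psi> z) = \<pi> (\<psi> w)"
    and inverse: "\<And>z. \<pi> (\<psi> (\<phi> z)) = \<pi> z" "\<And>z. \<pi>' (\<phi> (\<psi> z)) = \<pi>' z"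
  shows "algebra_isomorphic B B'"
proof -
  interpret B: algebra_epi B sc \<pi> by fact
  interpret B': algebra_epi B' sc' \<pi>' by fact
  define h where "h b = \<pi>' (\<phi> (SOME z. \<pi> z = b))" for b
  have h: "h (\<pi> z) = \<pi>' (\<phi> z)" for z
    unfolding h_def by (rule \<phi>_cong, rule someI[of _ z]) simp
  have "h \<in> ring_hom B B'"
    by (rule ring_hom_memI)
      (auto simp: h \<phi> simp flip: B.range B.one B.add B.mult B'.one B'.add B'.mult)
  moreover have "bij_betw h (carrier B) (carrier B')"
    unfolding bij_betw_def
  proof
    show "inj_on h (carrier B)"
    proof (rule inj_onI)
      fix u v assume "u \<in> carrier B" "v \<in> carrier B" and eq: "h u = h v"
      then obtain z w where zw: "u = \<pi> z" "v = \<pi> w" using B.range by blast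
      show "u = v"
        using \<psi>_cong[of "\<phi> z" "\<phi> w"] eq by (simp add: zw h inverse)
    qed
    have "u \<in> h ` carrier B" if "u \<in> carrier B'" for u
    proof -
      from that obtain z where "u = \<pi>' z" using B'.range by auto
      then have "u = h (\<pi> (\<psi> z))" by (simp add: h inverse)
      then show ?thesis by auto
    qed
    then show "h ` carrier B = carrier B'"
      by (auto simp: h simp flip: B.range)
  qed
  moreover have "h (c \<odot>\<^bsub>B\<^esub> b) = c \<odot>\<^bsub>B'\<^esub> h b" if "b \<in> carrier B" for c b
  proof -
    from that obtain z where "b = \<pi> z" using B.range by auto
    then show ?thesis by (simp add: h \<phi> flip: B.smult B'.smult)
  qed
  ultimately have "h \<in> algebra_iso B B'"
    by (simp add: algebra_iso_def ring_iso_def)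
  then show ?thesis
    by (auto simp: algebra_isomorphic_def)
qed

text \<open>The ordered product becomes the value of one polynomial, and the factors are rearranged
  in the commutative polynomial ring.\<close>

lemma cyclotomic_element_image:
  assumes "algebra_epi B sc \<pi>" "algebra_congruence (=) sc"
  shows "cyclotomic_element B e \<Lambda> (\<pi> y) = \<pi> (poly_eval sc y (weight_poly e \<Lambda>))"
proof -
  interpret B: algebra_epi B sc \<pi> by fact
  interpret A: algebra_congruence "(=)" sc by fact
  have lin: "\<pi> (y - sc c) = \<pi> y \<ominus>\<^bsub>B\<^esub> (c \<odot>\<^bsub>B\<^esub> \<one>\<^bsub>B\<^esub>)" for c
    using B.smult[of c 1] by (simp add: B.diff B.one)
  have pw: "A.pe ([:- c, 1:] ^ n) y = (y - sc c) ^ n" for c n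
  proof (induction n)
    case (Suc n)
    have "A.pe [:- c, 1:] y = y - sc c"
      by (simp add: A.sc_minus)
    then show ?case
      unfolding power_Suc A.pe_mult Suc.IH by simp
  qed (simp add: one_pCons)
  have "foldr (\<lambda>i p. (\<pi> y \<ominus>\<^bsub>B\<^esub> (e i \<odot>\<^bsub>B\<^esub> \<one>\<^bsub>B\<^esub>)) [^]\<^bsub>B\<^esub> Poly_Mapping.lookup \<Lambda> i \<otimes>\<^bsub>B\<^esub> p) l \<one>\<^bsub>B\<^esub>
    = \<pi> (A.pe (\<Prod>i\<leftarrow>l. [:- e i, 1:] ^ Poly_Mapping.lookup \<Lambda> i) y)" for l
  proof (induction l)
    case (Cons i l)
    then show ?case
      unfolding foldr.simps list.map prod_list.Cons A.pe_mult pw B.mult B.power lin by simp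
  qed (simp add: B.one one_pCons)
  then show ?thesis
    unfolding cyclotomic_element_def weight_poly_def
    by (simp add: prod.distinct_set_conv_list[symmetric])
qed

section \<open>The universal property of free algebras and presentations\<close>

lemma poly_mapping_single_induct [case_names zero single add]:
  assumes "Q 0" "\<And>k c. Q (Poly_Mapping.single k c)" "\<And>f g. Q f \<Longrightarrow> Q g \<Longrightarrow> Q (f + g)"
  shows "Q (f :: 'k \<Rightarrow>\<^sub>0 'c::comm_monoid_add)"
proof (induction f rule: update_induct)
  case (update f k c)
  have "Poly_Mapping.update k c f = f + Poly_Mapping.single k c"
    using update(1) by (intro poly_mapping_eqI) (auto simp: lookup_update lookup_add lookup_single in_keys_iff when_def)
  then show ?case
    using assms(2,3) update by simp
qed (rule assms(1))

lemma scalar_simps: "scalar 0 = 0" "scalar 1 = 1" "scalar (b + c) = scalar b + scalar c"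
  "scalar (b * c) = scalar b * scalar c"
  by (simp_all add: scalar_def single_add mult_single)

lemma scalar_central: "scalar c * z = z * scalar c"
  by (induction z rule: poly_mapping_single_induct)
    (simp_all add: scalar_def mult_single mult.commute distrib_left distrib_right)

interpretation F: algebra_congruence "(=)" "scalar :: 'f::field \<Rightarrow> ('g fword \<Rightarrow>\<^sub>0 'f)"
  by unfold_locales (rule scalar_simps scalar_central | simp)+

lemma algebra_congruence_ideal:
  "two_sided_ideal K \<Longrightarrow> algebra_congruence (\<lambda>x y. x - y \<in> K) (scalar :: 'f::field \<Rightarrow> ('g fword \<Rightarrow>\<^sub>0 'f))"
  by (intro algebra_congruence.intro ring_congruence_ideal algebra_congruence_axioms.intro)
    (assumption | rule scalar_simps scalar_central)+

lemma single_Word: "Poly_Mapping.single (Word l) c = scalar c * prod_list (map gen l)"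
proof -
  have "prod_list (map gen l) = (Poly_Mapping.single (Word l) 1 :: _ fword \<Rightarrow>\<^sub>0 'b)"
    by (induction l) (simp_all add: gen_def mult_single plus_fword_def flip: zero_fword_def)
  then show ?thesis
    by (simp add: scalar_def mult_single)
qed

lemma free_algebra_induct [case_names scalar gen add mult]:
  fixes z :: "'g fword \<Rightarrow>\<^sub>0 'f::field"
  assumes "\<And>c. Q (scalar c)" "\<And>g. Q (gen g)" "\<And>f g. Q f \<Longrightarrow> Q g \<Longrightarrow> Q (f + g)"
    "\<And>f g. Q f \<Longrightarrow> Q g \<Longrightarrow> Q (f * g)"
  shows "Q z"
proof (induction z rule: poly_mapping_single_induct)
  case zero
  show ?case using assms(1)[of 0] by (simp add: scalar_simps)
next
  case (single k c)
  have "Q (prod_list (map gen l))" for l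
    by (induction l) (use assms(1)[of 1] in \<open>simp_all add: scalar_simps assms\<close>)
  then show ?case
    using assms(1,4) by (metis single_Word fword.collapse)
qed (rule assms(3))

definition lift :: "('f::field \<Rightarrow> 'b::ring_1) \<Rightarrow> ('g \<Rightarrow> 'b) \<Rightarrow> ('g fword \<Rightarrow>\<^sub>0 'f) \<Rightarrow> 'b"
  where "lift sc m z = (\<Sum>w\<in>Poly_Mapping.keys z. sc (Poly_Mapping.lookup z w) * prod_list (map m (letters w)))"

locale free_lift = algebra_congruence "(=)" sc for sc :: "'f::field \<Rightarrow> 'b::ring_1" +
  fixes m :: "'g \<Rightarrow> 'b"
begin

abbreviation \<phi> :: "('g fword \<Rightarrow>\<^sub>0 'f) \<Rightarrow> 'b" where "\<phi> \<equiv> lift sc m"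

lemma lift_superset:
  assumes "finite W" "Poly_Mapping.keys z \<subseteq> W"
  shows "\<phi> z = (\<Sum>w\<in>W. sc (Poly_Mapping.lookup z w) * prod_list (map m (letters w)))"
  unfolding lift_def using assms by (intro sum.mono_neutral_left) (auto simp: in_keys_iff)

lemma lift_add: "\<phi> (y + z) = \<phi> y + \<phi> z"
proof -
  let ?W = "Poly_Mapping.keys y \<union> Poly_Mapping.keys z"
  have "\<phi> (y + z) = (\<Sum>w\<in>?W. sc (Poly_Mapping.lookup (y + z) w) * prod_list (map m (letters w)))"
    using keys_add[of y z] by (intro lift_superset) auto
  also have "\<dots> = \<phi> y + \<phi> z"
    using lift_superset[of ?W y] lift_superset[of ?W z]
    by (simp add: lookup_add sc_add distrib_right sum.distrib)
  finally show ?thesis .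
qed

lemma lift_single: "\<phi> (Poly_Mapping.single w c) = sc c * prod_list (map m (letters w))"
  by (cases "c = 0") (simp_all add: lift_def)

lemma lift_0: "\<phi> 0 = 0"
  by (simp add: lift_def)

lemma lift_mult: "\<phi> (y * z) = \<phi> y * \<phi> z"
proof (induction y rule: poly_mapping_single_induct)
  case (single v b)
  show ?case
  proof (induction z rule: poly_mapping_single_induct)
    case (single w c)
    have "sc b * sc c * (P * R) = sc b * P * (sc c * R)" for P R
      by (metis mult.assoc sc_commute)
    then show ?case
      by (simp add: mult_single lift_single plus_fword_def sc_mult)
  qed (simp_all add: lift_add distrib_left lift_0)
qed (simp_all add: lift_add distrib_right lift_0)

lemma lift_scalar [simp]: "\<phi> (scalar c) = sc c"
  by (simp add: scalar_def lift_single zero_fword_def)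

lemma lift_gen [simp]: "\<phi> (gen g) = m g"
  by (simp add: gen_def lift_single)

lemma lift_hom: "hom_mod \<phi>"
  using lift_scalar[of 0] lift_scalar[of 1]
  by (simp add: hom_mod_def lift_add lift_mult scalar_simps)

lemmas lift_simps = lift_add lift_mult hom_modD(1,2,5,6)[OF lift_hom]

lemma lift_pe: "\<phi> (poly_eval scalar z f) = pe f (\<phi> z)"
  by (rule hom_poly_eval[OF lift_hom]) (simp_all add: scalar_simps)

lemma lift_divdiff: "\<phi> (divdiff scalar f z y) = divdiff sc f (\<phi> z) (\<phi> y)"
  by (rule hom_divdiff[OF lift_hom]) (simp_all add: scalar_simps)

lemma lift_twist_factor:
  "\<phi> (F.twist_factor \<alpha> \<beta> E L z y) = twist_factor \<alpha> \<beta> E L (\<phi> z) (\<phi> y)"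
  by (simp add: F.twist_factor_def twist_factor_def lift_simps lift_divdiff lift_pe)

lemma two_sided_ideal_vimage:
  assumes "two_sided_ideal K"
  shows "two_sided_ideal {z. \<phi> z \<in> K}"
  unfolding two_sided_ideal_def by (auto simp: lift_simps intro: two_sided_idealD[OF assms])

lemma lift_generated_ideal:
  assumes "two_sided_ideal K" "\<And>s. s \<in> S \<Longrightarrow> \<phi> s \<in> K" "z \<in> generated_ideal S"
  shows "\<phi> z \<in> K"
  using generated_ideal_minimal[OF two_sided_ideal_vimage[OF assms(1)], of S] assms(2,3) by auto

end

lemma free_algebra_agree:
  fixes K :: "'b::ring_1 set" and \<phi> \<psi> :: "('g fword \<Rightarrow>\<^sub>0 'f::field) \<Rightarrow> 'b"
  assumes K: "two_sided_ideal K" and gen: "\<And>g. \<phi> (gen g) - \<psi> (gen g) \<in> K"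
    and "\<And>c. \<phi> (scalar c) = \<psi> (scalar c)"
    and "\<And>y z. \<phi> (y + z) = \<phi> y + \<phi> z" "\<And>y z. \<phi> (y * z) = \<phi> y * \<phi> z"
    and "\<And>y z. \<psi> (y + z) = \<psi> y + \<psi> z" "\<And>y z. \<psi> (y * z) = \<psi> y * \<psi> z"
  shows "\<phi> z - \<psi> z \<in> K"
proof (induction z rule: free_algebra_induct)
  interpret ring_congruence "\<lambda>x y. x - y \<in> K" by (rule ring_congruence_ideal[OF K])
  case (add y z)
  then show ?case unfolding assms using eq_add by blast
next
  interpret ring_congruence "\<lambda>x y. x - y \<in> K" by (rule ring_congruence_ideal[OF K])
  case (mult y z)
  then show ?case unfolding assms using eq_mult by blast
qed (use assms two_sided_idealD(1)[OF K] in auto)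

text \<open>A retraction of the free algebra on the whole generator type onto the one on
  \<open>G\<close>, which makes the carrier of \<open>free_algebra G\<close> the image of a
  type.\<close>

definition restrict_gens :: "'g set \<Rightarrow> ('g fword \<Rightarrow>\<^sub>0 'f::field) \<Rightarrow> ('g fword \<Rightarrow>\<^sub>0 'f)"
  where "restrict_gens G = lift scalar (\<lambda>g. if g \<in> G then gen g else 0)"

lemma free_lift_restrict: "free_lift (scalar :: 'f::field \<Rightarrow> ('g fword \<Rightarrow>\<^sub>0 'f))" ..

lemma free_algebra_closed:
  fixes y z :: "'g fword \<Rightarrow>\<^sub>0 'f::field"
  shows "(scalar c :: 'g fword \<Rightarrow>\<^sub>0 'f) \<in> carrier (free_algebra G)" "g \<in> G \<Longrightarrow> (gen g :: 'g fword \<Rightarrow>\<^sub>0 'f) \<in> carrier (free_algebra G)"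
    "0 \<in> carrier (free_algebra G :: ('f, _) module)" "1 \<in> carrier (free_algebra G :: ('f, _) module)"
    "y \<in> carrier (free_algebra G) \<Longrightarrow> z \<in> carrier (free_algebra G) \<Longrightarrow> y + z \<in> carrier (free_algebra G)"
    "y \<in> carrier (free_algebra G) \<Longrightarrow> z \<in> carrier (free_algebra G) \<Longrightarrow> y - z \<in> carrier (free_algebra G)"
    "y \<in> carrier (free_algebra G) \<Longrightarrow> z \<in> carrier (free_algebra G) \<Longrightarrow> y * z \<in> carrier (free_algebra G)"
proof -
  show "y * z \<in> carrier (free_algebra G)"
    if "y \<in> carrier (free_algebra G)" "z \<in> carrier (free_algebra G)"
  proof -
    have "set (letters w) \<subseteq> G" if w: "w \<in> Poly_Mapping.keys (y * z)" for w
    proof -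
      obtain u v where "w = u + v" "u \<in> Poly_Mapping.keys y" "v \<in> Poly_Mapping.keys z"
        using w keys_mult[of y z] by blast
      with \<open>y \<in> _\<close> \<open>z \<in> _\<close> show ?thesis
        by (auto simp: free_algebra_def plus_fword_def)
    qed
    then show ?thesis by (simp add: free_algebra_def)
  qed
  show "y + z \<in> carrier (free_algebra G)" "y - z \<in> carrier (free_algebra G)"
    if "y \<in> carrier (free_algebra G)" "z \<in> carrier (free_algebra G)"
    using that keys_add[of y z] keys_diff[of y z] by (auto simp: free_algebra_def)
qed (auto simp: free_algebra_def scalar_def gen_def zero_fword_def simp flip: single_one)

lemma restrict_gens_closed:
  fixes z :: "'g fword \<Rightarrow>\<^sub>0 'f::field"
  shows "restrict_gens G z \<in> carrier (free_algebra G)"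
proof -
  interpret R: free_lift "scalar :: 'f \<Rightarrow> ('g fword \<Rightarrow>\<^sub>0 'f)" "\<lambda>g. if g \<in> G then gen g else 0"
    by (rule free_lift_restrict)
  show ?thesis
    unfolding restrict_gens_def
    by (induction z rule: free_algebra_induct) (auto simp: R.lift_simps intro: free_algebra_closed)
qed

lemma restrict_gens_id:
  fixes z :: "'g fword \<Rightarrow>\<^sub>0 'f::field"
  assumes "z \<in> carrier (free_algebra G)"
  shows "restrict_gens G z = z"
proof -
  have "restrict_gens G z = (\<Sum>w\<in>Poly_Mapping.keys z. Poly_Mapping.single w (Poly_Mapping.lookup z w))"
    unfolding restrict_gens_def lift_def
  proof (rule sum.cong[OF refl])
    fix w assume "w \<in> Poly_Mapping.keys z"
    then have "set (letters w) \<subseteq> G"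
      using assms by (auto simp: free_algebra_def)
    then have *: "map (\<lambda>g. if g \<in> G then gen g else 0) (letters w) = (map gen (letters w) :: (_ \<Rightarrow>\<^sub>0 'f) list)"
      by auto
    show "scalar (Poly_Mapping.lookup z w) * prod_list (map (\<lambda>g. if g \<in> G then gen g else 0) (letters w))
      = Poly_Mapping.single w (Poly_Mapping.lookup z w)"
      unfolding * by (simp flip: single_Word)
  qed
  also have "\<dots> = z"
    by (intro poly_mapping_eqI) (simp add: lookup_sum lookup_single when_def in_keys_iff)
  finally show ?thesis .
qed

lemma algebra_epi_free:
  "algebra_epi (free_algebra G) (scalar :: 'f::field \<Rightarrow> ('g fword \<Rightarrow>\<^sub>0 'f)) (restrict_gens G)"
proof -
  interpret R: free_lift "scalar :: 'f \<Rightarrow> ('g fword \<Rightarrow>\<^sub>0 'f)" "\<lambda>g. if g \<in> G then gen g else 0"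
    by (rule free_lift_restrict)
  show ?thesis
  proof
  show "range (restrict_gens G) = carrier (free_algebra G :: ('f, _) module)"
    proof (intro equalityI subsetI)
      fix z :: "'g fword \<Rightarrow>\<^sub>0 'f"
      show "z \<in> carrier (free_algebra G)" if "z \<in> range (restrict_gens G)"
        using that restrict_gens_closed by auto
      show "z \<in> range (restrict_gens G)" if "z \<in> carrier (free_algebra G)"
        using restrict_gens_id[OF that] by (metis rangeI)
    qed
  qed (simp_all add: restrict_gens_def free_algebra_def R.lift_simps)
qed

lemma kernel_free:
  "{z. restrict_gens G z = \<zero>\<^bsub>free_algebra G\<^esub>} = generated_ideal (gen ` (- G) :: ('g fword \<Rightarrow>\<^sub>0 'f::field) set)"
proof (intro equalityI subsetI)
  interpret R: free_lift "scalar :: 'f \<Rightarrow> ('g fword \<Rightarrow>\<^sub>0 'f)" "\<lambda>g. if g \<in> G then gen g else 0"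
    by (rule free_lift_restrict)
    let ?K = "generated_ideal (gen ` (- G)) :: (_ \<Rightarrow>\<^sub>0 'f) set"
  note K = ideal_generated[of "gen ` (- G) :: (_ \<Rightarrow>\<^sub>0 'f) set"]
  fix z :: "_ \<Rightarrow>\<^sub>0 'f" assume "z \<in> {z. restrict_gens G z = \<zero>\<^bsub>free_algebra G\<^esub>}"
  then have "restrict_gens G z = 0" by (simp add: free_algebra_def)
  moreover have "z - restrict_gens G z \<in> ?K"
    unfolding restrict_gens_def
  proof (rule free_algebra_agree[where \<phi> = "\<lambda>z. z" and \<psi> = R.\<phi>, OF K])
    show "gen g - R.\<phi> (gen g) \<in> ?K" for g
      using generated_ideal_superset[of "gen ` (- G)"] two_sided_idealD(1)[OF K] by auto
  qed (simp_all add: R.lift_simps)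
  ultimately show "z \<in> ?K" by simp
next
  interpret R: free_lift "scalar :: 'f \<Rightarrow> ('g fword \<Rightarrow>\<^sub>0 'f)" "\<lambda>g. if g \<in> G then gen g else 0"
    by (rule free_lift_restrict)
  fix z :: "_ \<Rightarrow>\<^sub>0 'f" assume "z \<in> generated_ideal (gen ` (- G))"
  then have "R.\<phi> z \<in> {0}"
    by (rule R.lift_generated_ideal[rotated 2]) (auto simp: two_sided_ideal_def)
  then show "z \<in> {z. restrict_gens G z = \<zero>\<^bsub>free_algebra G\<^esub>}"
    by (simp add: free_algebra_def restrict_gens_def)
qed

lemma presented_algebra_epi:
  fixes R :: "(('g fword \<Rightarrow>\<^sub>0 'f::field) \<times> _) set"
  assumes R: "\<And>l r. (l, r) \<in> R \<Longrightarrow> l - r \<in> carrier (free_algebra G)"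
  defines "\<pi> \<equiv> \<lambda>z. relation_ideal G R +>\<^bsub>free_algebra G\<^esub> restrict_gens G z"
  shows "algebra_epi (presented_algebra G R) scalar \<pi>"
    and "{z. \<pi> z = \<zero>\<^bsub>presented_algebra G R\<^esub>} = generated_ideal (gen ` (- G) \<union> {l - r |l r. (l, r) \<in> R})"
    and "g \<in> G \<Longrightarrow> presented_gen G R g = \<pi> (gen g)"
proof -
  interpret F: algebra_epi "free_algebra G" scalar "restrict_gens G :: _ \<Rightarrow> (_ \<Rightarrow>\<^sub>0 'f)"
    by (rule algebra_epi_free)
  have C: "{l - r |l r. (l, r) \<in> R} = restrict_gens G ` {l - r |l r. (l, r) \<in> R}"
    using R restrict_gens_id by (force simp: image_iff)
  have sub: "{l - r |l r. (l, r) \<in> R} \<subseteq> carrier (free_algebra G)"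
    using R by auto
  show "algebra_epi (presented_algebra G R) scalar \<pi>"
    unfolding presented_algebra_def relation_ideal_def \<pi>_def
    by (intro F.algebra_epi_quotient F.B.genideal_ideal sub)
  show "{z. \<pi> z = \<zero>\<^bsub>presented_algebra G R\<^esub>} = generated_ideal (gen ` (- G) \<union> {l - r |l r. (l, r) \<in> R})"
    unfolding presented_algebra_def relation_ideal_def \<pi>_def
    by (rule F.kernel_quotient[OF kernel_free C])
  show "presented_gen G R g = \<pi> (gen g)" if "g \<in> G"
  proof -
    have "restrict_gens G (gen g) = (gen g :: _ \<Rightarrow>\<^sub>0 'f)"
      by (intro restrict_gens_id free_algebra_closed that)
    then show ?thesis
      by (simp add: presented_gen_def \<pi>_def)
  qed
qed

text \<open>Generators of the one ideal that presents a cyclotomic quotient. Letters outside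
  \<open>G\<close> are included because the ambient free algebra is taken on the whole type of
  letters.\<close>

definition cyclotomic_gens where
  "cyclotomic_gens G R d f g =
    gen ` (- G) \<union> {l - r |l r. (l, r) \<in> R} \<union> (if d = (0::nat) then {} else {poly_eval scalar (gen g) f})"

lemma cyclotomic_presentation:
  fixes R :: "(('g fword \<Rightarrow>\<^sub>0 'f::field) \<times> _) set" and e :: "int \<Rightarrow> 'f" and \<Lambda> :: "int \<Rightarrow>\<^sub>0 nat"
  assumes R: "\<And>l r. (l, r) \<in> R \<Longrightarrow> l - r \<in> carrier (free_algebra G)" and g: "d > 0 \<Longrightarrow> g \<in> G"
  defines "B \<equiv> quotient_algebra (presented_algebra G R) (Idl\<^bsub>presented_algebra G R\<^esub>
    (if d = 0 then {} else {cyclotomic_element (presented_algebra G R) e \<Lambda> (presented_gen G R g)}))"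
  shows "\<exists>\<pi>. algebra_epi B scalar \<pi> \<and> (\<forall>z w. \<pi> z = \<pi> w \<longleftrightarrow>
    z - w \<in> generated_ideal (cyclotomic_gens G R d (weight_poly e \<Lambda>) g))"
proof -
  define \<pi>0 where "\<pi>0 = (\<lambda>z. relation_ideal G R +>\<^bsub>free_algebra G\<^esub> restrict_gens G z)"
  have \<pi>0: "algebra_epi (presented_algebra G R) scalar \<pi>0"
    "{z. \<pi>0 z = \<zero>\<^bsub>presented_algebra G R\<^esub>} = generated_ideal (gen ` (- G) \<union> {l - r |l r. (l, r) \<in> R})"
    using presented_algebra_epi(1,2)[of R G] R by (simp_all add: \<pi>0_def)
  interpret P0: algebra_epi "presented_algebra G R" scalar \<pi>0
    by (rule \<pi>0(1))
  define C C' where "C = (if d = 0 then {} else {cyclotomic_element (presented_algebra G R) e \<Lambda> (presented_gen G R g)})"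
    and "C' = (if d = 0 then {} else {poly_eval scalar (gen g) (weight_poly e \<Lambda>) :: 'g fword \<Rightarrow>\<^sub>0 'f})"
  have C: "C = \<pi>0 ` C'"
  proof (cases "d = 0")
    case False
    then have "presented_gen G R g = \<pi>0 (gen g)"
      using presented_algebra_epi(3)[of R G g] R g by (simp add: \<pi>0_def)
    with False show ?thesis
      by (simp add: C_def C'_def cyclotomic_element_image[OF \<pi>0(1) F.algebra_congruence_axioms])
  qed (simp add: C_def C'_def)
  define J where "J = Idl\<^bsub>presented_algebra G R\<^esub> C"
  have B: "B = quotient_algebra (presented_algebra G R) J"
    by (simp add: B_def J_def C_def)
  interpret P1: algebra_epi B scalar "\<lambda>z. J +>\<^bsub>presented_algebra G R\<^esub> \<pi>0 z"
    unfolding B J_def by (intro P0.algebra_epi_quotient P0.B.genideal_ideal) (auto simp: C)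
  have kernel: "{z. J +>\<^bsub>presented_algebra G R\<^esub> \<pi>0 z = \<zero>\<^bsub>B\<^esub>}
    = generated_ideal (cyclotomic_gens G R d (weight_poly e \<Lambda>) g)"
    unfolding B J_def cyclotomic_gens_def C'_def[symmetric]
    by (rule P0.kernel_quotient[OF \<pi>0(2) C])
  show ?thesis
  proof (intro exI conjI allI)
    show "algebra_epi B scalar (\<lambda>z. J +>\<^bsub>presented_algebra G R\<^esub> \<pi>0 z)" ..
    show "J +>\<^bsub>presented_algebra G R\<^esub> \<pi>0 z = J +>\<^bsub>presented_algebra G R\<^esub> \<pi>0 w
      \<longleftrightarrow> z - w \<in> generated_ideal (cyclotomic_gens G R d (weight_poly e \<Lambda>) g)" for z w
      unfolding kernel[symmetric] using P1.eq_iff by simp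
  qed
qed

section \<open>Translation between the generators \<open>T\<close> and \<open>T + 1\<close>\<close>

lemma (in ring_congruence) com_add_left: "com x z \<Longrightarrow> com y z \<Longrightarrow> com (x + y) z"
  by (meson com_add com_sym)

lemma (in ring_congruence) com_diff_left: "com x z \<Longrightarrow> com y z \<Longrightarrow> com (x - y) z"
  by (meson com_diff com_sym)

text \<open>By the quadratic relation, \<open>(t + 1) (u + 1) (t + 1)\<close> is
  \<open>t u t\<close> plus terms symmetric in \<open>t\<close> and \<open>u\<close> plus
  \<open>\<alpha> (t + 1)\<close>. This is the origin of the subtracted terms in
  \<open>a_braid\<close>.\<close>

lemma (in algebra_congruence) hecke_datumI:
  assumes "\<alpha> \<noteq> 0"
    and x: "\<And>r s. r \<in> {1..d} \<Longrightarrow> s \<in> {1..d} \<Longrightarrow> com (x r) (x s)"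
    and x_T: "\<And>r. 1 \<le> r \<Longrightarrow> r < d \<Longrightarrow> x r * T r \<approx> T r * x (Suc r) - sc (\<alpha> - 1) * x (Suc r) - sc \<beta>"
    and T_x: "\<And>r s. 1 \<le> r \<Longrightarrow> r < d \<Longrightarrow> s \<in> {1..d} \<Longrightarrow> s \<noteq> r \<Longrightarrow> s \<noteq> Suc r \<Longrightarrow> com (T r) (x s)"
    and T_sq: "\<And>r. 1 \<le> r \<Longrightarrow> r < d \<Longrightarrow> T r * T r \<approx> sc (\<alpha> - 1) * T r + sc \<alpha>"
    and T_braid: "\<And>r. 1 \<le> r \<Longrightarrow> Suc r < d \<Longrightarrow> T r * T (Suc r) * T r \<approx> T (Suc r) * T r * T (Suc r)"
    and T_com: "\<And>r s. 1 \<le> r \<Longrightarrow> Suc r < s \<Longrightarrow> s < d \<Longrightarrow> com (T r) (T s)"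
    and g: "1 \<le> d \<Longrightarrow> pe g (x 1) \<approx> 0"
  shows "hecke_datum eq sc \<alpha> \<beta> g d x (\<lambda>r. T r + 1)"
proof unfold_locales
  fix r assume r: "1 \<le> r" "r < d"
  show "x r * (T r + 1) \<approx> (T r + 1) * x (Suc r) + (x r - sc \<alpha> * x (Suc r) - sc \<beta>)"
    using x_T[OF r] by (subst (asm) eq_iff_diff, subst eq_iff_diff) (simp add: sc_diff algebra_simps)
  show "(T r + 1) * (T r + 1) \<approx> sc (1 + \<alpha>) * (T r + 1)"
    using T_sq[OF r] by (subst (asm) eq_iff_diff, subst eq_iff_diff) (simp add: sc_diff sc_add algebra_simps)
  show "com (T r + 1) (x s)" if "s \<in> {1..d}" "s \<noteq> r" "s \<noteq> Suc r" for s
    using T_x[OF r that] by (simp add: com_add_left)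
next
  fix r assume r: "1 \<le> r" "Suc r < d"
  have *: "(t + 1) * (u + 1) * (t + 1) - sc \<alpha> * (t + 1)
      \<approx> t * u * t + (t * u + u * t) + t + u + 1" if "t * t \<approx> sc (\<alpha> - 1) * t + sc \<alpha>" for t u
  proof -
    have "(t + 1) * (u + 1) * (t + 1) - sc \<alpha> * (t + 1)
      = t * t + (t * u * t + t * u + u * t + (t + t) + u + 1 - sc \<alpha> * (t + 1))"
      by (simp add: algebra_simps)
    also have "\<dots> \<approx> (sc (\<alpha> - 1) * t + sc \<alpha>) + (t * u * t + t * u + u * t + (t + t) + u + 1 - sc \<alpha> * (t + 1))"
      by (intro eq_add that eq_refl)
    also have "\<dots> = t * u * t + (t * u + u * t) + t + u + 1"
      by (simp add: sc_diff algebra_simps)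
    finally show ?thesis .
  qed
  let ?t = "T r" and ?u = "T (Suc r)"
  have "(?t + 1) * (?u + 1) * (?t + 1) - sc \<alpha> * (?t + 1) \<approx> ?t * ?u * ?t + (?t * ?u + ?u * ?t) + ?t + ?u + 1"
    using r by (intro * T_sq) auto
  also have "\<dots> \<approx> ?u * ?t * ?u + (?t * ?u + ?u * ?t) + ?t + ?u + 1"
    using r by (intro eq_add T_braid eq_refl)
  also have "\<dots> = ?u * ?t * ?u + (?u * ?t + ?t * ?u) + ?u + ?t + 1"
    by (simp add: algebra_simps)
  also have "\<dots> \<approx> (?u + 1) * (?t + 1) * (?u + 1) - sc \<alpha> * (?u + 1)"
    using r by (intro eq_sym[OF *] T_sq) auto
  finally show "(?t + 1) * (?u + 1) * (?t + 1) - sc \<alpha> * (?t + 1)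
    \<approx> (?u + 1) * (?t + 1) * (?u + 1) - sc \<alpha> * (?u + 1)" .
next
  show "com (T r + 1) (T s + 1)" if "1 \<le> r" "Suc r < s" "s < d" for r s
    using T_com[OF that] by (simp add: com_add com_add_left)
qed (use assms in auto)

context hecke_datum
begin

definition T :: "nat \<Rightarrow> 'a" where "T r = a r - 1"

lemma T_sq:
  assumes "1 \<le> r" "r < d"
  shows "T r * T r \<approx> sc (\<alpha> - 1) * T r + sc \<alpha>"
  using a_sq[OF assms] unfolding T_def
  by (subst (asm) eq_iff_diff, subst eq_iff_diff) (simp add: sc_diff sc_add algebra_simps)

lemma x_T:
  assumes "1 \<le> r" "r < d"
  shows "x r * T r \<approx> T r * x (Suc r) - sc (\<alpha> - 1) * x (Suc r) - sc \<beta>"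
  using x_a[OF assms] unfolding T_def
  by (subst (asm) eq_iff_diff, subst eq_iff_diff) (simp add: sc_diff algebra_simps)

lemma T_x_com:
  "1 \<le> r \<Longrightarrow> r < d \<Longrightarrow> s \<in> {1..d} \<Longrightarrow> s \<noteq> r \<Longrightarrow> s \<noteq> Suc r \<Longrightarrow> com (T r) (x s)"
  unfolding T_def by (simp add: a_x_com com_diff_left)

lemma T_com:
  assumes "1 \<le> r" "r < d" "1 \<le> s" "s < d" "\<bar>int r - int s\<bar> > 1"
  shows "com (T r) (T s)"
proof -
  have "com (a r) (a s)"
    using assms a_com[of r s] a_com[of s r] by (cases "r < s") (auto intro: com_sym)
  then show ?thesis
    unfolding T_def by (simp add: com_diff com_diff_left)
qed

lemma T_braid:
  assumes r: "1 \<le> r" "Suc r < d"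
  shows "T r * T (Suc r) * T r \<approx> T (Suc r) * T r * T (Suc r)"
proof -
  have *: "(t - 1) * (u - 1) * (t - 1) \<approx> (t * u * t - sc \<alpha> * t) + (t + u - t * u - u * t - 1)"
    if "t * t \<approx> sc (1 + \<alpha>) * t" for t u
  proof -
    have "(t - 1) * (u - 1) * (t - 1) = - (t * t) + (t * u * t - t * u - u * t + (t + t) + u - 1)"
      by (simp add: algebra_simps)
    also have "\<dots> \<approx> - (sc (1 + \<alpha>) * t) + (t * u * t - t * u - u * t + (t + t) + u - 1)"
      by (intro eq_add eq_uminus that eq_refl)
    also have "\<dots> = (t * u * t - sc \<alpha> * t) + (t + u - t * u - u * t - 1)"
      by (simp add: sc_add algebra_simps)
    finally show ?thesis .
  qed
  let ?t = "a r" and ?u = "a (Suc r)"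
  have "T r * T (Suc r) * T r \<approx> (?t * ?u * ?t - sc \<alpha> * ?t) + (?t + ?u - ?t * ?u - ?u * ?t - 1)"
    unfolding T_def using r by (intro * a_sq) auto
  also have "\<dots> \<approx> (?u * ?t * ?u - sc \<alpha> * ?u) + (?t + ?u - ?t * ?u - ?u * ?t - 1)"
    using r by (intro eq_add a_braid eq_refl)
  also have "\<dots> = (?u * ?t * ?u - sc \<alpha> * ?u) + (?u + ?t - ?u * ?t - ?t * ?u - 1)"
    by (simp add: algebra_simps)
  also have "\<dots> \<approx> T (Suc r) * T r * T (Suc r)"
    unfolding T_def using r by (intro eq_sym[OF *] a_sq) auto
  finally show ?thesis .
qed

text \<open>For \<open>\<beta> = 0\<close> this is the relation \<open>T X T = q X\<close> of the
  affine Hecke algebra.\<close>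

lemma T_x_T:
  assumes "1 \<le> r" "r < d"
  shows "T r * x r * T r \<approx> sc \<alpha> * x (Suc r) - T r * sc \<beta>"
proof -
  have "T r * x r * T r \<approx> T r * (T r * x (Suc r) - sc (\<alpha> - 1) * x (Suc r) - sc \<beta>)"
    unfolding mult.assoc by (intro eq_mult_left x_T assms)
  also have "\<dots> = (T r * T r) * x (Suc r) - sc (\<alpha> - 1) * T r * x (Suc r) - T r * sc \<beta>"
    unfolding sc_commute[of _ "T r"] by (simp add: algebra_simps)
  also have "\<dots> \<approx> (sc (\<alpha> - 1) * T r + sc \<alpha>) * x (Suc r) - sc (\<alpha> - 1) * T r * x (Suc r) - T r * sc \<beta>"
    by (intro eq_diff eq_mult_right T_sq assms eq_refl)
  also have "\<dots> = sc \<alpha> * x (Suc r) - T r * sc \<beta>"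
    by (simp add: algebra_simps)
  finally show ?thesis .
qed

end

section \<open>Images of the generators and verification of the relations\<close>

definition hecke_images :: "nat \<Rightarrow> (nat \<Rightarrow> 'b::zero) \<Rightarrow> (nat \<Rightarrow> 'b) \<Rightarrow> (nat \<Rightarrow> 'b) \<Rightarrow> hecke_gen \<Rightarrow> 'b"
  where "hecke_images d T X Y g = (case g of
      T_gen r \<Rightarrow> if r \<in> {1..<d} then T r else 0
    | X_gen r \<Rightarrow> if r \<in> {1..d} then X r else 0
    | Xinv_gen r \<Rightarrow> if r \<in> {1..d} then Y r else 0)"

definition degen_images :: "nat \<Rightarrow> (nat \<Rightarrow> 'b::zero) \<Rightarrow> (nat \<Rightarrow> 'b) \<Rightarrow> degen_gen \<Rightarrow> 'b"
  where "degen_images d s x g = (case g of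
      s_gen r \<Rightarrow> if r \<in> {1..<d} then s r else 0
    | x_gen r \<Rightarrow> if r \<in> {1..d} then x r else 0)"

lemma hecke_gens_iff [simp]:
  "T_gen r \<in> hecke_gens d \<longleftrightarrow> r \<in> {1..<d}" "X_gen r \<in> hecke_gens d \<longleftrightarrow> r \<in> {1..d}"
  "Xinv_gen r \<in> hecke_gens d \<longleftrightarrow> r \<in> {1..d}"
  by (auto simp: hecke_gens_def)

lemma degen_gens_iff [simp]:
  "s_gen r \<in> degen_gens d \<longleftrightarrow> r \<in> {1..<d}" "x_gen r \<in> degen_gens d \<longleftrightarrow> r \<in> {1..d}"
  by (auto simp: degen_gens_def)

lemma hecke_relations_closed:
  assumes "(l, r) \<in> hecke_relations d q"
  shows "l - r \<in> carrier (free_algebra (hecke_gens d))"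
  using assms unfolding hecke_relations_def
  by (elim UnE CollectE exE conjE) (auto intro!: free_algebra_closed)

lemma degen_relations_closed:
  assumes "(l, r) \<in> degen_relations d"
  shows "l - r \<in> carrier (free_algebra (degen_gens d))"
  using assms unfolding degen_relations_def
  by (elim UnE CollectE exE conjE) (auto intro!: free_algebra_closed)

context algebra_congruence
begin

text \<open>\<open>exact\<close> makes the lift an honest homomorphism on the ambient ring; only the
  relations are tested modulo the congruence. The second condition on \<open>Y\<close> supplies the
  commutations among all letters \<open>X\<close> and their inverses.\<close>

lemma hecke_images_relations:
  assumes "hecke_datum eq sc q 0 g d X b" and exact: "algebra_congruence (=) sc"
    and Y: "\<And>r. r \<in> {1..d} \<Longrightarrow> X r * Y r \<approx> 1" "\<And>r z. com z (X r) \<Longrightarrow> com z (Y r)"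
    and z: "z \<in> cyclotomic_gens (hecke_gens d) (hecke_relations d q) d g (X_gen 1)"
  shows "lift sc (hecke_images d (\<lambda>r. b r - 1) X Y) z \<approx> 0"
proof -
  interpret H: hecke_datum eq sc q 0 g d X b by fact
  interpret L: free_lift sc "hecke_images d (\<lambda>r. b r - 1) X Y"
    using exact by (simp add: free_lift_def)
  have T: "L.\<phi> (Th r) = H.T r" if "r \<in> {1..<d}" for r
    using that by (simp add: hecke_images_def H.T_def)
  have XY: "L.\<phi> (Xh r) = X r" "L.\<phi> (Xhinv r) = Y r" if "r \<in> {1..d}" for r
    using that by (simp_all add: hecke_images_def)
  \<comment> \<open>The value 0 outside the index ranges matches the letters that
    \<open>cyclotomic_gens\<close> kills.\<close>
  have out: "L.\<phi> (gen g) = 0" if "g \<notin> hecke_gens d" for g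
    using that by (cases g) (auto simp: hecke_images_def)
  have comXY: "com u v" if "u \<in> X ` {1..d} \<union> Y ` {1..d}" "v \<in> X ` {1..d} \<union> Y ` {1..d}" for u v
  proof -
    have "com (X r) v" if "r \<in> {1..d}" "v \<in> X ` {1..d} \<union> Y ` {1..d}" for r v
      using that H.x_com Y(2) by auto
    then have "com v (X r)" "com v (Y r)" if "r \<in> {1..d}" "v \<in> X ` {1..d} \<union> Y ` {1..d}" for r v
      using that Y(2) com_sym by blast+
    then show ?thesis using that by auto
  qed
  define XX :: "(hecke_gen fword \<Rightarrow>\<^sub>0 'f) set" where "XX = Xh ` {1..d} \<union> Xhinv ` {1..d}"
  consider g where "z = gen g" "g \<notin> hecke_gens d"
    | l r where "z = l - r" "(l, r) \<in> hecke_relations d q"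
    | "d > 0" "z = poly_eval scalar (Xh 1) g"
    using z by (auto simp: cyclotomic_gens_def split: if_splits)
  then show ?thesis
  proof cases
    case 1
    then show ?thesis by (simp add: out del: L.lift_gen)
  next
    case 3
    then show ?thesis
      using H.cyclotomic by (simp add: L.lift_pe XY del: L.lift_gen)
  next
    case (2 l r)
    have "L.\<phi> l \<approx> L.\<phi> r"
      using 2(2) unfolding hecke_relations_def XX_def[symmetric]
    proof (elim UnE CollectE exE conjE; (unfold prod.inject)?; (elim conjE)?; hypsubst?)
      fix u v :: "hecke_gen fword \<Rightarrow>\<^sub>0 'f"
      assume "u \<in> XX" "v \<in> XX"
      then have "com (L.\<phi> u) (L.\<phi> v)"
        using XY by (intro comXY) (force simp: XX_def)+
      then show "L.\<phi> (u * v) \<approx> L.\<phi> (v * u)"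
        by (simp add: com_def L.lift_mult)
    next
      fix r assume "r \<in> {1..d}"
      then show "L.\<phi> (Xh r * Xhinv r) \<approx> L.\<phi> 1"
        using Y(1) by (simp add: L.lift_simps XY del: L.lift_gen)
    next
      fix r assume "r \<in> {1..<d}"
      then show "L.\<phi> (Th r * Xh r * Th r) \<approx> L.\<phi> (scalar q * Xh (r + 1))"
        using H.T_x_T[of r] by (simp add: L.lift_simps XY T del: L.lift_gen)
    next
      fix r s assume "r \<in> {1..<d}" "s \<in> {1..d}" "s \<noteq> r" "s \<noteq> r + 1"
      then show "L.\<phi> (Th r * Xh s) \<approx> L.\<phi> (Xh s * Th r)"
        using H.T_x_com[of r s] by (simp add: L.lift_simps XY T com_def del: L.lift_gen)
    next
      fix r assume "r \<in> {1..<d}"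
      then show "L.\<phi> (Th r * Th r) \<approx> L.\<phi> (scalar (q - 1) * Th r + scalar q)"
        using H.T_sq[of r] by (simp add: L.lift_simps T del: L.lift_gen)
    next
      fix r assume "r \<in> {1..<d}" "r + 1 \<in> {1..<d}"
      then show "L.\<phi> (Th r * Th (r + 1) * Th r) \<approx> L.\<phi> (Th (r + 1) * Th r * Th (r + 1))"
        using H.T_braid[of r] by (simp add: L.lift_simps T del: L.lift_gen)
    next
      fix r s assume "r \<in> {1..<d}" "s \<in> {1..<d}" "1 < \<bar>int r - int s\<bar>"
      then show "L.\<phi> (Th r * Th s) \<approx> L.\<phi> (Th s * Th r)"
        using H.T_com[of r s] by (simp add: L.lift_simps T com_def del: L.lift_gen)
    qed
    then show ?thesis
      unfolding 2(1) by (subst (asm) eq_iff_diff) (simp add: L.lift_simps)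
  qed
qed

lemma degen_images_relations:
  assumes "hecke_datum eq sc 1 1 g d x a" and exact: "algebra_congruence (=) sc"
    and z: "z \<in> cyclotomic_gens (degen_gens d) (degen_relations d) d g (x_gen 1)"
  shows "lift sc (degen_images d (\<lambda>r. a r - 1) x) z \<approx> 0"
proof -
  interpret H: hecke_datum eq sc 1 1 g d x a by fact
  interpret L: free_lift sc "degen_images d (\<lambda>r. a r - 1) x"
    using exact by (simp add: free_lift_def)
  have T: "L.\<phi> (sd r) = H.T r" if "r \<in> {1..<d}" for r
    using that by (simp add: degen_images_def H.T_def)
  have X: "L.\<phi> (xd r) = x r" if "r \<in> {1..d}" for r
    using that by (simp_all add: degen_images_def)
  have out: "L.\<phi> (gen g) = 0" if "g \<notin> degen_gens d" for g
    using that by (cases g) (auto simp: degen_images_def)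
  consider g where "z = gen g" "g \<notin> degen_gens d"
    | l r where "z = l - r" "(l, r) \<in> degen_relations d"
    | "d > 0" "z = poly_eval scalar (xd 1) g"
    using z by (auto simp: cyclotomic_gens_def split: if_splits)
  then show ?thesis
  proof cases
    case 1
    then show ?thesis by (simp add: out del: L.lift_gen)
  next
    case 3
    then show ?thesis
      using H.cyclotomic by (simp add: L.lift_pe X del: L.lift_gen)
  next
    case (2 l r)
    have "L.\<phi> l \<approx> L.\<phi> r"
      using 2(2) unfolding degen_relations_def
    proof (elim UnE CollectE exE conjE; (unfold prod.inject)?; (elim conjE)?; hypsubst?)
      fix r s assume "r \<in> {1..d}" "s \<in> {1..d}"
      then show "L.\<phi> (xd r * xd s) \<approx> L.\<phi> (xd s * xd r)"
        using H.x_com[of r s] by (simp add: L.lift_simps X com_def del: L.lift_gen)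
    next
      fix r assume r: "r \<in> {1..<d}"
      have "x r * H.T r + 1 \<approx> H.T r * x (Suc r)"
        using eq_add[OF H.x_T[of r] eq_refl[of 1]] r by simp
      with r show "L.\<phi> (sd r * xd (r + 1)) \<approx> L.\<phi> (xd r * sd r + 1)"
        by (simp add: L.lift_simps X T eq_sym del: L.lift_gen)
    next
      fix r s assume "r \<in> {1..<d}" "s \<in> {1..d}" "s \<noteq> r" "s \<noteq> r + 1"
      then show "L.\<phi> (sd r * xd s) \<approx> L.\<phi> (xd s * sd r)"
        using H.T_x_com[of r s] by (simp add: L.lift_simps X T com_def del: L.lift_gen)
    next
      fix r assume "r \<in> {1..<d}"
      then show "L.\<phi> (sd r * sd r) \<approx> L.\<phi> 1"
        using H.T_sq[of r] by (simp add: L.lift_simps T del: L.lift_gen)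
    next
      fix r assume "r \<in> {1..<d}" "r + 1 \<in> {1..<d}"
      then show "L.\<phi> (sd r * sd (r + 1) * sd r) \<approx> L.\<phi> (sd (r + 1) * sd r * sd (r + 1))"
        using H.T_braid[of r] by (simp add: L.lift_simps T del: L.lift_gen)
    next
      fix r s assume "r \<in> {1..<d}" "s \<in> {1..<d}" "1 < \<bar>int r - int s\<bar>"
      then show "L.\<phi> (sd r * sd s) \<approx> L.\<phi> (sd s * sd r)"
        using H.T_com[of r s] by (simp add: L.lift_simps T com_def del: L.lift_gen)
    qed
    then show ?thesis
      unfolding 2(1) by (subst (asm) eq_iff_diff) (simp add: L.lift_simps)
  qed
qed

end

context algebra_congruence
begin

text \<open>By the quadratic relation \<open>t - (q - 1)\<close> is \<open>q\<close> times the
  inverse of \<open>t\<close>; multiplying \<open>t x t = q y\<close> by it on the left solves for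
  \<open>x t\<close>.\<close>

lemma x_T_if_T_x_T:
  assumes q: "q \<noteq> 0" and T: "t * t \<approx> sc (q - 1) * t + sc q" and TxT: "t * x * t \<approx> sc q * y"
  shows "x * t \<approx> t * y - sc (q - 1) * y"
proof -
  have inv: "(t - sc (q - 1)) * t \<approx> sc q"
    using T by (subst (asm) eq_iff_diff, subst eq_iff_diff) (simp add: algebra_simps)
  have "sc q * (x * t) \<approx> ((t - sc (q - 1)) * t) * (x * t)"
    by (intro eq_mult_right eq_sym[OF inv])
  also have "\<dots> = (t - sc (q - 1)) * (t * x * t)"
    by (simp add: mult.assoc)
  also have "\<dots> \<approx> (t - sc (q - 1)) * (sc q * y)"
    by (rule eq_mult_left[OF TxT])
  also have "\<dots> = sc q * (t * y - sc (q - 1) * y)"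
  proof -
    have "z * (sc q * y) = sc q * (z * y)" for z
      by (metis mult.assoc sc_commute)
    then show ?thesis
      by (simp add: left_diff_distrib)
  qed
  finally have "sc (inverse q) * (sc q * (x * t)) \<approx> sc (inverse q) * (sc q * (t * y - sc (q - 1) * y))"
    by (rule eq_mult_left)
  then show ?thesis
    using q by (simp flip: mult.assoc sc_mult)
qed

text \<open>Writing the polynomial as \<open>x\<close> times \<open>synthetic_div p 0\<close> plus
  \<open>p(0)\<close>, its vanishing at \<open>z\<close> displays an inverse of \<open>z\<close>
  that is itself a polynomial in \<open>z\<close>.\<close>

lemma inverse_if_annihilated:
  assumes "pe p z \<approx> 0" "poly p 0 \<noteq> 0"
  shows "z * pe (smult (- inverse (poly p 0)) (synthetic_div p 0)) z \<approx> 1"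
proof -
  have "p = [:0, 1:] * synthetic_div p 0 + [:poly p 0:]"
    using synthetic_div_correct'[of 0 p] by simp
  then have 1: "pe p z = pe ([:0, 1:] * synthetic_div p 0) z + sc (poly p 0)"
    by (metis (no_types, lifting) poly_eval_0 poly_eval_pCons mult_zero_right pe_add sc_0 add_0_right)
  have 2: "pe ([:0, 1:] * synthetic_div p 0) z \<approx> z * pe (synthetic_div p 0) z"
    by (rule eq_trans[OF pe_mult]) simp
  have "z * pe (synthetic_div p 0) z + sc (poly p 0) \<approx> 0"
    by (rule eq_trans[OF eq_add[OF eq_sym[OF 2] eq_refl]]) (use assms(1) 1 in simp)
  then have "sc (- inverse (poly p 0)) * (z * pe (synthetic_div p 0) z + sc (poly p 0)) \<approx> 0"
    by (rule eq_0_mult_left)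
  then have "sc (- inverse (poly p 0)) * (z * pe (synthetic_div p 0) z) - 1 \<approx> 0"
    using assms(2) by (simp add: distrib_left flip: sc_mult) (simp add: sc_minus)
  moreover have "sc c * (z * u) = z * (sc c * u)" for c u
    by (metis mult.assoc sc_commute)
  ultimately show ?thesis
    by (subst eq_iff_diff) (simp only: pe_smult)
qed

end

section \<open>The presented algebras as instances of the common relations\<close>

lemma presented_relation:
  assumes "(l, r) \<in> R"
  shows "l - r \<in> generated_ideal (cyclotomic_gens G R d f g)"
  using assms generated_ideal_superset by (force simp: cyclotomic_gens_def)

lemma hecke_relationsI:
  "r \<in> {1..d} \<Longrightarrow> s \<in> {1..d} \<Longrightarrow> (Xh r * Xh s, Xh s * Xh r) \<in> hecke_relations d q"
  "r \<in> {1..d} \<Longrightarrow> s \<in> {1..d} \<Longrightarrow> (Xh r * Xhinv s, Xhinv s * Xh r) \<in> hecke_relations d q"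
  "r \<in> {1..d} \<Longrightarrow> (Xh r * Xhinv r, 1) \<in> hecke_relations d q"
  "r \<in> {1..<d} \<Longrightarrow> (Th r * Xh r * Th r, scalar q * Xh (r + 1)) \<in> hecke_relations d q"
  "r \<in> {1..<d} \<Longrightarrow> s \<in> {1..d} \<Longrightarrow> s \<noteq> r \<Longrightarrow> s \<noteq> r + 1 \<Longrightarrow>
    (Th r * Xh s, Xh s * Th r) \<in> hecke_relations d q"
  "r \<in> {1..<d} \<Longrightarrow> (Th r * Th r, scalar (q - 1) * Th r + scalar q) \<in> hecke_relations d q"
  "r \<in> {1..<d} \<Longrightarrow> r + 1 \<in> {1..<d} \<Longrightarrow>
    (Th r * Th (r + 1) * Th r, Th (r + 1) * Th r * Th (r + 1)) \<in> hecke_relations d q"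
  "r \<in> {1..<d} \<Longrightarrow> s \<in> {1..<d} \<Longrightarrow> \<bar>int r - int s\<bar> > 1 \<Longrightarrow>
    (Th r * Th s, Th s * Th r) \<in> hecke_relations d q"
  unfolding hecke_relations_def
  subgoal by (rule UnI1, rule UnI1, rule UnI1, rule UnI1, rule UnI1, rule UnI1, rule CollectI, intro exI conjI, rule refl; blast)
  subgoal by (rule UnI1, rule UnI1, rule UnI1, rule UnI1, rule UnI1, rule UnI1, rule CollectI, intro exI conjI, rule refl; blast)
  subgoal by (rule UnI1, rule UnI1, rule UnI1, rule UnI1, rule UnI1, rule UnI2, rule CollectI, intro exI conjI, rule refl; blast)
  subgoal by (rule UnI1, rule UnI1, rule UnI1, rule UnI1, rule UnI2, rule CollectI, intro exI conjI, rule refl; blast)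
  subgoal by (rule UnI1, rule UnI1, rule UnI1, rule UnI2, rule CollectI, intro exI conjI, rule refl; blast)
  subgoal by (rule UnI1, rule UnI1, rule UnI2, rule CollectI, intro exI conjI, rule refl; blast)
  subgoal by (rule UnI1, rule UnI2, rule CollectI, intro exI conjI, rule refl; blast)
  subgoal by (rule UnI2, rule CollectI, intro exI conjI, rule refl; blast)
  done

lemma degen_relationsI:
  "r \<in> {1..d} \<Longrightarrow> s \<in> {1..d} \<Longrightarrow> (xd r * xd s, xd s * xd r) \<in> degen_relations d"
  "r \<in> {1..<d} \<Longrightarrow> (sd r * xd (r + 1), xd r * sd r + 1) \<in> degen_relations d"
  "r \<in> {1..<d} \<Longrightarrow> s \<in> {1..d} \<Longrightarrow> s \<noteq> r \<Longrightarrow> s \<noteq> r + 1 \<Longrightarrow>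
    (sd r * xd s, xd s * sd r) \<in> degen_relations d"
  "r \<in> {1..<d} \<Longrightarrow> (sd r * sd r, 1) \<in> degen_relations d"
  "r \<in> {1..<d} \<Longrightarrow> r + 1 \<in> {1..<d} \<Longrightarrow>
    (sd r * sd (r + 1) * sd r, sd (r + 1) * sd r * sd (r + 1)) \<in> degen_relations d"
  "r \<in> {1..<d} \<Longrightarrow> s \<in> {1..<d} \<Longrightarrow> \<bar>int r - int s\<bar> > 1 \<Longrightarrow>
    (sd r * sd s, sd s * sd r) \<in> degen_relations d"
  unfolding degen_relations_def
  subgoal by (rule UnI1, rule UnI1, rule UnI1, rule UnI1, rule UnI1, rule CollectI, intro exI conjI, rule refl; blast)
  subgoal by (rule UnI1, rule UnI1, rule UnI1, rule UnI1, rule UnI2, rule CollectI, intro exI conjI, rule refl; blast)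
  subgoal by (rule UnI1, rule UnI1, rule UnI1, rule UnI2, rule CollectI, intro exI conjI, rule refl; blast)
  subgoal by (rule UnI1, rule UnI1, rule UnI2, rule CollectI, intro exI conjI, rule refl; blast)
  subgoal by (rule UnI1, rule UnI2, rule CollectI, intro exI conjI, rule refl; blast)
  subgoal by (rule UnI2, rule CollectI, intro exI conjI, rule refl; blast)
  done

lemma hecke_datum_presented:
  fixes q :: "'f::field" and g :: "'f poly" and d :: nat
  assumes "q \<noteq> 0"
  defines "K \<equiv> generated_ideal (cyclotomic_gens (hecke_gens d) (hecke_relations d q) d g (X_gen 1))"
  shows "hecke_datum (\<lambda>x y. x - y \<in> K) scalar q 0 g d Xh (\<lambda>r. Th r + 1)"
    and "r \<in> {1..d} \<Longrightarrow> Xh r * Xhinv r - 1 \<in> K"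
    and "r \<in> {1..d} \<Longrightarrow> Xh r * Xhinv r - Xhinv r * Xh r \<in> K"
proof -
  interpret C: algebra_congruence "\<lambda>x y. x - y \<in> K" "scalar :: 'f \<Rightarrow> (hecke_gen fword \<Rightarrow>\<^sub>0 'f)"
    unfolding K_def by (intro algebra_congruence_ideal ideal_generated)
  have rel: "l - r \<in> K" if "(l, r) \<in> hecke_relations d q" for l r
    unfolding K_def using that by (rule presented_relation)
  show "Xh r * Xhinv r - 1 \<in> K" "Xh r * Xhinv r - Xhinv r * Xh r \<in> K" if "r \<in> {1..d}" for r
    using that by (intro rel hecke_relationsI; simp)+
  have T_sq: "Th r * Th r - (scalar (q - 1) * Th r + scalar q) \<in> K" if "r \<in> {1..<d}" for r
    using that by (intro rel hecke_relationsI) auto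
  have TXT: "Th r * Xh r * Th r - scalar q * Xh (r + 1) \<in> K" if "r \<in> {1..<d}" for r
    using that by (intro rel hecke_relationsI) auto
  show "hecke_datum (\<lambda>x y. x - y \<in> K) scalar q 0 g d Xh (\<lambda>r. Th r + 1)"
  proof (rule C.hecke_datumI[OF \<open>q \<noteq> 0\<close>])
    show "C.com (Xh r) (Xh s)" if "r \<in> {1..d}" "s \<in> {1..d}" for r s
      unfolding C.com_def using that by (intro rel hecke_relationsI) auto
    show "Xh r * Th r - (Th r * Xh (Suc r) - scalar (q - 1) * Xh (Suc r) - scalar 0) \<in> K"
      if "1 \<le> r" "r < d" for r
      using C.x_T_if_T_x_T[OF \<open>q \<noteq> 0\<close> T_sq TXT, of r] that by (simp add: scalar_simps)
    show "C.com (Th r) (Xh s)" if "1 \<le> r" "r < d" "s \<in> {1..d}" "s \<noteq> r" "s \<noteq> Suc r" for r s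
      unfolding C.com_def using that by (intro rel hecke_relationsI) auto
    show "Th r * Th r - (scalar (q - 1) * Th r + scalar q) \<in> K" if "1 \<le> r" "r < d" for r
      using that by (intro T_sq) auto
    show "Th r * Th (Suc r) * Th r - Th (Suc r) * Th r * Th (Suc r) \<in> K" if "1 \<le> r" "Suc r < d" for r
      using that rel[OF hecke_relationsI(7)[of r]] by simp
    show "C.com (Th r) (Th s)" if "1 \<le> r" "Suc r < s" "s < d" for r s
      unfolding C.com_def using that by (intro rel hecke_relationsI) auto
    show "C.pe g (Xh 1) - 0 \<in> K" if "1 \<le> d"
      unfolding K_def using that generated_ideal_superset by (force simp: cyclotomic_gens_def)
  qed
qed

lemma degen_datum_presented:
  fixes g :: "'f::field poly" and d :: nat
  defines "K \<equiv> generated_ideal (cyclotomic_gens (degen_gens d) (degen_relations d) d g (x_gen 1))"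
  shows "hecke_datum (\<lambda>x y. x - y \<in> K) scalar 1 1 g d xd (\<lambda>r. sd r + 1)"
proof -
  interpret C: algebra_congruence "\<lambda>x y. x - y \<in> K" "scalar :: 'f \<Rightarrow> (degen_gen fword \<Rightarrow>\<^sub>0 'f)"
    unfolding K_def by (intro algebra_congruence_ideal ideal_generated)
  have rel: "l - r \<in> K" if "(l, r) \<in> degen_relations d" for l r
    unfolding K_def using that by (rule presented_relation)
  show ?thesis
  proof (rule C.hecke_datumI)
    show "C.com (xd r) (xd s)" if "r \<in> {1..d}" "s \<in> {1..d}" for r s
      unfolding C.com_def using that by (intro rel degen_relationsI) auto
    show "xd r * sd r - (sd r * xd (Suc r) - scalar (1 - 1) * xd (Suc r) - scalar 1) \<in> K"
      if "1 \<le> r" "r < d" for r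
    proof -
      have "sd r * xd (r + 1) - (xd r * sd r + 1) \<in> K"
        using that by (intro rel degen_relationsI) auto
      from C.eq_sym[OF this] show ?thesis
        by (simp add: scalar_simps algebra_simps)
    qed
    show "C.com (sd r) (xd s)" if "1 \<le> r" "r < d" "s \<in> {1..d}" "s \<noteq> r" "s \<noteq> Suc r" for r s
      unfolding C.com_def using that by (intro rel degen_relationsI) auto
    show "sd r * sd r - (scalar (1 - 1) * sd r + scalar 1) \<in> K" if "1 \<le> r" "r < d" for r
    proof -
      have "sd r * sd r - 1 \<in> K"
        using that by (intro rel degen_relationsI) auto
      then show ?thesis by (simp add: scalar_simps)
    qed
    show "sd r * sd (Suc r) * sd r - sd (Suc r) * sd r * sd (Suc r) \<in> K" if "1 \<le> r" "Suc r < d" for r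
      using that rel[OF degen_relationsI(5)[of r]] by simp
    show "C.com (sd r) (sd s)" if "1 \<le> r" "Suc r < s" "s < d" for r s
      unfolding C.com_def using that by (intro rel degen_relationsI) auto
    show "C.pe g (xd 1) - 0 \<in> K" if "1 \<le> d"
      unfolding K_def using that generated_ideal_superset by (force simp: cyclotomic_gens_def)
  qed simp
qed

lemma affine_orbit_powi:
  fixes q :: "'f::field"
  assumes "q \<noteq> 0" "\<And>n::nat. n > 0 \<Longrightarrow> q ^ n \<noteq> 1"
  shows "affine_orbit q 0 (\<lambda>i. q powi i)"
proof
  show "q powi (i + 1) = q * q powi i + 0" for i
    using assms(1) by (simp add: power_int_add)
  have "i = j" if "i \<le> j" "q powi i = q powi j" for i j
  proof -
    have "q powi j = q powi i * q ^ nat (j - i)"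
      using assms(1) that(1) power_int_add[of q i "j - i"] by (simp add: power_int_def)
    then have "q ^ nat (j - i) = 1"
      using that(2) assms(1) by simp
    then show ?thesis
      using assms(2)[of "nat (j - i)"] that(1) by force
  qed
  then show "inj (\<lambda>i. q powi i)"
    by (intro injI) (metis linorder_le_cases)
qed (use assms in auto)

lemma affine_orbit_of_int: "affine_orbit 1 1 (of_int :: int \<Rightarrow> 'f::field_char_0)"
  by unfold_locales (auto intro: injI)

theorem corollary2:
  fixes q :: "'f::field_char_0"
    and \<Lambda> :: "int \<Rightarrow>\<^sub>0 nat"
    and d :: nat
  assumes "q \<noteq> 0"
    and "\<And>n::nat. n > 0 \<Longrightarrow> q ^ n \<noteq> 1"
  shows "algebra_isomorphic (cyclotomic_hecke d q \<Lambda>)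
           (degen_cyclotomic_hecke d \<Lambda> :: ('f, (degen_gen fword \<Rightarrow>\<^sub>0 'f) set set) module)"
proof -
  define e where "e = (\<lambda>i. q powi i)"
  have e: "affine_orbit q 0 e"
    unfolding e_def by (rule affine_orbit_powi[OF assms])
  define p where "p = annihilating_poly e \<Lambda> d"
  \<comment> \<open>All roots of \<open>p\<close> are powers of \<open>q\<close>, hence nonzero;
    this provides the inverses of the elements annihilated by \<open>p\<close>.\<close>
  have p: "poly p 0 \<noteq> 0"
    using assms(1) by (simp add: p_def annihilating_poly_def orbit_poly_def poly_prod e_def)
  obtain E L where EL: "coordinate_pair 1 1 of_int q 0 e \<Lambda> d E L"
    and LE: "coordinate_pair q 0 e 1 1 of_int \<Lambda> d L E"
    using coordinate_pair_exists[OF affine_orbit_of_int e] .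
  define K where "K = generated_ideal (cyclotomic_gens (hecke_gens d) (hecke_relations d q) d
    (weight_poly e \<Lambda>) (X_gen 1))"
  define K' where "K' = generated_ideal (cyclotomic_gens (degen_gens d) (degen_relations d) d
    (weight_poly of_int \<Lambda>) (x_gen 1) :: (degen_gen fword \<Rightarrow>\<^sub>0 'f) set)"
  have ideal: "two_sided_ideal K" "two_sided_ideal K'"
    by (simp_all add: K_def K'_def ideal_generated)
  interpret H: algebra_congruence "\<lambda>x y. x - y \<in> K" "scalar :: 'f \<Rightarrow> _"
    by (rule algebra_congruence_ideal[OF ideal(1)])
  interpret D: algebra_congruence "\<lambda>x y. x - y \<in> K'" "scalar :: 'f \<Rightarrow> _"
    by (rule algebra_congruence_ideal[OF ideal(2)])

  have "\<exists>\<pi>. algebra_epi (cyclotomic_hecke d q \<Lambda>) scalar \<pi> \<and> (\<forall>z w. \<pi> z = \<pi> w \<longleftrightarrow> z - w \<in> K)"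
    unfolding cyclotomic_hecke_def affine_hecke_def e_def[symmetric] K_def
    by (rule cyclotomic_presentation[of "hecke_relations d q" "hecke_gens d" d "X_gen 1" e \<Lambda>],
        erule hecke_relations_closed, simp)
  then obtain \<pi> where \<pi>: "algebra_epi (cyclotomic_hecke d q \<Lambda>) scalar \<pi>"
    "\<And>z w. \<pi> z = \<pi> w \<longleftrightarrow> z - w \<in> K"
    by blast
  have "\<exists>\<pi>. algebra_epi (degen_cyclotomic_hecke d \<Lambda>) scalar \<pi> \<and> (\<forall>z w. \<pi> z = \<pi> w \<longleftrightarrow> z - w \<in> K')"
    unfolding degen_cyclotomic_hecke_def degen_affine_hecke_def K'_def
    by (rule cyclotomic_presentation[of "degen_relations d" "degen_gens d" d "x_gen 1" of_int \<Lambda>],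
        erule degen_relations_closed, simp)
  then obtain \<pi>' :: "_ \<Rightarrow> (degen_gen fword \<Rightarrow>\<^sub>0 'f) set set"
    where \<pi>': "algebra_epi (degen_cyclotomic_hecke d \<Lambda>) scalar \<pi>'" "\<And>z w. \<pi>' z = \<pi>' w \<longleftrightarrow> z - w \<in> K'"
    by blast

  define X b where "X = (\<lambda>r. poly_eval scalar (xd r) E :: degen_gen fword \<Rightarrow>\<^sub>0 'f)"
    and "b = (\<lambda>r. (sd r + 1) * D.twist_factor 1 1 E L (xd r) (xd (Suc r)))"
  \<comment> \<open>The image of the inverse letter is taken as a polynomial in \<open>X r\<close>,
    so that it commutes with whatever \<open>X r\<close> commutes with and any lift evaluates it as
    the same polynomial.\<close>
  define Y where "Y r = D.pe (smult (- inverse (poly p 0)) (synthetic_div p 0)) (X r)" for r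
  define x a where "x = (\<lambda>r. poly_eval scalar (Xh r) L :: hecke_gen fword \<Rightarrow>\<^sub>0 'f)"
    and "a = (\<lambda>r. (Th r + 1) * H.twist_factor q 0 L E (Xh r) (Xh (Suc r)))"
  note datum = hecke_datum_presented[OF assms(1), where d = d and g = "weight_poly e \<Lambda>", folded K_def]
  note datum' = degen_datum_presented[where d = d and g = "weight_poly of_int \<Lambda> :: 'f poly", folded K'_def]
  \<comment> \<open>Each change is made inside the opposite algebra: \<open>Xb\<close> finds
    generators \<open>X\<close>, \<open>b\<close> satisfying the relations at \<open>q\<close> in
    the degenerate algebra, and \<open>xa\<close> finds degenerate ones in the algebra at
    \<open>q\<close>.\<close>
  note Xb = hecke_datum_transfer[OF affine_orbit_of_int e datum' EL X_def b_def]
  note xa = hecke_datum_transfer[OF e affine_orbit_of_int datum(1) LE x_def a_def]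
  have Y: "X r * Y r - 1 \<in> K'" if "r \<in> {1..d}" for r
    unfolding Y_def
    using D.inverse_if_annihilated[OF hecke_datum_annihilating_poly[OF e Xb(1) that, folded p_def] p] .
  have Y_com: "D.com z (Y r)" if "D.com z (X r)" for z r
    unfolding Y_def by (rule D.pe_com[OF that])
  \<comment> \<open>Uniqueness of inverses modulo \<open>K\<close>: both elements invert
    \<open>Xh r\<close>.\<close>
  have Xinv: "H.pe (smult (- inverse (poly p 0)) (synthetic_div p 0)) (Xh r) - Xhinv r \<in> K"
    if "r \<in> {1..d}" for r
  proof -
    let ?y = "H.pe (smult (- inverse (poly p 0)) (synthetic_div p 0)) (Xh r)"
    have 1: "Xh r * ?y - 1 \<in> K"
      using H.inverse_if_annihilated[OF hecke_datum_annihilating_poly[OF e datum(1) that, folded p_def] p] .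
    have 2: "Xhinv r * Xh r - 1 \<in> K"
      using H.eq_trans[OF H.eq_sym[OF datum(3)[OF that]] datum(2)[OF that]] .
    have "1 * ?y - (Xhinv r * Xh r) * ?y \<in> K"
      by (rule H.eq_mult_right[OF H.eq_sym[OF 2]])
    moreover have "Xhinv r * (Xh r * ?y) - Xhinv r * 1 \<in> K"
      by (rule H.eq_mult_left[OF 1])
    ultimately show ?thesis
      using H.eq_trans by (simp add: mult.assoc)
  qed

  interpret \<phi>: free_lift scalar "hecke_images d (\<lambda>r. b r - 1) X Y" ..
  interpret \<psi>: free_lift scalar "degen_images d (\<lambda>r. a r - 1) x" ..
  have \<phi>_rel: "\<phi>.\<phi> z \<in> K'" if "z \<in> K" for z
  proof (rule \<phi>.lift_generated_ideal[OF ideal(2) _ that[unfolded K_def]])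
    show "\<phi>.\<phi> s \<in> K'" if "s \<in> cyclotomic_gens (hecke_gens d) (hecke_relations d q) d (weight_poly e \<Lambda>) (X_gen 1)" for s
      using D.hecke_images_relations[OF Xb(1) F.algebra_congruence_axioms Y Y_com that] by simp
  qed
  have \<psi>_rel: "\<psi>.\<phi> z \<in> K" if "z \<in> K'" for z
  proof (rule \<psi>.lift_generated_ideal[OF ideal(1) _ that[unfolded K'_def]])
    show "\<psi>.\<phi> s \<in> K" if "s \<in> cyclotomic_gens (degen_gens d) (degen_relations d) d (weight_poly of_int \<Lambda>) (x_gen 1)" for s
      using H.degen_images_relations[OF xa(1) F.algebra_congruence_axioms that] by simp
  qed

  have \<phi>_gen: "\<phi>.\<phi> (Th r) = b r - 1" if "r \<in> {1..<d}" for r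
    using that by (simp add: hecke_images_def)
  have \<phi>_X: "\<phi>.\<phi> (Xh r) = X r" "\<phi>.\<phi> (Xhinv r) = Y r" if "r \<in> {1..d}" for r
    using that by (simp_all add: hecke_images_def)
  have \<psi>_gen: "\<psi>.\<phi> (sd r) = a r - 1" if "r \<in> {1..<d}" for r
    using that by (simp add: degen_images_def)
  have \<psi>_x: "\<psi>.\<phi> (xd r) = x r" if "r \<in> {1..d}" for r
    using that by (simp add: degen_images_def)
  have \<psi>_X: "\<psi>.\<phi> (X r) - Xh r \<in> K" if "r \<in> {1..d}" for r
    using xa(2)[OF that] unfolding X_def \<psi>.lift_pe \<psi>_x[OF that] .
  have "\<psi>.\<phi> (\<phi>.\<phi> z) - z \<in> K" for z
  proof (rule free_algebra_agree[where \<phi> = "\<lambda>z. \<psi>.\<phi> (\<phi>.\<phi> z)" and \<psi> = "\<lambda>z. z", OF ideal(1)])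
    fix g
    show "\<psi>.\<phi> (\<phi>.\<phi> (gen g)) - gen g \<in> K"
    proof (cases "g \<in> hecke_gens d")
      case False
      then have "\<phi>.\<phi> (gen g) = 0"
        by (cases g) (auto simp: hecke_images_def)
      moreover have "gen g \<in> K"
        unfolding K_def using False generated_ideal_superset by (force simp: cyclotomic_gens_def)
      ultimately show ?thesis
        using two_sided_idealD(4)[OF ideal(1)] by (simp add: \<psi>.lift_simps)
    next
      case True
      show ?thesis
      proof (cases g)
        case (T_gen r)
        with True have r: "r \<in> {1..<d}" by simp
        \<comment> \<open>The lift sends \<open>sd r + 1\<close> to \<open>a r\<close> and
          \<open>xd r\<close> to \<open>x r\<close>, and it commutes with
          \<open>twist_factor\<close>; so the image of \<open>b r\<close> is the left side of the
          inverse law \<open>xa(3)\<close>.\<close>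
        have eq: "\<psi>.\<phi> (b r - 1) = a r * H.twist_factor 1 1 E L (x r) (x (Suc r)) - 1"
          using r by (simp add: b_def \<psi>.lift_simps \<psi>.lift_twist_factor \<psi>_gen \<psi>_x del: \<psi>.lift_gen)
        show ?thesis
          using xa(3)[OF r] unfolding T_gen \<phi>_gen[OF r] eq by (simp add: algebra_simps)
      next
        case (X_gen r)
        with True show ?thesis
          using \<psi>_X[of r] by (simp add: \<phi>_X del: \<phi>.lift_gen)
      next
        case (Xinv_gen r)
        with True have r: "r \<in> {1..d}" by simp
        have "\<psi>.\<phi> (Y r) = H.pe (smult (- inverse (poly p 0)) (synthetic_div p 0)) (\<psi>.\<phi> (X r))"
          by (simp only: Y_def \<psi>.lift_pe)
        with H.eq_trans[OF H.pe_cong[OF \<psi>_X[OF r]] Xinv[OF r]] show ?thesis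
          unfolding Xinv_gen \<phi>_X(2)[OF r] by (simp only:)
      qed
    qed
  qed (simp_all add: \<phi>.lift_simps \<psi>.lift_simps)
  then have inverse: "\<pi> (\<psi>.\<phi> (\<phi>.\<phi> z)) = \<pi> z" for z
    by (simp add: \<pi>(2))

  have \<phi>_x: "\<phi>.\<phi> (x r) - xd r \<in> K'" if "r \<in> {1..d}" for r
    using Xb(2)[OF that] unfolding x_def \<phi>.lift_pe \<phi>_X(1)[OF that] .
  have "\<phi>.\<phi> (\<psi>.\<phi> z) - z \<in> K'" for z
  proof (rule free_algebra_agree[where \<phi> = "\<lambda>z. \<phi>.\<phi> (\<psi>.\<phi> z)" and \<psi> = "\<lambda>z. z", OF ideal(2)])
    fix g
    show "\<phi>.\<phi> (\<psi>.\<phi> (gen g)) - gen g \<in> K'"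
    proof (cases "g \<in> degen_gens d")
      case False
      then have "\<psi>.\<phi> (gen g) = 0"
        by (cases g) (auto simp: degen_images_def)
      moreover have "gen g \<in> K'"
        unfolding K'_def using False generated_ideal_superset by (force simp: cyclotomic_gens_def)
      ultimately show ?thesis
        using two_sided_idealD(4)[OF ideal(2)] by (simp add: \<phi>.lift_simps)
    next
      case True
      show ?thesis
      proof (cases g)
        case (s_gen r)
        with True have r: "r \<in> {1..<d}" by simp
        have eq: "\<phi>.\<phi> (a r - 1) = b r * D.twist_factor q 0 L E (X r) (X (Suc r)) - 1"
          using r by (simp add: a_def \<phi>.lift_simps \<phi>.lift_twist_factor \<phi>_gen \<phi>_X del: \<phi>.lift_gen)
        show ?thesis
          using Xb(3)[OF r] unfolding s_gen \<psi>_gen[OF r] eq by (simp add: algebra_simps)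
      next
        case (x_gen r)
        with True show ?thesis
          using \<phi>_x[of r] by (simp add: \<psi>_x del: \<psi>.lift_gen)
      qed
    qed
  qed (simp_all add: \<phi>.lift_simps \<psi>.lift_simps)
  then have inverse': "\<pi>' (\<phi>.\<phi> (\<psi>.\<phi> z)) = \<pi>' z" for z
    by (simp add: \<pi>'(2))

  show ?thesis
  proof (rule algebra_isomorphic_if_inverse[OF \<pi>(1) \<pi>'(1), of \<phi>.\<phi> \<psi>.\<phi>])
    show "\<pi>' (\<phi>.\<phi> z) = \<pi>' (\<phi>.\<phi> w)" if "\<pi> z = \<pi> w" for z w
      using \<phi>_rel[of "z - w"] that by (simp add: \<pi>(2) \<pi>'(2) \<phi>.lift_simps)
    show "\<pi> (\<psi>.\<phi> z) = \<pi> (\<psi>.\<phi> w)" if "\<pi>' z = \<pi>' w" for z w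
      using \<psi>_rel[of "z - w"] that by (simp add: \<pi>(2) \<pi>'(2) \<psi>.lift_simps)
  qed (simp_all add: \<phi>.lift_simps inverse inverse')
qed

end
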